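(* Each entire space-like stationary graph $M$ of a function $F:\mathbb{R}^{1,1}\to\mathbb{R}^2$ is a complete degenerate stationary surface of elliptic type. Moreover, if $M$ is nonflat, then each $\psi_i$ ($i=1,2$) takes each point of $\mathbb{C}^*=\mathbb{C}\cup\{\infty\}$ infinitely many times, with the exception of exactly $2$ points, and the total Gauss curvature of $M$ is $\infty$ (i.e. $\int_M K\,dA_M$ is not absolutely convergent).
   Context: $\mathbb{R}^{3,1}$ is $\mathbb{R}^4$ with the Minkowski inner product $\langle u,v\rangle=u_1v_1+u_2v_2+u_3v_3-u_4v_4$, extended complex-bilinearly to $\mathbb{C}^4$. A surface is space-like if its induced metric is positive definite; it is stationary if its mean curvature vector field vanishes identically, complete if the induced metric is complete, nonflat if its Gauss curvature $K$ is not identically $0$. The entire graph of $F=(F_1,F_2):\mathbb{R}^{1,1}\to\mathbb{R}^2$ is $M=\{(F_1(u_1,u_2),F_2(u_1,u_2),u_1,u_2):(u_1,u_2)\in\mathbb{R}^{1,1}\}\subset\mathbb{R}^{3,1}$ (a graph over the time-like $x_3x_4$-plane). Let $Q_{1,1}=\{[z]\in\mathbb{CP}^3:\langle z,z\rangle=0\}$, $Q_{1,1}^+=\{[z]\in Q_{1,1}:\langle z,\bar z\rangle>0\}$, $\mathbb{C}^*=\mathbb{C}\cup\{\infty\}$. There is a biholomorphism $\Psi:Q_{1,1}\to\mathbb{C}^*\times\mathbb{C}^*$ with inverse $(w_1,w_2)\mapsto[(w_1+w_2,-i(w_1-w_2),1-w_1w_2,1+w_1w_2)]$ for $w_1,w_2\in\mathbb{C}$,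 $(w_1,\infty)\mapsto[(1,i,-w_1,w_1)]$, $(\infty,w_2)\mapsto[(1,-i,-w_2,w_2)]$, $(\infty,\infty)\mapsto[(0,0,-1,1)]$. With local complex coordinate $z=u+iv$ from oriented isothermal parameters, the Gauss map of a space-like stationary surface $\mathbf{x}:M\to\mathbb{R}^{3,1}$ is $p\mapsto[\mathbf{x}_z]\in Q_{1,1}^+$, and $(\psi_1,\psi_2):=\Psi([\mathbf{x}_z])$ are holomorphic maps $M\to\mathbb{C}^*$. For $[A]\in\mathbb{CP}^3$, $H_A=\{[z]\in Q_{1,1}:\langle A,z\rangle=0\}$. $M$ is a degenerate stationary surface of elliptic type if its Gauss image lies in some $H_A$ such that $\mathrm{Re}\,A,\mathrm{Im}\,A$ are linearly independent and span a time-like $2$-plane (induced inner product Lorentzian). *)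

theory Defs
  imports "HOL-Analysis.Analysis"
begin

section \<open>Smooth maps\<close>

primrec Ck_on :: "nat \<Rightarrow> 'a::euclidean_space set \<Rightarrow> ('a \<Rightarrow> 'b::real_normed_vector) \<Rightarrow> bool" where
  "Ck_on 0 S f \<longleftrightarrow> continuous_on S f"
| "Ck_on (Suc k) S f \<longleftrightarrow> (\<forall>x\<in>S. f differentiable at x) \<and>
     (\<forall>b\<in>Basis. Ck_on k S (\<lambda>x. frechet_derivative f (at x) b))"

text \<open>\<^term>\<open>S\<close> is meant to be open.\<close>
definition smooth_on :: "'a::euclidean_space set \<Rightarrow> ('a \<Rightarrow> 'b::real_normed_vector) \<Rightarrow> bool" where
  "smooth_on S f \<longleftrightarrow> (\<forall>k. Ck_on k S f)"

definition pd :: "2 \<Rightarrow> (real^2 \<Rightarrow> 'b::real_normed_vector) \<Rightarrow> real^2 \<Rightarrow> 'b" where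
  "pd i f u = frechet_derivative f (at u) (axis i 1)"


section \<open>Minkowski space\<close>

text \<open>Over the reals this is the Minkowski inner product; over the complex numbers it is its
  complex-bilinear (not Hermitian) extension.\<close>
definition mink :: "'a::comm_ring_1^4 \<Rightarrow> 'a^4 \<Rightarrow> 'a" where
  "mink u v = u$1 * v$1 + u$2 * v$2 + u$3 * v$3 - u$4 * v$4"

definition lorentzian_plane :: "(real^4) set \<Rightarrow> bool" where
  "lorentzian_plane P \<longleftrightarrow> subspace P \<and> dim P = 2 \<and>
     (\<exists>v\<in>P. \<exists>w\<in>P. mink v v > 0 \<and> mink w w < 0 \<and> mink v w = 0)"


section \<open>Surfaces parametrized by the plane\<close>

text \<open>A surface is given by a map \<open>X\<close> from the plane, and everything on the surface is pulled back to
  the parameter plane: the surface point \<open>X u\<close> is represented by \<open>u\<close>.\<close>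

definition spacelike :: "(real^2 \<Rightarrow> real^4) \<Rightarrow> bool" where
  "spacelike X \<longleftrightarrow> (\<forall>u v. v \<noteq> 0 \<longrightarrow>
     mink (frechet_derivative X (at u) v) (frechet_derivative X (at u) v) > 0)"

definition fff :: "(real^2 \<Rightarrow> real^4) \<Rightarrow> real^2 \<Rightarrow> real^2^2" where
  "fff X u = (\<chi> i j. mink (pd i X u) (pd j X u))"

definition ginv :: "(real^2 \<Rightarrow> real^4) \<Rightarrow> real^2 \<Rightarrow> real^2^2" where
  "ginv X u = matrix_inv (fff X u)"

definition normal_part :: "(real^2 \<Rightarrow> real^4) \<Rightarrow> real^2 \<Rightarrow> real^4 \<Rightarrow> real^4" where
  "normal_part X u v =
     v - (\<Sum>i\<in>UNIV. \<Sum>j\<in>UNIV. (ginv X u $ i $ j * mink v (pd i X u)) *\<^sub>R pd j X u)"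

definition second_ff :: "(real^2 \<Rightarrow> real^4) \<Rightarrow> real^2 \<Rightarrow> 2 \<Rightarrow> 2 \<Rightarrow> real^4" where
  "second_ff X u i j = normal_part X u (pd i (pd j X) u)"

definition mean_curvature :: "(real^2 \<Rightarrow> real^4) \<Rightarrow> real^2 \<Rightarrow> real^4" where
  "mean_curvature X u = (1/2) *\<^sub>R (\<Sum>i\<in>UNIV. \<Sum>j\<in>UNIV. (ginv X u $ i $ j) *\<^sub>R second_ff X u i j)"

definition stationary :: "(real^2 \<Rightarrow> real^4) \<Rightarrow> bool" where
  "stationary X \<longleftrightarrow> (\<forall>u. mean_curvature X u = 0)"


subsection \<open>Gauss curvature, area and completeness of the induced metric\<close>

text \<open>\<open>christoffel X k i j\<close> has the upper index \<open>k\<close>.\<close>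
definition christoffel :: "(real^2 \<Rightarrow> real^4) \<Rightarrow> 2 \<Rightarrow> 2 \<Rightarrow> 2 \<Rightarrow> real^2 \<Rightarrow> real" where
  "christoffel X k i j u = (1/2) * (\<Sum>l\<in>UNIV. ginv X u $ k $ l *
     (pd i (\<lambda>w. fff X w $ j $ l) u + pd j (\<lambda>w. fff X w $ i $ l) u - pd l (\<lambda>w. fff X w $ i $ j) u))"

text \<open>The component along the \<open>l\<close>-th coordinate field of \<open>R(e\<^sub>i, e\<^sub>j) e\<^sub>k\<close>, where \<open>e\<^sub>1\<close> and \<open>e\<^sub>2\<close> are the
  coordinate fields and \<open>R(V, W) = D\<^sub>V D\<^sub>W - D\<^sub>W D\<^sub>V\<close> for commuting fields \<open>V\<close>, \<open>W\<close>.\<close>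
definition riemann :: "(real^2 \<Rightarrow> real^4) \<Rightarrow> 2 \<Rightarrow> 2 \<Rightarrow> 2 \<Rightarrow> 2 \<Rightarrow> real^2 \<Rightarrow> real" where
  "riemann X l i j k u = pd i (christoffel X l j k) u - pd j (christoffel X l i k) u
     + (\<Sum>m\<in>UNIV. christoffel X m j k u * christoffel X l i m u
                 - christoffel X m i k u * christoffel X l j m u)"

text \<open>\<open>K = g(R(e\<^sub>1, e\<^sub>2) e\<^sub>2, e\<^sub>1) / det g\<close>, which is positive on round spheres.\<close>
definition gauss_curvature :: "(real^2 \<Rightarrow> real^4) \<Rightarrow> real^2 \<Rightarrow> real" where
  "gauss_curvature X u = (\<Sum>l\<in>UNIV. riemann X l 1 2 2 u * fff X u $ l $ 1) / det (fff X u)"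

definition nonflat :: "(real^2 \<Rightarrow> real^4) \<Rightarrow> bool" where
  "nonflat X \<longleftrightarrow> (\<exists>u. gauss_curvature X u \<noteq> 0)"

definition area_measure :: "(real^2 \<Rightarrow> real^4) \<Rightarrow> (real^2) measure" where
  "area_measure X = density lborel (\<lambda>u. ennreal (sqrt (det (fff X u))))"

text \<open>A valid path may have unbounded velocity near its finitely many corners; the extended
  nonnegative integral then still gives its true, possibly infinite, length.\<close>
definition curve_length :: "(real \<Rightarrow> real^4) \<Rightarrow> ennreal" where
  "curve_length c = (\<integral>\<^sup>+t\<in>{0..1}.
     ennreal (sqrt (mink (vector_derivative c (at t)) (vector_derivative c (at t)))) \<partial>lborel)"

definition riem_dist :: "(real^2 \<Rightarrow> real^4) \<Rightarrow> real^2 \<Rightarrow> real^2 \<Rightarrow> real" where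
  "riem_dist X p q = enn2real
     (INF \<gamma>\<in>{\<gamma>. valid_path \<gamma> \<and> pathstart \<gamma> = p \<and> pathfinish \<gamma> = q}. curve_length (X \<circ> \<gamma>))"

definition complete_surface :: "(real^2 \<Rightarrow> real^4) \<Rightarrow> bool" where
  "complete_surface X \<longleftrightarrow>
     Metric_space UNIV (riem_dist X) \<and> Metric_space.mcomplete UNIV (riem_dist X)"


section \<open>The quadric in complex projective 3-space\<close>

text \<open>A point of projective space is represented by the set of its homogeneous coordinate vectors.\<close>
definition proj :: "complex^4 \<Rightarrow> (complex^4) set" where
  "proj z = {c *s z | c. c \<noteq> 0}"

definition Q11 :: "(complex^4) set set" where
  "Q11 = {proj z | z. z \<noteq> 0 \<and> mink z z = 0}"

definition hyperplane_section :: "complex^4 \<Rightarrow> (complex^4) set set" where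
  "hyperplane_section A = {L \<in> Q11. \<forall>z\<in>L. mink A z = 0}"

text \<open>The extended complex plane is \<^typ>\<open>complex option\<close>, with \<^const>\<open>None\<close> as the point at infinity.\<close>
fun Psi_inv :: "complex option \<times> complex option \<Rightarrow> (complex^4) set" where
  "Psi_inv (Some w1, Some w2) = proj (vector [w1 + w2, - \<i> * (w1 - w2), 1 - w1 * w2, 1 + w1 * w2])"
| "Psi_inv (Some w1, None) = proj (vector [1, \<i>, - w1, w1])"
| "Psi_inv (None, Some w2) = proj (vector [1, - \<i>, - w2, w2])"
| "Psi_inv (None, None) = proj (vector [0, 0, - 1, 1])"

definition Psi :: "(complex^4) set \<Rightarrow> complex option \<times> complex option" where
  "Psi = the_inv_into UNIV Psi_inv"


section \<open>The Gauss map\<close>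

definition pdu :: "(complex \<Rightarrow> 'b::real_normed_vector) \<Rightarrow> complex \<Rightarrow> 'b" where
  "pdu f z = frechet_derivative f (at z) 1"

definition pdv :: "(complex \<Rightarrow> 'b::real_normed_vector) \<Rightarrow> complex \<Rightarrow> 'b" where
  "pdv f z = frechet_derivative f (at z) \<i>"

definition wirtinger :: "(complex \<Rightarrow> real^4) \<Rightarrow> complex \<Rightarrow> complex^4" where
  "wirtinger x z = (\<chi> k. (of_real (pdu x z $ k) - \<i> * of_real (pdv x z $ k)) / 2)"

text \<open>Local isothermal parameters \<open>z = u + iv\<close> for \<open>X\<close>, as a reparametrization \<open>\<phi>\<close> of an open part of
  the parameter plane. The sign \<open>\<sigma>\<close> selects the orientation of the surface: the standard one of
  the parameter plane for \<open>\<sigma> = 1\<close>, the opposite one for \<open>\<sigma> = -1\<close>.\<close>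
definition isothermal_chart ::
  "real \<Rightarrow> (real^2 \<Rightarrow> real^4) \<Rightarrow> complex set \<Rightarrow> (complex \<Rightarrow> real^2) \<Rightarrow> bool" where
  "isothermal_chart \<sigma> X D \<phi> \<longleftrightarrow> open D \<and> smooth_on D \<phi> \<and> inj_on \<phi> D \<and>
     (\<forall>z\<in>D. \<sigma> * (pdu \<phi> z $ 1 * pdv \<phi> z $ 2 - pdu \<phi> z $ 2 * pdv \<phi> z $ 1) > 0 \<and>
        mink (pdu (X \<circ> \<phi>) z) (pdu (X \<circ> \<phi>) z) = mink (pdv (X \<circ> \<phi>) z) (pdv (X \<circ> \<phi>) z) \<and>
        mink (pdu (X \<circ> \<phi>) z) (pdv (X \<circ> \<phi>) z) = 0)"

definition gauss_map :: "real \<Rightarrow> (real^2 \<Rightarrow> real^4) \<Rightarrow> real^2 \<Rightarrow> (complex^4) set" where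
  "gauss_map \<sigma> X p = (THE L. \<exists>D \<phi>. \<exists>z\<in>D.
     isothermal_chart \<sigma> X D \<phi> \<and> \<phi> z = p \<and> L = proj (wirtinger (X \<circ> \<phi>) z))"

definition psi1 :: "real \<Rightarrow> (real^2 \<Rightarrow> real^4) \<Rightarrow> real^2 \<Rightarrow> complex option" where
  "psi1 \<sigma> X p = fst (Psi (gauss_map \<sigma> X p))"

definition psi2 :: "real \<Rightarrow> (real^2 \<Rightarrow> real^4) \<Rightarrow> real^2 \<Rightarrow> complex option" where
  "psi2 \<sigma> X p = snd (Psi (gauss_map \<sigma> X p))"

definition degenerate_stationary_elliptic :: "real \<Rightarrow> (real^2 \<Rightarrow> real^4) \<Rightarrow> bool" where
  "degenerate_stationary_elliptic \<sigma> X \<longleftrightarrow> smooth_on UNIV X \<and> spacelike X \<and> stationary X \<and>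
     (\<exists>A. range (gauss_map \<sigma> X) \<subseteq> hyperplane_section A \<and>
        (let a = (\<chi> k. Re (A $ k)); b = (\<chi> k. Im (A $ k))
         in a \<noteq> b \<and> independent {a, b} \<and> lorentzian_plane (span {a, b})))"


section \<open>Graphs over the time-like plane\<close>

definition graph_param :: "(real^2 \<Rightarrow> real^2) \<Rightarrow> real^2 \<Rightarrow> real^4" where
  "graph_param F u = vector [F u $ 1, F u $ 2, u $ 1, u $ 2]"

lemma vector_4:
  "(vector [a,b,c,d]::('a::zero)^4)$1 = a" "(vector [a,b,c,d]::'a^4)$2 = b"
  "(vector [a,b,c,d]::'a^4)$3 = c" "(vector [a,b,c,d]::'a^4)$4 = d"
  by (simp_all add: vector_def)

end

theory Submission
  imports Defs "HOL-Complex_Analysis.Complex_Analysis"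
begin

text \<open>Let \<open>(E, M, G)\<close> be the first fundamental form of the graph and \<open>W\<^sup>2\<close> its determinant.
  Stationarity makes the rows of \<open>(E, M; M, G) / W\<close> closed, so this matrix is the Hessian of a
  solution of \<open>det D\<^sup>2u = 1\<close> on the plane, and by Joergens' theorem it is a constant
  \<open>(r, s; s, t)\<close>. The induced metric is thus conformal to a constant one: a linear map \<open>L\<close> is a
  global isothermal chart, in which \<open>2x\<^sub>z = (h\<^sub>1, h\<^sub>2, a, b)\<close> with entire \<open>h\<^sub>k\<close> and constants \<open>a\<close>, \<open>b\<close>
  that are linearly independent over the reals. Hence the Gauss image lies in the hyperplane
  of \<open>(0, 0, b, a)\<close>, and \<open>\<psi>\<^sub>1 = (h\<^sub>1 + \<i> h\<^sub>2) / (a + b)\<close>, \<open>\<psi>\<^sub>2 = (h\<^sub>1 - \<i> h\<^sub>2) / (a + b)\<close> are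
  entire functions whose product is the non-real constant \<open>m = (b - a) / (a + b)\<close>. That keeps \<open>W\<close>
  away from \<open>0\<close>, which gives completeness.

  In the nonflat case \<open>\<psi>\<^sub>1\<close> is a constant times \<open>exp B\<close> with \<open>B\<close> entire and nonconstant. By the little
  Picard theorem \<open>B\<close> omits at most one value, so \<open>exp B\<close> takes every nonzero value infinitely often.
  Moreover \<open>K dA\<close> is the pull-back under \<open>B\<close> of a form \<open>k(x) dx dy\<close> that does not depend on \<open>y\<close>, and
  the image of \<open>B\<close> is almost the whole plane.\<close>

text \<open>The time-like direction contributes a \<open>- 1\<close> to the metric, so being an
  entire graph gives no lower bound for it and completeness cannot be read off directly. It needs
  the rigidity of the conformal class first. With \<open>Z = (b - a) * cnj (a + b)\<close> one has
  \<open>2 W \<ge> |Z| - Re Z\<close>, and \<open>Im Z = - 2 \<sigma>\<close> is not zero; this is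
  how non-reality of \<open>m\<close> bounds \<open>W\<close> from below. The closedness of the two
  rows says that the coordinates \<open>x_4\<close> and \<open>x_3\<close> are harmonic on the
  surface, a consequence of stationarity. The condition \<open>det = 1\<close> is just the
  normalization by \<open>W\<close>. The two exceptional values are \<open>0\<close> and the point
  at infinity, since each component of the Gauss map is entire and zero-free. The density
  \<open>k(x) = (1 - c cosh 2x) / (cosh 2x - c)^2\<close> with \<open>c < 1\<close> changes sign
  when \<open>c > 0\<close>. The divergence therefore concerns the integral of \<open>|K|\<close>:
  \<open>k\<close> does not vanish near \<open>x = 0\<close>, and a vertical strip in the image
  plane of \<open>B\<close> has infinite area.\<close>

no_notation fps_nth (infixl "$" 75)

section \<open>Joergens' theorem\<close>

text \<open>Poincare lemma on a star-shaped domain: the potential is the integral of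
  \<open>V (t z) \<bullet> z\<close> over \<open>t\<close> in \<open>[0, 1]\<close>, differentiated
  under the integral sign.\<close>

lemma closed_field_has_potential:
  fixes V :: "'a::euclidean_space \<Rightarrow> 'a"
  assumes V: "\<And>x. (V has_derivative V' x) (at x)"
    and cont: "\<And>h. continuous_on UNIV (\<lambda>x. V' x h)"
    and sym: "\<And>x h k. V' x h \<bullet> k = V' x k \<bullet> h"
  obtains P where "\<And>x. (P has_derivative (\<lambda>h. V x \<bullet> h)) (at x)"
proof
  fix x
  \<comment> \<open>\<open>g z t\<close> is the derivative of \<open>t V (t z)\<close> in
    \<open>t\<close>. By the symmetry of \<open>V'\<close> it is also the gradient in
    \<open>z\<close> of the integrand \<open>V (t z) \<bullet> z\<close>, so the gradient of the
    potential telescopes to \<open>V\<close>.\<close>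
  define g where "g z t = t *\<^sub>R V' (t *\<^sub>R z) z + V (t *\<^sub>R z)" for z t
  have lin: "linear (V' y)" for y
    by (rule has_derivative_linear[OF V])
  have contV: "continuous_on UNIV V"
    by (intro continuous_at_imp_continuous_on ballI has_derivative_continuous[OF V])
  \<comment> \<open>Continuity of \<open>V'\<close> is assumed only for a fixed direction; expanding
    the direction in the finite basis gives the joint continuity that differentiation under the
    integral requires.\<close>
  have expand: "V' y h = (\<Sum>b\<in>Basis. (h \<bullet> b) *\<^sub>R V' y b)" for y h
  proof -
    have "V' y h = V' y (\<Sum>b\<in>Basis. (h \<bullet> b) *\<^sub>R b)" by (simp add: euclidean_representation)
    then show ?thesis by (simp add: linear_sum[OF lin] linear_cmul[OF lin])
  qed
  have "continuous_on UNIV (\<lambda>p. g (fst p) (snd p))"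
  proof -
    have "continuous_on UNIV (\<lambda>p. V' (snd p *\<^sub>R fst p) (fst p))"
      by (subst expand) (intro continuous_intros continuous_on_compose2[OF cont], auto)
    moreover have "continuous_on UNIV (\<lambda>p. V (snd p *\<^sub>R fst p :: 'a))"
      by (intro continuous_on_compose2[OF contV] continuous_intros) auto
    ultimately show ?thesis unfolding g_def by (intro continuous_intros)
  qed
  then have contg: "continuous_on S (\<lambda>p. g (fst p) (snd p))" for S
    using continuous_on_subset by blast
  have 1: "((\<lambda>z. V (t *\<^sub>R z) \<bullet> z) has_derivative blinfun_apply (blinfun_inner_left (g z t))) (at z within UNIV)" for z t
  proof -
    have "((\<lambda>z. V (t *\<^sub>R z)) has_derivative (\<lambda>h. V' (t *\<^sub>R z) (t *\<^sub>R h))) (at z)"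
      by (rule has_derivative_compose[OF _ V]) (auto intro!: derivative_eq_intros)
    then have "((\<lambda>z. V (t *\<^sub>R z) \<bullet> z) has_derivative (\<lambda>h. V (t *\<^sub>R z) \<bullet> h + V' (t *\<^sub>R z) (t *\<^sub>R h) \<bullet> z)) (at z)"
      by (rule has_derivative_inner) (rule has_derivative_ident)
    moreover have "V' (t *\<^sub>R z) (t *\<^sub>R h) \<bullet> z = (t *\<^sub>R V' (t *\<^sub>R z) z) \<bullet> h" for h
      by (simp add: linear_cmul[OF lin] sym[of _ h z])
    ultimately show ?thesis
      by (simp add: g_def inner_add_right inner_commute add.commute)
  qed
  have 2: "(\<lambda>t. V (t *\<^sub>R z) \<bullet> z) integrable_on cbox 0 (1::real)" for z
    by (intro integrable_continuous continuous_intros continuous_on_compose2[OF contV]) auto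
  have 3: "continuous_on (UNIV \<times> cbox 0 (1::real)) (\<lambda>(z, t). blinfun_inner_left (g z t))"
    unfolding split_beta by (intro continuous_intros contg)
  have "(g x has_integral 1 *\<^sub>R V (1 *\<^sub>R x) - 0 *\<^sub>R V (0 *\<^sub>R x)) {0..1}"
  proof (rule fundamental_theorem_of_calculus)
    fix t :: real
    have "((\<lambda>t. V (t *\<^sub>R x)) has_derivative (\<lambda>d. V' (t *\<^sub>R x) (d *\<^sub>R x))) (at t)"
      by (rule has_derivative_compose[OF _ V]) (auto intro!: derivative_eq_intros)
    then have "((\<lambda>t. V (t *\<^sub>R x)) has_vector_derivative V' (t *\<^sub>R x) x) (at t)"
      by (simp add: has_vector_derivative_def linear_cmul[OF lin])
    from has_vector_derivative_scaleR[OF _ this, of id 1]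
    have "((\<lambda>t. t *\<^sub>R V (t *\<^sub>R x)) has_vector_derivative g x t) (at t)"
      by (simp add: g_def id_def)
    then show "((\<lambda>t. t *\<^sub>R V (t *\<^sub>R x)) has_vector_derivative g x t) (at t within {0..1})"
      by (rule has_vector_derivative_at_within)
  qed simp
  then have "((\<lambda>t. blinfun_inner_left (g x t)) has_integral blinfun_inner_left (V x)) (cbox 0 1)"
    using has_integral_linear[OF _ bounded_linear_blinfun_inner_left, of "g x" "V x" "{0..1}"] by (simp add: o_def)
  then have "integral (cbox 0 1) (\<lambda>t. blinfun_inner_left (g x t)) = blinfun_inner_left (V x)"
    by (rule integral_unique)
  with leibniz_rule[OF 1 2 3, of x]
  show "((\<lambda>z. integral (cbox 0 1) (\<lambda>t. V (t *\<^sub>R z) \<bullet> z)) has_derivative (\<lambda>h. V x \<bullet> h)) (at x)"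
    by (simp add: inner_commute)
qed

text \<open>The second difference of \<open>f\<close> over a small parallelogram is symmetric in its
  two sides. Two applications of the mean value theorem express it by \<open>gh\<close> or by
  \<open>gk\<close>, depending on which side is treated first, at points that tend to
  \<open>x\<close>.\<close>

lemma mixed_second_derivatives_eq:
  fixes f :: "'a::real_normed_vector \<Rightarrow> real"
  assumes f: "\<And>x. (f has_derivative f' x) (at x)"
    and gh: "\<And>x. ((\<lambda>x. f' x h) has_derivative gh x) (at x)"
    and gk: "\<And>x. ((\<lambda>x. f' x k) has_derivative gk x) (at x)"
    and ch: "continuous (at x) (\<lambda>y. gh y k)"
    and ck: "continuous (at x) (\<lambda>y. gk y h)"
  shows "gh x k = gk x h"
proof -
  have dir: "((\<lambda>\<tau>. q (y + \<tau> *\<^sub>R v)) has_real_derivative q' (y + \<tau> *\<^sub>R v) v) (at \<tau>)"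
    if "\<And>x. (q has_derivative q' x) (at x)" for q :: "'a \<Rightarrow> real" and q' y v \<tau>
  proof -
    have "((\<lambda>\<tau>. q (y + \<tau> *\<^sub>R v)) has_derivative (\<lambda>d. q' (y + \<tau> *\<^sub>R v) (d *\<^sub>R v))) (at \<tau>)"
      by (rule has_derivative_compose[OF _ that]) (auto intro!: derivative_eq_intros)
    then show ?thesis
      using linear_cmul[OF has_derivative_linear[OF that]]
      by (simp add: has_field_derivative_def mult.commute[of _ "q' _ _"])
  qed
  have quot: "\<exists>\<xi> \<eta>. 0 < \<xi> \<and> \<xi> < \<epsilon> \<and> 0 < \<eta> \<and> \<eta> < \<epsilon> \<and>
      f (x + \<epsilon> *\<^sub>R u + \<epsilon> *\<^sub>R v) - f (x + \<epsilon> *\<^sub>R u) - f (x + \<epsilon> *\<^sub>R v) + f x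
        = \<epsilon> * (\<epsilon> * gu (x + \<xi> *\<^sub>R u + \<eta> *\<^sub>R v) v)"
    if \<epsilon>: "0 < \<epsilon>" and gu: "\<And>x. ((\<lambda>x. f' x u) has_derivative gu x) (at x)" for \<epsilon> u v gu
  proof -
    have "\<exists>\<xi>>0. \<xi> < \<epsilon> \<and> (f (x + \<epsilon> *\<^sub>R v + \<epsilon> *\<^sub>R u) - f (x + \<epsilon> *\<^sub>R u)) - (f (x + \<epsilon> *\<^sub>R v + 0 *\<^sub>R u) - f (x + 0 *\<^sub>R u))
        = (\<epsilon> - 0) * (f' (x + \<epsilon> *\<^sub>R v + \<xi> *\<^sub>R u) u - f' (x + \<xi> *\<^sub>R u) u)"
      by (rule MVT2[OF \<epsilon>]) (intro DERIV_diff dir f)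
    then obtain \<xi> where \<xi>: "0 < \<xi>" "\<xi> < \<epsilon>" and 1: "(f (x + \<epsilon> *\<^sub>R v + \<epsilon> *\<^sub>R u) - f (x + \<epsilon> *\<^sub>R u)) - (f (x + \<epsilon> *\<^sub>R v + 0 *\<^sub>R u) - f (x + 0 *\<^sub>R u))
        = (\<epsilon> - 0) * (f' (x + \<epsilon> *\<^sub>R v + \<xi> *\<^sub>R u) u - f' (x + \<xi> *\<^sub>R u) u)" by blast
    have "\<exists>\<eta>>0. \<eta> < \<epsilon> \<and> f' (x + \<xi> *\<^sub>R u + \<epsilon> *\<^sub>R v) u - f' (x + \<xi> *\<^sub>R u + 0 *\<^sub>R v) u
        = (\<epsilon> - 0) * gu (x + \<xi> *\<^sub>R u + \<eta> *\<^sub>R v) v"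
      by (rule MVT2[OF \<epsilon>]) (intro dir gu)
    then obtain \<eta> where \<eta>: "0 < \<eta>" "\<eta> < \<epsilon>" and 2: "f' (x + \<xi> *\<^sub>R u + \<epsilon> *\<^sub>R v) u - f' (x + \<xi> *\<^sub>R u + 0 *\<^sub>R v) u
        = (\<epsilon> - 0) * gu (x + \<xi> *\<^sub>R u + \<eta> *\<^sub>R v) v" by blast
    have 3: "x + \<epsilon> *\<^sub>R v + w *\<^sub>R u = x + w *\<^sub>R u + \<epsilon> *\<^sub>R v" for w by simp
    show ?thesis
      using \<xi> \<eta> 1 2 unfolding 3 by (intro exI[of _ \<xi>] exI[of _ \<eta>]) simp
  qed
  have lim: "((\<lambda>n. G (x + \<xi> n *\<^sub>R u + \<eta> n *\<^sub>R v)) \<longlonglongrightarrow> G x)"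
    if "\<And>n. 0 < \<xi> n \<and> \<xi> n < inverse (real (Suc n)) \<and> 0 < \<eta> n \<and> \<eta> n < inverse (real (Suc n))"
      and "continuous (at x) G" for G :: "'a \<Rightarrow> real" and \<xi> \<eta> u v
  proof -
    have z: "\<xi> \<longlonglongrightarrow> 0" "\<eta> \<longlonglongrightarrow> 0"
      by (rule real_tendsto_sandwich[OF _ _ tendsto_const LIMSEQ_inverse_real_of_nat]; use that(1) in \<open>auto intro!: always_eventually less_imp_le\<close>)+
    have "(\<lambda>n. x + \<xi> n *\<^sub>R u + \<eta> n *\<^sub>R v) \<longlonglongrightarrow> x + 0 *\<^sub>R u + 0 *\<^sub>R v"
      by (intro tendsto_intros z)
    then show ?thesis
      using that(2) isCont_tendsto_compose by fastforce
  qed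
  let ?e = "\<lambda>n. inverse (real (Suc n))"
  have e: "?e n > 0" for n by simp
  have "\<forall>n. \<exists>\<xi> \<eta>. 0 < \<xi> \<and> \<xi> < ?e n \<and> 0 < \<eta> \<and> \<eta> < ?e n \<and>
      f (x + ?e n *\<^sub>R h + ?e n *\<^sub>R k) - f (x + ?e n *\<^sub>R h) - f (x + ?e n *\<^sub>R k) + f x
        = ?e n * (?e n * gh (x + \<xi> *\<^sub>R h + \<eta> *\<^sub>R k) k)"
    by (intro allI quot[OF e gh])
  then obtain \<xi> \<eta> where 1: "\<And>n. 0 < \<xi> n \<and> \<xi> n < ?e n \<and> 0 < \<eta> n \<and> \<eta> n < ?e n \<and>
      f (x + ?e n *\<^sub>R h + ?e n *\<^sub>R k) - f (x + ?e n *\<^sub>R h) - f (x + ?e n *\<^sub>R k) + f x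
        = ?e n * (?e n * gh (x + \<xi> n *\<^sub>R h + \<eta> n *\<^sub>R k) k)"
    unfolding choice_iff by blast
  have "\<forall>n. \<exists>\<xi> \<eta>. 0 < \<xi> \<and> \<xi> < ?e n \<and> 0 < \<eta> \<and> \<eta> < ?e n \<and>
      f (x + ?e n *\<^sub>R k + ?e n *\<^sub>R h) - f (x + ?e n *\<^sub>R k) - f (x + ?e n *\<^sub>R h) + f x
        = ?e n * (?e n * gk (x + \<xi> *\<^sub>R k + \<eta> *\<^sub>R h) h)"
    by (intro allI quot[OF e gk])
  then obtain \<xi>' \<eta>' where 2: "\<And>n. 0 < \<xi>' n \<and> \<xi>' n < ?e n \<and> 0 < \<eta>' n \<and> \<eta>' n < ?e n \<and>
      f (x + ?e n *\<^sub>R k + ?e n *\<^sub>R h) - f (x + ?e n *\<^sub>R k) - f (x + ?e n *\<^sub>R h) + f x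
        = ?e n * (?e n * gk (x + \<xi>' n *\<^sub>R k + \<eta>' n *\<^sub>R h) h)"
    unfolding choice_iff by blast
  have "gh (x + \<xi> n *\<^sub>R h + \<eta> n *\<^sub>R k) k = gk (x + \<xi>' n *\<^sub>R k + \<eta>' n *\<^sub>R h) h" for n
  proof -
    have c: "x + ?e n *\<^sub>R k + ?e n *\<^sub>R h = x + ?e n *\<^sub>R h + ?e n *\<^sub>R k" by (rule add.commute[THEN trans]) (simp add: ac_simps)
    have "?e n * (?e n * gh (x + \<xi> n *\<^sub>R h + \<eta> n *\<^sub>R k) k) = ?e n * (?e n * gk (x + \<xi>' n *\<^sub>R k + \<eta>' n *\<^sub>R h) h)"
      using 1[of n] 2[of n] unfolding c by linarith
    then show ?thesis by simp
  qed
  moreover have "(\<lambda>n. gh (x + \<xi> n *\<^sub>R h + \<eta> n *\<^sub>R k) k) \<longlonglongrightarrow> gh x k"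
    using 1 by (intro lim ch) blast
  moreover have "(\<lambda>n. gk (x + \<xi>' n *\<^sub>R k + \<eta>' n *\<^sub>R h) h) \<longlonglongrightarrow> gk x h"
    using 2 by (intro lim ck) blast
  ultimately show ?thesis
    using LIMSEQ_unique by fastforce
qed

lemma has_derivative_Complex:
  assumes "(P has_derivative P') F" "(Q has_derivative Q') F"
  shows "((\<lambda>z. Complex (P z) (Q z)) has_derivative (\<lambda>h. Complex (P' h) (Q' h))) F"
  using has_derivative_add[OF has_derivative_of_real[OF assms(1), where 'a=complex]
      has_derivative_mult_right[OF has_derivative_of_real[OF assms(2), where 'a=complex], of \<i>]]
  by (simp add: Complex_eq)

text \<open>An expanding map is injective, so its range is open by invariance of domain. The range
  is also closed, because preimages of a Cauchy sequence form a Cauchy sequence. Connectedness of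
  the space finishes.\<close>

lemma surj_of_expanding:
  fixes T :: "'a::euclidean_space \<Rightarrow> 'a"
  assumes cont: "continuous_on UNIV T" and exp: "\<And>u v. dist u v \<le> dist (T u) (T v)"
  shows "surj T"
proof -
  have "inj T"
  proof (rule injI)
    show "u = v" if "T u = T v" for u v using exp[of u v] that by simp
  qed
  then have "open (range T)" using invariance_of_domain[OF cont] by auto
  moreover have "closed (range T)"
  proof (subst closed_sequential_limits, intro allI impI, elim conjE)
    fix y l assume "\<forall>n. y n \<in> range T" and yl: "y \<longlonglongrightarrow> l"
    then have "\<forall>n. \<exists>x. y n = T x" by blast
    then obtain x where "\<forall>n. y n = T (x n)" by (rule choice[THEN exE])
    then have x: "y = (\<lambda>n. T (x n))" by blast
    have "Cauchy x"
      using LIMSEQ_imp_Cauchy[OF yl] exp unfolding Cauchy_def x by (meson order_le_less_trans)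
    then obtain x' where "x \<longlonglongrightarrow> x'" using Cauchy_convergent convergent_def by blast
    then have "(\<lambda>n. T (x n)) \<longlonglongrightarrow> T x'"
      by (intro isCont_tendsto_compose[of _ T] continuous_on_interior[OF cont]) auto
    then have "l = T x'" using yl LIMSEQ_unique by (simp add: x)
    then show "l \<in> range T" by simp
  qed
  ultimately show ?thesis
    using clopen[of "range T"] by auto
qed

text \<open>The Lewy transformation \<open>z \<mapsto> z + \<nabla>u\<close> turns \<open>conj (z - \<nabla>u)\<close> into an entire function whose
  derivative takes values in the unit disc, for a solution \<open>u\<close> of \<open>det D\<^sup>2u = 1\<close>.\<close>
lemma jorgens:
  fixes P Q r s t :: "complex \<Rightarrow> real"
  assumes P: "\<And>z. (P has_derivative (\<lambda>h. r z * Re h + s z * Im h)) (at z)"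
    and Q: "\<And>z. (Q has_derivative (\<lambda>h. s z * Re h + t z * Im h)) (at z)"
    and r: "\<And>z. r z > 0" and det: "\<And>z. r z * t z - (s z)\<^sup>2 = 1"
  shows "r z = r w" "s z = s w" "t z = t w"
proof -
  have tpos: "t z > 0" for z
    using det[of z] r[of z] by (smt (verit) zero_le_power2 zero_less_mult_pos)
  define T where "T z = Complex (Re z + P z) (Im z + Q z)" for z
  \<comment> \<open>The Hessian is positive: multiply by \<open>r\<close> and complete the square;
    the remainder is \<open>det * b^2\<close>.\<close>
  have quad: "r z * a\<^sup>2 + 2 * s z * a * b + t z * b\<^sup>2 \<ge> 0" for z a b
  proof -
    have "r z * (r z * a\<^sup>2 + 2 * s z * a * b + t z * b\<^sup>2) = (r z * a + s z * b)\<^sup>2 + (r z * t z - (s z)\<^sup>2) * b\<^sup>2"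
      by (simp add: power2_eq_square algebra_simps)
    also have "\<dots> \<ge> 0" using det by simp
    finally show ?thesis using r[of z] by (simp add: zero_le_mult_iff)
  qed
  \<comment> \<open>The gradient of a convex function is monotone: mean value theorem along the
    segment from \<open>v\<close> to \<open>u\<close>.\<close>
  have mono: "0 \<le> (P u - P v) * Re (u - v) + (Q u - Q v) * Im (u - v)" for u v
  proof -
    define d where "d = u - v"
    have "((\<lambda>\<tau>. P (v + \<tau> *\<^sub>R d) * Re d + Q (v + \<tau> *\<^sub>R d) * Im d) has_real_derivative
       (r (v + \<tau> *\<^sub>R d) * Re d + s (v + \<tau> *\<^sub>R d) * Im d) * Re d +
       (s (v + \<tau> *\<^sub>R d) * Re d + t (v + \<tau> *\<^sub>R d) * Im d) * Im d) (at \<tau>)" for \<tau>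
    proof -
      have l: "((\<lambda>\<tau>. v + \<tau> *\<^sub>R d) has_derivative (\<lambda>h. h *\<^sub>R d)) (at \<tau>)"
        by (auto intro!: derivative_eq_intros)
      show ?thesis
        unfolding has_field_derivative_def
        by (rule derivative_eq_intros has_derivative_compose[OF l P] has_derivative_compose[OF l Q] refl)+
          (simp add: algebra_simps fun_eq_iff)
    qed
    from MVT2[OF zero_less_one this] obtain \<tau> where
      "P (v + 1 *\<^sub>R d) * Re d + Q (v + 1 *\<^sub>R d) * Im d - (P (v + 0 *\<^sub>R d) * Re d + Q (v + 0 *\<^sub>R d) * Im d) =
       (1 - 0) * ((r (v + \<tau> *\<^sub>R d) * Re d + s (v + \<tau> *\<^sub>R d) * Im d) * Re d +
       (s (v + \<tau> *\<^sub>R d) * Re d + t (v + \<tau> *\<^sub>R d) * Im d) * Im d)" by blast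
    then show ?thesis
      using quad[of "v + \<tau> *\<^sub>R d" "Re d" "Im d"]
      by (simp add: d_def algebra_simps power2_eq_square)
  qed
  have expanding: "dist u v \<le> dist (T u) (T v)" for u v
  proof -
    have "(dist (T u) (T v))\<^sup>2 = (Re (u - v) + (P u - P v))\<^sup>2 + (Im (u - v) + (Q u - Q v))\<^sup>2"
      by (simp add: T_def dist_norm cmod_power2 algebra_simps)
    also have "\<dots> = (dist u v)\<^sup>2 + 2 * ((P u - P v) * Re (u - v) + (Q u - Q v) * Im (u - v))
        + (P u - P v)\<^sup>2 + (Q u - Q v)\<^sup>2"
      unfolding dist_norm cmod_power2 by (simp add: power2_eq_square algebra_simps)
    finally have "(dist u v)\<^sup>2 \<le> (dist (T u) (T v))\<^sup>2"
      using mono[of u v] by (smt (verit) zero_le_power2)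
    then show ?thesis by (simp add: power2_le_iff_abs_le)
  qed
  define T' where "T' z h = Complex (Re h + (r z * Re h + s z * Im h)) (Im h + (s z * Re h + t z * Im h))" for z h
  have T: "(T has_derivative T' z) (at z)" for z
    unfolding T_def T'_def
    by (intro has_derivative_Complex has_derivative_add P Q bounded_linear.has_derivative[OF bounded_linear_Re]
       bounded_linear.has_derivative[OF bounded_linear_Im] has_derivative_ident)
  have contT: "continuous_on UNIV T"
    by (intro continuous_at_imp_continuous_on ballI has_derivative_continuous[OF T])
  have "surj T" by (rule surj_of_expanding[OF contT expanding])
  define S where "S = inv T"
  have TS: "T (S y) = y" for y using \<open>surj T\<close> by (simp add: S_def surj_f_inv_f)
  have "inj T"
  proof (rule injI)
    show "u = v" if "T u = T v" for u v using expanding[of u v] that by simp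
  qed
  then have ST: "S (T z) = z" for z by (simp add: S_def)
  have contS: "continuous (at y) S" for y
    unfolding continuous_at_eps_delta using expanding by (metis TS order_le_less_trans)
  \<comment> \<open>With \<open>H = (r, s; s, t)\<close>, the derivative of \<open>T\<close> is
    \<open>I + H\<close>, whose determinant is \<open>1 + r + t + det H = 2 + r + t\<close>. The map
    \<open>S'\<close> below is its inverse written with cofactors.\<close>
  define \<Delta> where "\<Delta> z = 2 + r z + t z" for z
  have \<Delta>: "\<Delta> z > 0" for z using r[of z] tpos[of z] by (simp add: \<Delta>_def)
  define S' where "S' z k = Complex (((1 + t z) * Re k - s z * Im k) / \<Delta> z) ((- s z * Re k + (1 + r z) * Im k) / \<Delta> z)" for z k
  have "((\<lambda>y. S y) has_derivative S' (S y)) (at y)" for y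
  proof (rule has_derivative_inverse_basic[where f=T and T=UNIV and g=S, OF T _ _ contS])
    have "linear (S' (S y))"
      by (rule linearI) (auto simp: S'_def complex_eq_iff algebra_simps add_divide_distrib diff_divide_distrib)
    then show "bounded_linear (S' (S y))" by (simp add: linear_conv_bounded_linear)
    show "S' (S y) \<circ> T' (S y) = id"
    proof
      fix h
      let ?z = "S y"
      have d: "(1 + t ?z) * (1 + r ?z) - s ?z * s ?z = \<Delta> ?z"
        using det[of ?z] by (simp add: \<Delta>_def power2_eq_square algebra_simps)
      have "((1 + t ?z) * (Re h + (r ?z * Re h + s ?z * Im h)) - s ?z * (Im h + (s ?z * Re h + t ?z * Im h)))
          = ((1 + t ?z) * (1 + r ?z) - s ?z * s ?z) * Re h"
        "(- s ?z * (Re h + (r ?z * Re h + s ?z * Im h)) + (1 + r ?z) * (Im h + (s ?z * Re h + t ?z * Im h)))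
          = ((1 + t ?z) * (1 + r ?z) - s ?z * s ?z) * Im h"
        by algebra+
      then show "(S' ?z \<circ> T' ?z) h = id h"
        using \<Delta>[of ?z] unfolding d by (simp add: S'_def T'_def complex_eq_iff)
    qed
  qed (auto simp: TS)
  then have S: "(S has_derivative S' (S y)) (at y)" for y by simp
  define f where "f y = Complex (Re (S y) - P (S y)) (Q (S y) - Im (S y))" for y
  \<comment> \<open>The matrix \<open>(I - H) (I + H)^(-1)\<close> is symmetric, and
    \<open>det H = 1\<close> makes it traceless. Followed by conjugation, such a matrix is
    multiplication by a complex number, namely \<open>D\<close>; these are the Cauchy-Riemann
    equations for \<open>f\<close>.\<close>
  define D where "D z = Complex ((t z - r z) / \<Delta> z) (2 * s z / \<Delta> z)" for z
  have f: "(f has_field_derivative D (S y)) (at y)" for y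
  proof -
    let ?z = "S y"
    have "((\<lambda>z. Complex (Re z - P z) (Q z - Im z)) has_derivative
       (\<lambda>h. Complex (Re h - (r ?z * Re h + s ?z * Im h)) ((s ?z * Re h + t ?z * Im h) - Im h))) (at ?z)"
      by (intro has_derivative_Complex has_derivative_diff P Q bounded_linear.has_derivative[OF bounded_linear_Re]
       bounded_linear.has_derivative[OF bounded_linear_Im] has_derivative_ident)
    from has_derivative_compose[OF S this]
    have *: "(f has_derivative (\<lambda>k. Complex (Re (S' ?z k) - (r ?z * Re (S' ?z k) + s ?z * Im (S' ?z k)))
       ((s ?z * Re (S' ?z k) + t ?z * Im (S' ?z k)) - Im (S' ?z k)))) (at y)"
      unfolding f_def .
    have d: "r ?z * t ?z = 1 + s ?z * s ?z"
      using det[of ?z] by (simp add: power2_eq_square)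
    have 1: "((1 + t ?z) * Re k - s ?z * Im k) - (r ?z * ((1 + t ?z) * Re k - s ?z * Im k) + s ?z * (- s ?z * Re k + (1 + r ?z) * Im k))
        = (t ?z - r ?z) * Re k - 2 * s ?z * Im k"
      "(s ?z * ((1 + t ?z) * Re k - s ?z * Im k) + t ?z * (- s ?z * Re k + (1 + r ?z) * Im k)) - (- s ?z * Re k + (1 + r ?z) * Im k)
        = (t ?z - r ?z) * Im k + 2 * s ?z * Re k" for k
      using d by algebra+
    have "Complex (Re (S' ?z k) - (r ?z * Re (S' ?z k) + s ?z * Im (S' ?z k)))
       ((s ?z * Re (S' ?z k) + t ?z * Im (S' ?z k)) - Im (S' ?z k)) = D ?z * k" for k
      using \<Delta>[of ?z] 1[of k] unfolding S'_def D_def complex_eq_iff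
      by (simp flip: add_divide_distrib diff_divide_distrib)
    then show ?thesis using * by (simp add: has_field_derivative_def)
  qed
  have holf: "f holomorphic_on UNIV"
    using f by (auto simp: holomorphic_on_open)
  have derivf: "deriv f y = D (S y)" for y using f DERIV_imp_deriv by blast
  \<comment> \<open>This identity is used twice: it puts \<open>D\<close> in the unit disc, and once
    \<open>D\<close> is constant it makes \<open>\<Delta>\<close>, hence \<open>r + t\<close>,
    constant.\<close>
  have normD: "1 - (cmod (D z))\<^sup>2 = 4 / \<Delta> z" for z
  proof -
    have "(\<Delta> z)\<^sup>2 * (1 - (cmod (D z))\<^sup>2) = (\<Delta> z)\<^sup>2 - (t z - r z)\<^sup>2 - (2 * s z)\<^sup>2"
      using \<Delta>[of z] by (simp add: cmod_power2 D_def power_divide algebra_simps)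
    also have "\<dots> = 4 * \<Delta> z"
      using det[of z] unfolding \<Delta>_def by algebra
    finally have "\<Delta> z * (1 - (cmod (D z))\<^sup>2) = 4"
      using \<Delta>[of z] by (simp add: power2_eq_square)
    then show ?thesis using \<Delta>[of z] by (simp add: field_simps)
  qed
  have "cmod (D z) \<le> 1" for z
  proof -
    have "4 / \<Delta> z \<ge> 0" by (rule divide_nonneg_pos[OF _ \<Delta>]) simp
    then have "(cmod (D z))\<^sup>2 \<le> 1" using normD[of z] by linarith
    then show ?thesis by (simp add: power_le_one_iff)
  qed
  then have "bounded (range (deriv f))" by (auto simp: bounded_iff derivf intro!: exI[of _ 1])
  then obtain c where "\<And>y. deriv f y = c"
    using Liouville_theorem[of "deriv f"] holf holomorphic_deriv open_UNIV
    by (metis constant_on_def UNIV_I)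
  then have Dc: "D z = c" for z using derivf[of "T z"] by (simp add: ST)
  have *: "\<Delta> z = \<Delta> w" for z w
    using normD[of z] normD[of w] \<Delta>[of z] \<Delta>[of w] by (simp add: Dc)
  have "t z - r z = t w - r w" "s z = s w" for z w
    using trans[OF Dc[of z] Dc[of w, symmetric]] \<Delta>[of w] unfolding D_def *[of z w] by auto
  from this[of z w] *[of z w] show "r z = r w" "s z = s w" "t z = t w"
    unfolding \<Delta>_def by linarith+
qed

section \<open>Zero-free entire functions\<close>

lemma vector_2_eq: "(vector [a, b] :: real^2) = a *\<^sub>R axis 1 1 + b *\<^sub>R axis 2 1"
  by (simp add: vec_eq_iff forall_2 axis_def)

lemma vector_2_has_derivative:
  assumes "(f has_derivative f') F" "(g has_derivative g') F"
  shows "((\<lambda>x. vector [f x, g x] :: real^2) has_derivative (\<lambda>h. vector [f' h, g' h])) F"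
  unfolding vector_2_eq by (intro has_derivative_add has_derivative_scaleR_left assms)

lemma continuous_on_vector_2:
  assumes "continuous_on S f" "continuous_on S g"
  shows "continuous_on S (\<lambda>x. vector [f x, g x] :: real^2)"
  unfolding vector_2_eq by (intro continuous_intros assms)

lemma entire_omits_at_most_one:
  assumes "f holomorphic_on UNIV" "\<not> f constant_on UNIV"
  obtains a where "- {a} \<subseteq> range f"
proof (cases "range f = UNIV")
  case True then show ?thesis using that by blast
next
  case False
  then obtain a where a: "a \<notin> range f" by blast
  have "b \<in> range f" if "b \<noteq> a" for b :: complex
  proof (rule ccontr)
    assume "b \<notin> range f"
    then have "range f \<inter> {a, b} = {}" using a by blast
    then obtain c where "f = (\<lambda>x. c)"
      by (rule little_Picard[OF assms(1) \<open>b \<noteq> a\<close>[symmetric]])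
    with assms(2) show False by (auto simp: constant_on_def)
  qed
  then show ?thesis using that by blast
qed

text \<open>An entire logarithm of \<open>f\<close> attains all but at most one of the infinitely
  many logarithms of \<open>c\<close>. It maps the fibre over \<open>c\<close> onto an infinite set,
  so the fibre is infinite.\<close>

lemma zero_free_entire_infinite_fibres:
  assumes holf: "f holomorphic_on UNIV" and nz: "\<And>z. f z \<noteq> 0" and nc: "\<not> f constant_on UNIV"
    and "c \<noteq> 0"
  shows "infinite {z. f z = c}"
proof -
  obtain g where holg: "g holomorphic_on UNIV" and g: "\<And>z. exp (g z) = f z"
    using holomorphic_logarithm_exists[of UNIV f 0] holf nz by auto
  have "\<not> g constant_on UNIV"
    using nc unfolding constant_on_def by (metis g)
  then obtain a where a: "- {a} \<subseteq> range g"
    using entire_omits_at_most_one[OF holg] by blast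
  define l where "l k = Ln c + of_int (2 * k) * pi * \<i>" for k :: int
  have el: "exp (l k) = c" for k
    using exp_Ln[OF \<open>c \<noteq> 0\<close>] by (metis exp_eq l_def)
  have inj: "inj l" by (auto simp: l_def inj_on_def)
  have "infinite (range l - {a})"
    using inj by (simp add: finite_image_iff infinite_UNIV_char_0)
  moreover have "range l - {a} \<subseteq> g ` {z. f z = c}"
  proof
    fix w assume "w \<in> range l - {a}"
    then obtain k z where k: "w = l k" and z: "w = g z" using a by blast
    then have "f z = c" using g[of z] el[of k] by simp
    with z show "w \<in> g ` {z. f z = c}" by blast
  qed
  ultimately show ?thesis by (meson finite_imageI finite_subset)
qed

section \<open>Divergence of an integral over the image of an entire function\<close>

lemma not_integrable_strip:
  fixes k :: "real \<Rightarrow> real"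
  assumes cont: "isCont k 0" and k0: "k 0 \<noteq> 0"
  shows "\<not> (\<lambda>v::real^2. k (v $ 1)) absolutely_integrable_on UNIV"
proof
  let ?f = "\<lambda>v::real^2. \<bar>k (v $ 1)\<bar>"
  assume "(\<lambda>v::real^2. k (v $ 1)) absolutely_integrable_on UNIV"
  then have int: "?f integrable_on UNIV"
    by (simp add: absolutely_integrable_on_def)
  have "isCont (\<lambda>x. \<bar>k x\<bar>) 0" using cont by (intro continuous_intros)
  then have "((\<lambda>x. \<bar>k x\<bar>) \<longlongrightarrow> \<bar>k 0\<bar>) (nhds 0)"
    unfolding continuous_at by (rule iffD1[OF tendsto_at_iff_tendsto_nhds])
  then have "\<forall>\<^sub>F x in nhds 0. \<bar>k 0\<bar> / 2 < \<bar>k x\<bar>"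
    by (rule order_tendstoD(1)) (use k0 in simp)
  then obtain d where d: "d > 0" "\<And>x. \<bar>x\<bar> < d \<Longrightarrow> \<bar>k 0\<bar> / 2 < \<bar>k x\<bar>"
    unfolding eventually_nhds_metric by (auto simp: dist_real_def)
  define J where "J = integral UNIV ?f"
  \<comment> \<open>The half-width \<open>d/2\<close> keeps the closed box inside the open strip
    where \<open>|k| > |k 0| / 2\<close>; the content \<open>2 d n\<close> grows without
    bound.\<close>
  define box where "box n = cbox (vector [- (d/2), - real n]) (vector [d/2, real n] :: real^2)" for n
  have content: "Henstock_Kurzweil_Integration.content (box n) = d * (2 * real n)" for n
  proof -
    have "vector [0, 0] \<in> box n" using d by (auto simp: box_def mem_box_cart forall_2)
    then show ?thesis unfolding box_def
      by (subst content_cbox_cart) (auto simp: UNIV_2)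
  qed
  have "\<bar>k 0\<bar> / 2 * (d * (2 * real n)) \<le> J" for n
  proof -
    have i: "?f integrable_on box n"
      using integrable_on_subcbox[OF int] by (simp add: box_def)
    have "integral (box n) (\<lambda>_. \<bar>k 0\<bar> / 2) \<le> integral (box n) ?f"
    proof (rule integral_le)
      show "(\<lambda>_. \<bar>k 0\<bar> / 2) integrable_on box n" by (simp add: box_def integrable_const)
      show "\<bar>k 0\<bar> / 2 \<le> ?f v" if "v \<in> box n" for v
      proof (rule less_imp_le, rule d(2))
        show "\<bar>v $ 1\<bar> < d" using that d(1) by (auto simp: box_def mem_box_cart forall_2)
      qed
    qed (rule i)
    also have "\<dots> \<le> J" unfolding J_def by (rule integral_subset_le) (auto intro: i int)
    finally have "integral (box n) (\<lambda>_. \<bar>k 0\<bar> / 2) \<le> J" .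
    moreover have "integral (box n) (\<lambda>_. \<bar>k 0\<bar> / 2) = Henstock_Kurzweil_Integration.content (box n) * (\<bar>k 0\<bar> / 2)"
      unfolding box_def by (simp add: integral_const)
    ultimately show ?thesis unfolding content by (simp add: algebra_simps)
  qed
  note le = this
  obtain n :: nat where "J < real n * (\<bar>k 0\<bar> * d)"
    using reals_Archimedean3[of "\<bar>k 0\<bar> * d"] d(1) k0 by auto
  then show False using le[of n] by (simp add: algebra_simps)
qed

text \<open>Change of variables by \<open>B \<circ> \<zeta>\<close>. This map may be far from
  injective, but covering points repeatedly only increases the pulled-back integral of
  \<open>|k|\<close>, so integrability descends to the image. The condition on \<open>m1\<close> and
  \<open>m2\<close> says that they are linearly independent over the reals.\<close>

lemma entire_pullback_not_integrable:
  fixes B :: "complex \<Rightarrow> complex" and k :: "real \<Rightarrow> real" and m1 m2 :: complex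
  assumes holB: "B holomorphic_on UNIV" and nc: "\<not> B constant_on UNIV"
    and m: "Im (cnj m1 * m2) \<noteq> 0" and cont: "isCont k 0" and k0: "k 0 \<noteq> 0"
  defines "\<zeta> \<equiv> \<lambda>u::real^2. of_real (u $ 1) * m1 + of_real (u $ 2) * m2"
  shows "\<not> (\<lambda>u. (cmod (deriv B (\<zeta> u)))\<^sup>2 * k (Re (B (\<zeta> u)))) absolutely_integrable_on UNIV"
proof
  assume int: "(\<lambda>u. (cmod (deriv B (\<zeta> u)))\<^sup>2 * k (Re (B (\<zeta> u)))) absolutely_integrable_on UNIV"
  define g :: "real^2 \<Rightarrow> real^2" where "g u = vector [Re (B (\<zeta> u)), Im (B (\<zeta> u))]" for u
  define g' :: "real^2 \<Rightarrow> real^2 \<Rightarrow> real^2"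
    where "g' u h = vector [Re (deriv B (\<zeta> u) * \<zeta> h), Im (deriv B (\<zeta> u) * \<zeta> h)]" for u h
  have \<zeta>: "(\<zeta> has_derivative \<zeta>) (at u)" for u
    unfolding \<zeta>_def by (auto intro!: derivative_eq_intros bounded_linear.has_derivative[OF bounded_linear_vec_nth])
  have "(B has_derivative (\<lambda>h. deriv B z * h)) (at z)" for z
    using holomorphic_derivI[OF holB open_UNIV] by (simp add: has_field_derivative_def)
  from has_derivative_compose[OF \<zeta> this]
  have B: "((\<lambda>u. B (\<zeta> u)) has_derivative (\<lambda>h. deriv B (\<zeta> u) * \<zeta> h)) (at u)" for u .
  have der: "(g has_derivative g' u) (at u within UNIV)" for u
    unfolding g_def g'_def
    by (intro vector_2_has_derivative bounded_linear.has_derivative[OF bounded_linear_Re]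
        bounded_linear.has_derivative[OF bounded_linear_Im] B)
  have det: "\<bar>det (matrix (g' u))\<bar> = (cmod (deriv B (\<zeta> u)))\<^sup>2 * \<bar>Im (cnj m1 * m2)\<bar>" for u
  proof -
    have "det (matrix (g' u)) = Re (deriv B (\<zeta> u) * m1) * Im (deriv B (\<zeta> u) * m2) - Re (deriv B (\<zeta> u) * m2) * Im (deriv B (\<zeta> u) * m1)"
      by (simp add: det_2 matrix_def g'_def \<zeta>_def axis_def)
    also have "\<dots> = (cmod (deriv B (\<zeta> u)))\<^sup>2 * Im (cnj m1 * m2)"
      unfolding cmod_power2 by (simp add: power2_eq_square algebra_simps)
    finally show ?thesis by (simp add: abs_mult)
  qed
  have "(\<lambda>u. \<bar>det (matrix (g' u))\<bar> * k (g u $ 1)) = (\<lambda>u. \<bar>Im (cnj m1 * m2)\<bar> *\<^sub>R ((cmod (deriv B (\<zeta> u)))\<^sup>2 * k (Re (B (\<zeta> u)))))"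
    unfolding det by (simp add: g_def fun_eq_iff)
  then have "(\<lambda>u. \<bar>det (matrix (g' u))\<bar> * k (g u $ 1)) absolutely_integrable_on UNIV"
    using absolutely_integrable_scaleR_left[OF int] by simp
  then have 1: "(\<lambda>v::real^2. k (v $ 1)) absolutely_integrable_on range g"
    by (rule absolutely_integrable_on_image_real[OF der, where f = "\<lambda>v::real^2. k (v $ 1)"])
  obtain a where a: "- {a} \<subseteq> range B"
    using entire_omits_at_most_one[OF holB nc] by blast
  have surj: "\<exists>u. \<zeta> u = z" for z
  proof -
    let ?D = "Im (cnj m1 * m2)"
    \<comment> \<open>Cramer's rule for the real linear system
      \<open>x m1 + y m2 = z\<close>.\<close>
    have "\<zeta> (vector [Im (cnj z * m2) / ?D, Im (cnj m1 * z) / ?D]) = z"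
    proof -
      have "Im (cnj z * m2) * Re m1 + Im (cnj m1 * z) * Re m2 = Re z * ?D"
        "Im (cnj z * m2) * Im m1 + Im (cnj m1 * z) * Im m2 = Im z * ?D"
        by (simp_all add: algebra_simps)
      then have "(Im (cnj z * m2) * Re m1 + Im (cnj m1 * z) * Re m2) / ?D = Re z"
        "(Im (cnj z * m2) * Im m1 + Im (cnj m1 * z) * Im m2) / ?D = Im z"
        using m by (simp_all only: nonzero_mult_div_cancel_right not_False_eq_True)
      then show ?thesis
        unfolding \<zeta>_def complex_eq_iff add_divide_distrib by simp
    qed
    then show ?thesis by blast
  qed
  \<comment> \<open>By Picard the image misses at most one point, which is negligible.\<close>
  have "UNIV - range g \<subseteq> {vector [Re a, Im a]}"
  proof
    fix v assume v: "v \<in> UNIV - range g"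
    have "Complex (v $ 1) (v $ 2) \<notin> range B"
    proof
      assume "Complex (v $ 1) (v $ 2) \<in> range B"
      then obtain u where "Complex (v $ 1) (v $ 2) = B (\<zeta> u)" using surj by (metis image_iff)
      then have "v = g u" by (simp add: g_def vec_eq_iff forall_2 complex_eq_iff)
      then show False using v by blast
    qed
    then have "Complex (v $ 1) (v $ 2) = a" using a by blast
    then show "v \<in> {vector [Re a, Im a]}" by (auto simp: vec_eq_iff forall_2)
  qed
  then have "negligible (UNIV - range g)"
    by (meson finite.intros finite_subset negligible_finite)
  then have "(\<lambda>v::real^2. k (v $ 1)) absolutely_integrable_on UNIV"
    by (intro absolutely_integrable_spike_set[OF 1]) (auto elim: negligible_subset)
  with not_integrable_strip[OF cont k0] show False ..
qed

section \<open>Completeness\<close>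

text \<open>The corners in \<open>N\<close> form a null set. Cutting them out by an indicator leaves
  an integrand that is described everywhere by a chosen velocity.\<close>

lemma curve_length_eq:
  assumes "finite N" and "\<And>t. t \<in> {0..1} - N \<Longrightarrow> (c has_vector_derivative D t) (at t) \<and> sqrt (mink (D t) (D t)) = h t"
  shows "curve_length c = (\<integral>\<^sup>+t. ennreal (indicator ({0..1} - N) t * h t) \<partial>lborel)"
  unfolding curve_length_def
proof (rule nn_integral_cong_AE)
  have "AE t in lborel. t \<notin> N"
    by (rule AE_not_in) (simp add: finite_imp_null_set_lborel assms(1))
  then show "AE t in lborel. ennreal (sqrt (mink (vector_derivative c (at t)) (vector_derivative c (at t)))) * indicator {0..1} t
      = ennreal (indicator ({0..1} - N) t * h t)"
  proof eventually_elim
    case (elim t)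
    show ?case
    proof (cases "t \<in> {0..1}")
      case True
      then have "(c has_vector_derivative D t) (at t)" "sqrt (mink (D t) (D t)) = h t"
        using assms(2) elim by blast+
      then show ?thesis using True elim by (simp add: vector_derivative_at)
    qed (auto simp: indicator_def)
  qed
qed

text \<open>The induced metric dominates \<open>c^2\<close> times the flat one uniformly. Together
  with its local boundedness this compares Riemannian and Euclidean Cauchy sequences.\<close>

locale uniform_surface =
  fixes X :: "real^2 \<Rightarrow> real^4" and X' :: "real^2 \<Rightarrow> real^2 \<Rightarrow> real^4" and c :: real
  assumes X: "\<And>u. (X has_derivative X' u) (at u)"
    and cont: "\<And>v. continuous_on UNIV (\<lambda>u. X' u v)"
    and c: "c > 0" and lower: "\<And>u v. c\<^sup>2 * (norm v)\<^sup>2 \<le> mink (X' u v) (X' u v)"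
begin

definition spd :: "real^2 \<Rightarrow> real^2 \<Rightarrow> real" where
  "spd u v = sqrt (mink (X' u v) (X' u v))"

lemma spd_lower: "c * norm v \<le> spd u v"
proof -
  have "sqrt ((c * norm v)\<^sup>2) \<le> spd u v"
    unfolding spd_def using lower[of v u] by (intro real_sqrt_le_mono) (simp add: power_mult_distrib)
  then show ?thesis using c by simp
qed

lemma spd_scale: "spd u (a *\<^sub>R v) = \<bar>a\<bar> * spd u v"
proof -
  have "X' u (a *\<^sub>R v) = a *\<^sub>R X' u v"
    using linear_cmul[OF has_derivative_linear[OF X]] .
  then have "mink (X' u (a *\<^sub>R v)) (X' u (a *\<^sub>R v)) = a\<^sup>2 * mink (X' u v) (X' u v)"
    by (simp add: mink_def power2_eq_square algebra_simps)
  then show ?thesis by (simp add: spd_def real_sqrt_mult)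
qed

lemma continuous_spd: "continuous_on UNIV (\<lambda>p. spd (fst p) (snd p))"
proof -
  have expand: "X' u v = (\<Sum>b\<in>Basis. (v \<bullet> b) *\<^sub>R X' u b)" for u v
  proof -
    note lin = has_derivative_linear[OF X]
    have "X' u v = X' u (\<Sum>b\<in>Basis. (v \<bullet> b) *\<^sub>R b)" by (simp add: euclidean_representation)
    then show ?thesis by (simp add: linear_sum[OF lin] linear_cmul[OF lin])
  qed
  have "continuous_on UNIV (\<lambda>p. X' (fst p) (snd p))"
    by (subst expand) (intro continuous_intros continuous_on_compose2[OF cont], auto)
  then show ?thesis unfolding spd_def mink_def by (intro continuous_intros)
qed

lemma X_path:
  assumes "(\<gamma> has_vector_derivative D) (at t)"
  shows "((X \<circ> \<gamma>) has_vector_derivative X' (\<gamma> t) D) (at t)"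
proof -
  have "((\<lambda>t. X (\<gamma> t)) has_derivative (\<lambda>h. X' (\<gamma> t) (h *\<^sub>R D))) (at t)"
    using has_derivative_compose[OF assms[unfolded has_vector_derivative_def] X] .
  then show ?thesis
    unfolding has_vector_derivative_def o_def linear_cmul[OF has_derivative_linear[OF X]] .
qed

definition len :: "(real \<Rightarrow> real^2) \<Rightarrow> ennreal" where
  "len \<gamma> = curve_length (X \<circ> \<gamma>)"

lemma len_eq:
  assumes "finite N" and "\<And>t. t \<in> {0..1} - N \<Longrightarrow> (\<gamma> has_vector_derivative D t) (at t)"
  shows "len \<gamma> = (\<integral>\<^sup>+t. ennreal (indicator ({0..1} - N) t * spd (\<gamma> t) (D t)) \<partial>lborel)"
  unfolding len_def
  by (rule curve_length_eq[where D = "\<lambda>t. X' (\<gamma> t) (D t)"]) (use assms X_path in \<open>auto simp: spd_def\<close>)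

lemma valid_path_derivative:
  assumes "valid_path \<gamma>"
  obtains N D where "finite N" "\<And>t. t \<in> {0..1} - N \<Longrightarrow> (\<gamma> has_vector_derivative D t) (at t)"
    "continuous_on ({0..1} - N) D" "continuous_on {0..1} \<gamma>"
  using assms unfolding valid_path_def piecewise_C1_differentiable_on_def C1_differentiable_on_def by blast

lemma spd_measurable:
  fixes \<gamma> :: "real \<Rightarrow> real^2"
  assumes "finite N" "continuous_on ({0..1} - N) D" "continuous_on {0..1} \<gamma>"
  shows "(\<lambda>t. indicator ({0..1} - N) t * spd (\<gamma> t) (D t)) \<in> borel_measurable borel"
proof -
  have "continuous_on ({0..1} - N) (\<lambda>t. spd (\<gamma> t) (D t))"
    using continuous_on_compose2[OF continuous_spd, of "{0..1} - N" "\<lambda>t. (\<gamma> t, D t)"] assms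
      continuous_on_subset[OF assms(3), of "{0..1} - N"]
    by (auto intro!: continuous_on_Pair)
  moreover have "{0..1} - N \<in> sets borel" by (intro sets.Diff borel_closed closed_atLeastAtMost finite_imp_closed assms(1))
  ultimately show ?thesis
    using borel_measurable_continuous_on_indicator by fastforce
qed

text \<open>Substitution \<open>t \<mapsto> 1 - t\<close>. One inequality suffices: symmetry of the
  distance then follows by exchanging the end points.\<close>

lemma len_reversepath_le:
  assumes "valid_path \<gamma>" shows "len (reversepath \<gamma>) \<le> len \<gamma>"
proof -
  obtain N D where N: "finite N" and D: "\<And>t. t \<in> {0..1} - N \<Longrightarrow> (\<gamma> has_vector_derivative D t) (at t)"
    and cD: "continuous_on ({0..1} - N) D" and c\<gamma>: "continuous_on {0..1} \<gamma>"
    using valid_path_derivative[OF assms] by blast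
  let ?h = "\<lambda>t. ennreal (indicator ({0..1} - N) t * spd (\<gamma> t) (D t))"
  have meas: "?h \<in> borel_measurable borel" using spd_measurable[OF N cD c\<gamma>] by measurable
  let ?N = "(\<lambda>t. 1 - t) ` N"
  have "len (reversepath \<gamma>) = (\<integral>\<^sup>+t. ennreal (indicator ({0..1} - ?N) t * spd (reversepath \<gamma> t) (- 1 *\<^sub>R D (1 - t))) \<partial>lborel)"
  proof (rule len_eq)
    fix t assume t: "t \<in> {0..1} - ?N"
    have "1 - t \<notin> N"
    proof
      assume "1 - t \<in> N"
      then have "1 - (1 - t) \<in> ?N" by (rule imageI)
      then show False using t by simp
    qed
    then have "(\<gamma> has_vector_derivative D (1 - t)) (at (1 - t))" using D t by auto
    moreover have "((\<lambda>t. 1 - t) has_vector_derivative - 1) (at t)" for t :: real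
      by (auto intro!: derivative_eq_intros)
    ultimately show "(reversepath \<gamma> has_vector_derivative - 1 *\<^sub>R D (1 - t)) (at t)"
      using vector_diff_chain_at[of "\<lambda>t. 1 - t" "- 1" t \<gamma> "D (1 - t)"] by (simp add: reversepath_def o_def)
  qed (use N in simp)
  also have "\<dots> \<le> (\<integral>\<^sup>+t. ?h (1 + (- 1) * t) \<partial>lborel)"
  proof (rule nn_integral_mono)
    fix t :: real
    have "1 - t \<in> {0..1} - N" if "t \<in> {0..1} - ?N"
      using that by (auto simp: image_iff)
    then show "ennreal (indicator ({0..1} - ?N) t * spd (reversepath \<gamma> t) (- 1 *\<^sub>R D (1 - t))) \<le> ?h (1 + (- 1) * t)"
      unfolding spd_scale reversepath_def by (auto simp: indicator_def)
  qed
  also have "\<dots> = (\<integral>\<^sup>+t. ?h t \<partial>lborel)"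
    using nn_integral_real_affine[OF meas, of "- 1" 1] by simp
  also have "\<dots> = len \<gamma>" by (rule len_eq[OF N D, symmetric])
  finally show ?thesis .
qed

lemma len_join_le:
  assumes "valid_path \<gamma>1" "valid_path \<gamma>2"
  shows "len (\<gamma>1 +++ \<gamma>2) \<le> len \<gamma>1 + len \<gamma>2"
proof -
  obtain N1 D1 where N1: "finite N1" and D1: "\<And>t. t \<in> {0..1} - N1 \<Longrightarrow> (\<gamma>1 has_vector_derivative D1 t) (at t)"
    and c1: "continuous_on ({0..1} - N1) D1" "continuous_on {0..1} \<gamma>1"
    using valid_path_derivative[OF assms(1)] by blast
  obtain N2 D2 where N2: "finite N2" and D2: "\<And>t. t \<in> {0..1} - N2 \<Longrightarrow> (\<gamma>2 has_vector_derivative D2 t) (at t)"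
    and c2: "continuous_on ({0..1} - N2) D2" "continuous_on {0..1} \<gamma>2"
    using valid_path_derivative[OF assms(2)] by blast
  define h1 where "h1 t = ennreal (indicator ({0..1} - N1) t * spd (\<gamma>1 t) (D1 t))" for t
  define h2 where "h2 t = ennreal (indicator ({0..1} - N2) t * spd (\<gamma>2 t) (D2 t))" for t
  have m1: "h1 \<in> borel_measurable borel" unfolding h1_def using spd_measurable[OF N1 c1] by measurable
  have m2: "h2 \<in> borel_measurable borel" unfolding h2_def using spd_measurable[OF N2 c2] by measurable
  \<comment> \<open>The corners of the join are those of the two pieces, rescaled to their halves of
    the interval, and the junction at \<open>1/2\<close>.\<close>
  let ?N = "insert (1/2) ((\<lambda>t. t / 2) ` N1 \<union> (\<lambda>t. (t + 1) / 2) ` N2)"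
  let ?D = "\<lambda>t. if t < 1/2 then 2 *\<^sub>R D1 (2 * t) else 2 *\<^sub>R D2 (2 * t - 1)"
  have in1: "2 * t \<in> {0..1} - N1" if "t \<in> {0..1} - ?N" "t < 1/2" for t
    using that by (auto simp: image_iff field_simps)
  have in2: "2 * t - 1 \<in> {0..1} - N2" if "t \<in> {0..1} - ?N" "\<not> t < 1/2" for t
  proof -
    have "2 * t - 1 \<notin> N2"
    proof
      assume "2 * t - 1 \<in> N2"
      then have "(2 * t - 1 + 1) / 2 \<in> ?N" by blast
      then show False using that by simp
    qed
    then show ?thesis using that by auto
  qed
  have "len (\<gamma>1 +++ \<gamma>2) = (\<integral>\<^sup>+t. ennreal (indicator ({0..1} - ?N) t * spd ((\<gamma>1 +++ \<gamma>2) t) (?D t)) \<partial>lborel)"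
  proof (rule len_eq)
    fix t assume t: "t \<in> {0..1} - ?N"
    then have "t \<noteq> 1/2" by blast
    then consider "t < 1/2" | "t > 1/2" by linarith
    then show "((\<gamma>1 +++ \<gamma>2) has_vector_derivative ?D t) (at t)"
    proof cases
      case 1
      have "((\<lambda>t. 2 * t) has_vector_derivative 2) (at t)"
        by (auto intro!: derivative_eq_intros)
      from vector_diff_chain_at[OF this D1[OF in1[OF t 1]]]
      have *: "((\<lambda>t. \<gamma>1 (2 * t)) has_vector_derivative ?D t) (at t)" using 1 by (simp add: o_def)
      show ?thesis
        by (rule has_vector_derivative_transform_within_open[OF *, of "{..<1/2}"]) (use 1 in \<open>auto simp: joinpaths_def\<close>)
    next
      case 2
      then have n: "\<not> t < 1/2" by simp
      have "((\<lambda>t. 2 * t - 1) has_vector_derivative 2) (at t)"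
        by (auto intro!: derivative_eq_intros)
      from vector_diff_chain_at[OF this D2[OF in2[OF t n]]]
      have *: "((\<lambda>t. \<gamma>2 (2 * t - 1)) has_vector_derivative ?D t) (at t)" using n by (simp add: o_def)
      show ?thesis
        by (rule has_vector_derivative_transform_within_open[OF *, of "{1/2<..}"]) (use 2 in \<open>auto simp: joinpaths_def\<close>)
    qed
  qed (use N1 N2 in simp)
  \<comment> \<open>Each piece is run at double speed, and the factor 2 cancels against the
    rescaling of the parameter in the next steps. The indicators inside \<open>h1\<close> and
    \<open>h2\<close> confine each summand to its own half.\<close>
  also have "\<dots> \<le> (\<integral>\<^sup>+t. 2 * h1 (0 + 2 * t) + 2 * h2 (- 1 + 2 * t) \<partial>lborel)"
  proof (rule nn_integral_mono)
    fix t :: real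
    show "ennreal (indicator ({0..1} - ?N) t * spd ((\<gamma>1 +++ \<gamma>2) t) (?D t)) \<le> 2 * h1 (0 + 2 * t) + 2 * h2 (- 1 + 2 * t)"
    proof (cases "t \<in> {0..1} - ?N")
      case True
      show ?thesis
      proof (cases "t < 1/2")
        case t: True
        have "ennreal (indicator ({0..1} - ?N) t * spd ((\<gamma>1 +++ \<gamma>2) t) (?D t)) = 2 * h1 (0 + 2 * t)"
          using True t in1[OF True t] by (simp add: h1_def joinpaths_def spd_scale ennreal_mult' del: insert_iff Un_iff Diff_iff)
        then show ?thesis by simp
      next
        case t: False
        have "t \<noteq> 1/2" using True by blast
        then have "ennreal (indicator ({0..1} - ?N) t * spd ((\<gamma>1 +++ \<gamma>2) t) (?D t)) = 2 * h2 (- 1 + 2 * t)"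
          using True t in2[OF True t] by (simp add: h2_def joinpaths_def spd_scale ennreal_mult' del: insert_iff Un_iff Diff_iff)
        then show ?thesis by simp
      qed
    qed simp
  qed
  also have "\<dots> = (\<integral>\<^sup>+t. 2 * h1 (0 + 2 * t) \<partial>lborel) + (\<integral>\<^sup>+t. 2 * h2 (- 1 + 2 * t) \<partial>lborel)"
    by (rule nn_integral_add) (use m1 m2 in measurable)
  also have "\<dots> = (\<integral>\<^sup>+t. h1 t \<partial>lborel) + (\<integral>\<^sup>+t. h2 t \<partial>lborel)"
    using nn_integral_real_affine[OF m1, of 2 0] nn_integral_real_affine[OF m2, of 2 "- 1"] m1 m2
    by (simp add: nn_integral_cmult)
  also have "\<dots> = len \<gamma>1 + len \<gamma>2"
    unfolding h1_def h2_def using len_eq[OF N1 D1] len_eq[OF N2 D2] by simp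
  finally show ?thesis .
qed

text \<open>A chord is no longer than its path, and the speed is at least \<open>c\<close> times the
  Euclidean speed. The velocity may be unbounded near corners: finite length makes it Lebesgue
  integrable, and only then can the gauge integral of the fundamental theorem be identified with a
  Lebesgue integral.\<close>

lemma len_lower:
  assumes "valid_path \<gamma>"
  shows "ennreal (c * dist (pathstart \<gamma>) (pathfinish \<gamma>)) \<le> len \<gamma>"
proof (cases "len \<gamma> = \<infinity>")
  case False
  obtain N D where N: "finite N" and D: "\<And>t. t \<in> {0..1} - N \<Longrightarrow> (\<gamma> has_vector_derivative D t) (at t)"
    and cD: "continuous_on ({0..1} - N) D" and c\<gamma>: "continuous_on {0..1} \<gamma>"
    using valid_path_derivative[OF assms] by blast
  let ?g = "\<lambda>t. indicator ({0..1} - N) t *\<^sub>R D t"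
  have "{0..1} - N \<in> sets borel" by (intro sets.Diff borel_closed closed_atLeastAtMost finite_imp_closed N)
  then have meas: "?g \<in> borel_measurable lborel"
    using borel_measurable_continuous_on_indicator[OF _ cD] by simp
  have "ennreal c * (\<integral>\<^sup>+t. norm (?g t) \<partial>lborel) = (\<integral>\<^sup>+t. ennreal c * norm (?g t) \<partial>lborel)"
    by (rule nn_integral_cmult[symmetric]) (rule measurable_compose[OF meas], measurable)
  also have "\<dots> \<le> (\<integral>\<^sup>+t. ennreal (indicator ({0..1} - N) t * spd (\<gamma> t) (D t)) \<partial>lborel)"
    using spd_lower c by (intro nn_integral_mono) (auto simp: indicator_def ennreal_mult'[symmetric] intro!: ennreal_leI)
  also have "\<dots> = len \<gamma>" by (rule len_eq[OF N D, symmetric])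
  finally have le: "ennreal c * (\<integral>\<^sup>+t. norm (?g t) \<partial>lborel) \<le> len \<gamma>" .
  then have "ennreal c * (\<integral>\<^sup>+t. norm (?g t) \<partial>lborel) < \<infinity>" using False by (simp add: less_top top_unique)
  then have fin: "(\<integral>\<^sup>+t. norm (?g t) \<partial>lborel) < \<infinity>"
    using c by (auto simp: ennreal_mult_less_top)
  then have int: "integrable lborel ?g" using meas by (simp add: integrable_iff_bounded)
  have "(D has_integral \<gamma> 1 - \<gamma> 0) {0..1}"
    by (rule fundamental_theorem_of_calculus_strong[OF N]) (use D c\<gamma> in auto)
  then have "(?g has_integral \<gamma> 1 - \<gamma> 0) {0..1}"
    by (rule has_integral_spike_finite[OF N, rotated]) (auto simp: indicator_def)
  then have "((\<lambda>t. if t \<in> {0..1} then ?g t else 0) has_integral \<gamma> 1 - \<gamma> 0) UNIV"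
    by (simp only: has_integral_restrict_UNIV)
  moreover have "(\<lambda>t. if t \<in> {0..1} then ?g t else 0) = ?g" by (auto simp: indicator_def)
  ultimately have "(?g has_integral \<gamma> 1 - \<gamma> 0) UNIV" by simp
  then have "integral\<^sup>L lborel ?g = \<gamma> 1 - \<gamma> 0"
    by (rule has_integral_unique[OF has_integral_integral_lborel[OF int]])
  then have "ennreal (dist (pathstart \<gamma>) (pathfinish \<gamma>)) \<le> (\<integral>\<^sup>+t. norm (?g t) \<partial>lborel)"
    using integral_norm_bound_ennreal[OF int] by (simp add: dist_norm norm_minus_commute pathstart_def pathfinish_def)
  then have "ennreal c * ennreal (dist (pathstart \<gamma>) (pathfinish \<gamma>)) \<le> ennreal c * (\<integral>\<^sup>+t. norm (?g t) \<partial>lborel)"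
    by (rule mult_left_mono) simp
  also note le
  finally show ?thesis using c by (simp add: ennreal_mult')
qed simp

text \<open>Compactness bounds the speed of unit vectors over the ball, and homogeneity extends the
  bound to all vectors.\<close>

lemma spd_upper:
  obtains K where "\<And>u v. u \<in> cball p r \<Longrightarrow> spd u v \<le> K * norm v"
proof -
  have "compact ((\<lambda>q. spd (fst q) (snd q)) ` (cball p r \<times> sphere 0 1))"
    by (intro compact_continuous_image continuous_on_subset[OF continuous_spd] compact_Times) auto
  then obtain K where K0: "\<forall>x\<in>(\<lambda>q. spd (fst q) (snd q)) ` (cball p r \<times> sphere 0 1). norm x \<le> K"
    by (rule exE[OF iffD1[OF bounded_iff compact_imp_bounded]])
  have K: "spd u v \<le> K" if "u \<in> cball p r" "norm v = 1" for u v
  proof -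
    have "(u, v) \<in> cball p r \<times> sphere 0 1" using that by simp
    then have "spd (fst (u, v)) (snd (u, v)) \<in> (\<lambda>q. spd (fst q) (snd q)) ` (cball p r \<times> sphere 0 1)" by (rule imageI)
    from bspec[OF K0 this] show ?thesis by simp
  qed
  have "spd u v \<le> K * norm v" if u: "u \<in> cball p r" for u v
  proof (cases "v = 0")
    case True
    then show ?thesis using spd_scale[of u 0 0] by simp
  next
    case False
    have "spd u v = spd u (norm v *\<^sub>R (v /\<^sub>R norm v))" using False by simp
    also have "\<dots> = norm v * spd u (v /\<^sub>R norm v)" by (simp only: spd_scale) simp
    also have "\<dots> \<le> norm v * K" using False by (intro mult_left_mono K u) auto
    finally show ?thesis by (simp add: mult.commute)
  qed
  then show ?thesis using that by blast
qed

lemma len_linepath: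
  assumes "\<And>u v. u \<in> cball p r \<Longrightarrow> spd u v \<le> K * norm v" "a \<in> cball p r" "b \<in> cball p r"
  shows "len (linepath a b) \<le> ennreal (K * dist a b)"
proof -
  have "len (linepath a b) = (\<integral>\<^sup>+t. ennreal (indicator ({0..1} - {}) t * spd (linepath a b t) (b - a)) \<partial>lborel)"
    by (rule len_eq) (auto intro: has_vector_derivative_linepath_within)
  also have "\<dots> \<le> (\<integral>\<^sup>+t. ennreal (K * dist a b) * indicator {0..1::real} t \<partial>lborel)"
  proof (intro nn_integral_mono)
    fix t :: real
    have "linepath a b t \<in> cball p r" if t: "t \<in> {0..1}"
    proof -
      have "linepath a b t \<in> path_image (linepath a b)" using t by (auto simp: path_image_def)
      then show ?thesis using closed_segment_subset[OF assms(2,3) convex_cball] by auto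
    qed
    from assms(1)[OF this]
    show "ennreal (indicator ({0..1} - {}) t * spd (linepath a b t) (b - a)) \<le> ennreal (K * dist a b) * indicator {0..1} t"
      by (auto simp: indicator_def dist_norm norm_minus_commute[of a b] intro: ennreal_leI)
  qed
  also have "\<dots> = ennreal (K * dist a b)" by (subst nn_integral_cmult) (auto simp: nn_integral_indicator)
  finally show ?thesis .
qed

section \<open>The Riemannian distance as an infimum of lengths\<close>

definition paths :: "real^2 \<Rightarrow> real^2 \<Rightarrow> (real \<Rightarrow> real^2) set" where
  "paths p q = {\<gamma>. valid_path \<gamma> \<and> pathstart \<gamma> = p \<and> pathfinish \<gamma> = q}"

definition pdist :: "real^2 \<Rightarrow> real^2 \<Rightarrow> ennreal" where
  "pdist p q = (INF \<gamma>\<in>paths p q. len \<gamma>)"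

lemma linepath_paths: "linepath p q \<in> paths p q"
  by (simp add: paths_def)

lemma pdist_le_len: "\<gamma> \<in> paths p q \<Longrightarrow> pdist p q \<le> len \<gamma>"
  unfolding pdist_def by (rule INF_lower)

lemma pdist_finite: "pdist p q < \<infinity>"
proof -
  obtain K where K: "\<And>u v. u \<in> cball p (dist p q) \<Longrightarrow> spd u v \<le> K * norm v" using spd_upper[where p = p and r = "dist p q"] by blast
  have "pdist p q \<le> ennreal (K * dist p q)"
    by (rule order_trans[OF pdist_le_len[OF linepath_paths] len_linepath[OF K]]) auto
  then show ?thesis using le_less_trans[OF _ ennreal_less_top] by simp
qed

lemma pdist_lower: "ennreal (c * dist p q) \<le> pdist p q"
  unfolding pdist_def by (rule INF_greatest) (use len_lower in \<open>auto simp: paths_def\<close>)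

lemma pdist_commute_le: "pdist q p \<le> pdist p q"
  unfolding pdist_def[of p q]
proof (rule INF_greatest)
  fix \<gamma> assume \<gamma>: "\<gamma> \<in> paths p q"
  then have "reversepath \<gamma> \<in> paths q p" by (auto simp: paths_def valid_path_imp_reverse)
  from pdist_le_len[OF this] len_reversepath_le[of \<gamma>] \<gamma> show "pdist q p \<le> len \<gamma>"
    by (auto simp: paths_def)
qed

lemma pdist_triangle: "pdist p r \<le> pdist p q + pdist q r"
proof (rule ennreal_le_epsilon)
  fix e :: real assume e: "0 < e"
  have app: "\<exists>\<gamma>\<in>paths a b. len \<gamma> < pdist a b + ennreal (e/2)" for a b
  proof -
    have "pdist a b < pdist a b + ennreal (e/2)"
      using pdist_finite[of a b] e by (simp add: ennreal_add_left_cancel_less[of _ 0, simplified] less_top)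
    then show ?thesis unfolding pdist_def INF_less_iff .
  qed
  obtain \<gamma>1 \<gamma>2 where \<gamma>: "\<gamma>1 \<in> paths p q" "\<gamma>2 \<in> paths q r"
    "len \<gamma>1 < pdist p q + ennreal (e/2)" "len \<gamma>2 < pdist q r + ennreal (e/2)"
    using app[of p q] app[of q r] by blast
  then have "\<gamma>1 +++ \<gamma>2 \<in> paths p r" by (auto simp: paths_def intro: valid_path_join)
  then have "pdist p r \<le> len (\<gamma>1 +++ \<gamma>2)" by (rule pdist_le_len)
  also have "\<dots> \<le> len \<gamma>1 + len \<gamma>2" using \<gamma> by (intro len_join_le) (auto simp: paths_def)
  also have "\<dots> \<le> (pdist p q + ennreal (e/2)) + (pdist q r + ennreal (e/2))"
    using \<gamma> by (intro add_mono less_imp_le)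
  also have "\<dots> = pdist p q + pdist q r + (ennreal (e/2) + ennreal (e/2))" by (simp add: ac_simps)
  also have "ennreal (e/2) + ennreal (e/2) = ennreal e" using e by (simp flip: ennreal_plus)
  finally show "pdist p r \<le> pdist p q + pdist q r + ennreal e" .
qed

text \<open>\<open>enn2real\<close> sends infinity to \<open>0\<close>, so finiteness of the infimum
  is what makes \<open>riem_dist\<close> faithful to it.\<close>

lemma riem_dist_eq: "ennreal (riem_dist X p q) = pdist p q"
  using pdist_finite[of p q] by (simp add: riem_dist_def pdist_def paths_def len_def)

lemma riem_dist_nonneg: "0 \<le> riem_dist X p q"
  by (simp add: riem_dist_def)

lemma riem_dist_lower: "c * dist p q \<le> riem_dist X p q"
  using pdist_lower[of p q] unfolding riem_dist_eq[symmetric] by (simp add: riem_dist_nonneg)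

text \<open>Local Lipschitz comparison, by straight segments inside the convex ball; through it
  Euclidean convergence implies convergence in the Riemannian distance.\<close>

lemma riem_dist_upper:
  obtains K where "\<And>a b. a \<in> cball p r \<Longrightarrow> b \<in> cball p r \<Longrightarrow> riem_dist X a b \<le> K * dist a b"
proof -
  obtain K where K: "\<And>u v. u \<in> cball p r \<Longrightarrow> spd u v \<le> K * norm v" using spd_upper by blast
  \<comment> \<open>\<open>max 0 K\<close> keeps the bound nonnegative, as cancelling
    \<open>ennreal\<close> requires.\<close>
  have "riem_dist X a b \<le> max 0 K * dist a b" if "a \<in> cball p r" "b \<in> cball p r" for a b
  proof -
    have "ennreal (riem_dist X a b) \<le> ennreal (K * dist a b)"
      unfolding riem_dist_eq using order_trans[OF pdist_le_len[OF linepath_paths] len_linepath[OF K that]] .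
    also have "\<dots> \<le> ennreal (max 0 K * dist a b)" by (intro ennreal_leI mult_right_mono) auto
    finally show ?thesis by (simp add: ennreal_le_iff)
  qed
  then show ?thesis using that by blast
qed

sublocale Metric_space UNIV "riem_dist X"
proof
  show "riem_dist X p q = riem_dist X q p" for p q
    using antisym[OF pdist_commute_le pdist_commute_le, of p q] unfolding riem_dist_eq[symmetric]
    by (simp add: riem_dist_nonneg)
  show "(riem_dist X p q = 0) = (p = q)" for p q
  proof
    assume "riem_dist X p q = 0"
    then have "c * dist p q \<le> 0" using riem_dist_lower[of p q] by simp
    then show "p = q" using c by (simp add: mult_le_0_iff)
  next
    assume "p = q"
    obtain K where "\<And>a b. a \<in> cball p 1 \<Longrightarrow> b \<in> cball p 1 \<Longrightarrow> riem_dist X a b \<le> K * dist a b" using riem_dist_upper by blast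
    from this[of p p] show "riem_dist X p q = 0" using riem_dist_nonneg[of p p] \<open>p = q\<close> by simp
  qed
  show "riem_dist X p r \<le> riem_dist X p q + riem_dist X q r" for p q r
    using pdist_triangle[of p r q] unfolding riem_dist_eq[symmetric]
    by (simp add: riem_dist_nonneg flip: ennreal_plus)
qed (rule riem_dist_nonneg)

text \<open>The uniform lower bound makes a Cauchy sequence Euclidean Cauchy; the local Lipschitz
  bound around its Euclidean limit turns convergence back into Riemannian convergence.\<close>

lemma complete: "complete_surface X"
  unfolding complete_surface_def mcomplete_def
proof (intro conjI allI impI)
  fix s assume s: "MCauchy s"
  have "Cauchy s"
    unfolding Cauchy_def
  proof (intro allI impI)
    fix e :: real assume "e > 0"
    then obtain N where N: "\<And>n m. n \<ge> N \<Longrightarrow> m \<ge> N \<Longrightarrow> riem_dist X (s n) (s m) < c * e"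
      using s mult_pos_pos[OF c \<open>e > 0\<close>] unfolding MCauchy_def by blast
    have "dist (s m) (s n) < e" if "m \<ge> N" "n \<ge> N" for m n
      using le_less_trans[OF riem_dist_lower N[OF that]] c by simp
    then show "\<exists>M. \<forall>m\<ge>M. \<forall>n\<ge>M. dist (s m) (s n) < e" by blast
  qed
  then obtain p where p: "s \<longlonglongrightarrow> p" using Cauchy_convergent convergent_def by blast
  obtain K where K: "\<And>a b. a \<in> cball p 1 \<Longrightarrow> b \<in> cball p 1 \<Longrightarrow> riem_dist X a b \<le> K * dist a b" using riem_dist_upper by blast
  have "(\<lambda>n. riem_dist X (s n) p) \<longlonglongrightarrow> 0"
  proof (rule tendsto_sandwich[where f = "\<lambda>_. 0" and h = "\<lambda>n. K * dist (s n) p"])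
    show "(\<lambda>n. K * dist (s n) p) \<longlonglongrightarrow> 0"
      using tendsto_mult_right_zero[OF iffD1[OF tendsto_dist_iff p]] .
    have "\<forall>\<^sub>F n in sequentially. dist (s n) p < 1" using p by (rule tendstoD) simp
    then show "\<forall>\<^sub>F n in sequentially. riem_dist X (s n) p \<le> K * dist (s n) p"
    proof eventually_elim
      case (elim n)
      then show ?case by (intro K) (auto simp: dist_commute)
    qed
  qed (auto simp: riem_dist_nonneg)
  then show "\<exists>x. limitin mtopology s x sequentially"
    by (intro exI[of _ p]) (auto simp: limit_metric_sequentially LIMSEQ_iff riem_dist_nonneg)
qed (rule Metric_space_axioms)

end

section \<open>Stationary graphs\<close>

lemma matrix_inv_eqI:
  fixes A :: "'a::semiring_1^'n^'m"
  assumes "A ** B = mat 1" "B ** A = mat 1"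
  shows "matrix_inv A = B"
  unfolding matrix_inv_def
proof (rule some_equality)
  fix C assume C: "A ** C = mat 1 \<and> C ** A = mat 1"
  have "C = C ** (A ** B)" by (simp add: assms)
  also have "\<dots> = B" using C by (simp add: matrix_mul_assoc)
  finally show "C = B" .
qed (use assms in simp)

lemma smooth_on_pd: "smooth_on UNIV f \<Longrightarrow> smooth_on UNIV (pd i f)"
  unfolding smooth_on_def
proof
  fix k assume "\<forall>k. Ck_on k UNIV f"
  then have "Ck_on (Suc k) UNIV f" by blast
  then show "Ck_on k UNIV (pd i f)"
    by (auto simp: pd_def[abs_def] axis_in_Basis_iff)
qed

lemma has_derivative_pd:
  fixes f :: "real^2 \<Rightarrow> 'b::real_normed_vector"
  assumes "f differentiable at u"
  shows "(f has_derivative (\<lambda>h. (h$1) *\<^sub>R pd 1 f u + (h$2) *\<^sub>R pd 2 f u)) (at u)"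
proof -
  have der: "(f has_derivative frechet_derivative f (at u)) (at u)"
    using assms frechet_derivative_works by blast
  note lin = has_derivative_linear[OF der]
  have "frechet_derivative f (at u) h = (h$1) *\<^sub>R pd 1 f u + (h$2) *\<^sub>R pd 2 f u" for h :: "real^2"
  proof -
    have "h = (h$1) *\<^sub>R axis 1 1 + (h$2) *\<^sub>R axis 2 1"
      by (simp add: vec_eq_iff forall_2 axis_def)
    then have "frechet_derivative f (at u) h = frechet_derivative f (at u) ((h$1) *\<^sub>R axis 1 1 + (h$2) *\<^sub>R axis 2 1)"
      by simp
    then show ?thesis by (simp add: linear_add[OF lin] linear_cmul[OF lin] pd_def)
  qed
  then show ?thesis by (intro has_derivative_eq_rhs[OF der] ext)
qed

lemma smooth_on_has_derivative_pd:
  fixes f :: "real^2 \<Rightarrow> 'b::real_normed_vector"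
  assumes "smooth_on UNIV f"
  shows "(f has_derivative (\<lambda>h. (h$1) *\<^sub>R pd 1 f u + (h$2) *\<^sub>R pd 2 f u)) (at u)"
proof (rule has_derivative_pd)
  have "Ck_on (Suc 0) UNIV f" using assms unfolding smooth_on_def by blast
  then show "f differentiable at u" by simp
qed

lemma smooth_on_continuous: "smooth_on UNIV f \<Longrightarrow> continuous_on UNIV f"
  unfolding smooth_on_def by (metis Ck_on.simps(1))

lemma pd_eq:
  assumes "(f has_derivative f') (at u)"
  shows "pd i f u = f' (axis i 1)"
  using frechet_derivative_at[OF assms] by (simp add: pd_def)

lemma smooth_on_pd_commute:
  fixes f :: "real^2 \<Rightarrow> real^2"
  assumes f: "smooth_on UNIV f"
  shows "pd 1 (pd 2 f) u = pd 2 (pd 1 f) u"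
proof -
  note f1 = smooth_on_pd[OF f, of 1] and f2 = smooth_on_pd[OF f, of 2]
  have "pd 2 (pd 1 f) u $ k = pd 1 (pd 2 f) u $ k" for k
  proof -
    have nth: "((\<lambda>x. q x $ k) has_derivative (\<lambda>h. h$1 * pd 1 q x $ k + h$2 * pd 2 q x $ k)) (at x)"
      if "smooth_on UNIV q" for q :: "real^2 \<Rightarrow> real^2" and x
      using bounded_linear.has_derivative[OF bounded_linear_vec_nth smooth_on_has_derivative_pd[OF that], of k x] by simp
    have c: "continuous (at x) (\<lambda>y. (v$1) * pd 1 q y $ k + (v$2) * pd 2 q y $ k)"
      if "smooth_on UNIV q" for q :: "real^2 \<Rightarrow> real^2" and x v :: "real^2"
      using smooth_on_continuous[OF smooth_on_pd[OF that]]
      by (intro continuous_intros) (auto simp: continuous_on_eq_continuous_at)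
    have g: "((\<lambda>x. (axis i 1 :: real^2)$1 * pd 1 f x $ k + (axis i 1 :: real^2)$2 * pd 2 f x $ k) has_derivative
        (\<lambda>h. h$1 * pd 1 (pd i f) x $ k + h$2 * pd 2 (pd i f) x $ k)) (at x)" for i x
      using nth[OF smooth_on_pd[OF f, of i]] exhaust_2[of i] by (auto simp: axis_def)
    from mixed_second_derivatives_eq[OF nth[OF f] g[of 1] g[of 2] c[OF f1] c[OF f2], of u]
    show ?thesis by (simp add: axis_def)
  qed
  then show ?thesis by (simp add: vec_eq_iff)
qed

text \<open>Splits Minkowski space into the space-like target plane and the time-like parameter
  plane. It is linear in the pair of arguments, so derivatives of the graph pass through it.\<close>

definition emb :: "real^2 \<Rightarrow> real^2 \<Rightarrow> real^4" where
  "emb v h = vector [v $ 1, v $ 2, h $ 1, h $ 2]"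

lemma emb_nth: "emb v h $ 1 = v $ 1" "emb v h $ 2 = v $ 2" "emb v h $ 3 = h $ 1" "emb v h $ 4 = h $ 2"
  by (simp_all add: emb_def vector_4)

lemma linear_emb: "linear (\<lambda>p. emb (fst p) (snd p))"
  by (rule linearI) (simp_all add: vec_eq_iff forall_4 emb_nth)

lemma emb_has_derivative:
  assumes "(f has_derivative f') (at x)" "(g has_derivative g') (at x)"
  shows "((\<lambda>x. emb (f x) (g x)) has_derivative (\<lambda>h. emb (f' h) (g' h))) (at x)"
  using bounded_linear.has_derivative[OF linear_conv_bounded_linear[THEN iffD1, OF linear_emb] has_derivative_Pair[OF assms]]
  by simp

lemma mink_emb: "mink (emb v h) (emb w k) = v \<bullet> w + h $ 1 * k $ 1 - h $ 2 * k $ 2"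
  by (simp add: mink_def emb_nth inner_vec_def UNIV_2)

lemma graph_param_emb: "graph_param F u = emb (F u) u"
  by (simp add: graph_param_def emb_def)

section \<open>First and second derivatives of a graph and its induced metric\<close>

locale smooth_graph =
  fixes F :: "real^2 \<Rightarrow> real^2"
  assumes smooth: "smooth_on UNIV F"
begin

abbreviation "X \<equiv> graph_param F"
abbreviation "F1 \<equiv> pd 1 F"
abbreviation "F2 \<equiv> pd 2 F"
abbreviation "F11 \<equiv> pd 1 (pd 1 F)"
abbreviation "F12 \<equiv> pd 1 (pd 2 F)"
abbreviation "F22 \<equiv> pd 2 (pd 2 F)"

lemma F21: "pd 2 (pd 1 F) u = F12 u"
  using smooth_on_pd_commute[OF smooth] by simp

lemma F_der: "(F has_derivative (\<lambda>h. (h$1) *\<^sub>R F1 u + (h$2) *\<^sub>R F2 u)) (at u)"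
  by (rule smooth_on_has_derivative_pd[OF smooth])

lemma F1_der: "(F1 has_derivative (\<lambda>h. (h$1) *\<^sub>R F11 u + (h$2) *\<^sub>R F12 u)) (at u)"
  using smooth_on_has_derivative_pd[OF smooth_on_pd[OF smooth, of 1], of u] by (simp add: F21)

lemma F2_der: "(F2 has_derivative (\<lambda>h. (h$1) *\<^sub>R F12 u + (h$2) *\<^sub>R F22 u)) (at u)"
  by (rule smooth_on_has_derivative_pd[OF smooth_on_pd[OF smooth]])

lemma F_cont: "continuous_on UNIV (pd i F)" "continuous_on UNIV (pd i (pd j F))"
  by (intro smooth_on_continuous smooth_on_pd smooth)+

definition X' :: "real^2 \<Rightarrow> real^2 \<Rightarrow> real^4" where
  "X' u h = emb ((h$1) *\<^sub>R F1 u + (h$2) *\<^sub>R F2 u) h"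

lemma X_der: "(X has_derivative X' u) (at u)"
  unfolding graph_param_emb[abs_def] X'_def by (intro emb_has_derivative F_der has_derivative_ident)

lemma pd_X: "pd i X u = emb (pd i F u) (axis i 1)"
  unfolding pd_eq[OF X_der] X'_def using exhaust_2[of i] by (auto simp: axis_def)

lemma pd_pd_X: "pd i (pd j X) u = emb (pd i (pd j F) u) 0"
proof -
  have "(pd j F has_derivative (\<lambda>h. (h$1) *\<^sub>R pd 1 (pd j F) u + (h$2) *\<^sub>R pd 2 (pd j F) u)) (at u)"
    by (rule smooth_on_has_derivative_pd[OF smooth_on_pd[OF smooth]])
  from emb_has_derivative[OF this has_derivative_const]
  have "(pd j X has_derivative (\<lambda>h. emb ((h$1) *\<^sub>R pd 1 (pd j F) u + (h$2) *\<^sub>R pd 2 (pd j F) u) 0)) (at u)"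
    unfolding pd_X[abs_def] .
  from pd_eq[OF this] show ?thesis using exhaust_2[of i] by (auto simp: axis_def)
qed

definition E :: "real^2 \<Rightarrow> real" where "E u = 1 + F1 u \<bullet> F1 u"
definition M :: "real^2 \<Rightarrow> real" where "M u = F1 u \<bullet> F2 u"
definition G :: "real^2 \<Rightarrow> real" where "G u = F2 u \<bullet> F2 u - 1"
definition W :: "real^2 \<Rightarrow> real" where "W u = sqrt (E u * G u - (M u)\<^sup>2)"

lemma fff_X: "fff X u $ 1 $ 1 = E u" "fff X u $ 1 $ 2 = M u" "fff X u $ 2 $ 1 = M u" "fff X u $ 2 $ 2 = G u"
  by (simp_all add: fff_def pd_X mink_emb E_def M_def G_def axis_def inner_commute)

lemma mink_X': "mink (X' u h) (X' u h) = E u * (h$1)\<^sup>2 + 2 * M u * (h$1) * (h$2) + G u * (h$2)\<^sup>2"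
  unfolding X'_def mink_emb E_def M_def G_def
  by (simp add: inner_add_left inner_add_right inner_commute power2_eq_square algebra_simps)

end

locale spacelike_graph = smooth_graph +
  assumes spacelike: "spacelike (graph_param F)"
begin

lemma pos: "E u > 0" "E u * G u - (M u)\<^sup>2 > 0"
proof -
  have q: "E u * (h$1)\<^sup>2 + 2 * M u * (h$1) * (h$2) + G u * (h$2)\<^sup>2 > 0" if "h \<noteq> 0" for h :: "real^2"
    using spacelike that unfolding spacelike_def frechet_derivative_at[OF X_der, symmetric] mink_X' by blast
  have "(axis 1 1 :: real^2) \<noteq> 0" by (simp add: axis_eq_0_iff)
  from q[OF this] show E: "E u > 0" by (simp add: axis_def)
  \<comment> \<open>The vector \<open>(- M, E)\<close> is orthogonal to the first coordinate field;
    the quadratic form takes the value \<open>E (E G - M^2)\<close> on it.\<close>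
  have "(vector [- M u, E u] :: real^2) \<noteq> 0" using E by (simp add: vec_eq_iff forall_2)
  from q[OF this] have "E u * (E u * G u - (M u)\<^sup>2) > 0"
    by (simp add: power2_eq_square algebra_simps)
  then show "E u * G u - (M u)\<^sup>2 > 0" using E by (simp add: zero_less_mult_iff)
qed

lemma W_pos: "W u > 0" and W_sq: "(W u)\<^sup>2 = E u * G u - (M u)\<^sup>2"
  using pos(2)[of u] by (simp_all add: W_def)

lemma det_fff: "det (fff X u) = (W u)\<^sup>2"
  unfolding W_sq by (simp add: det_2 fff_X power2_eq_square)

lemma ginv_X:
  "ginv X u $ 1 $ 1 = G u / (W u)\<^sup>2" "ginv X u $ 1 $ 2 = - M u / (W u)\<^sup>2"
  "ginv X u $ 2 $ 1 = - M u / (W u)\<^sup>2" "ginv X u $ 2 $ 2 = E u / (W u)\<^sup>2"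
proof -
  let ?B = "vector [vector [G u / (W u)\<^sup>2, - M u / (W u)\<^sup>2], vector [- M u / (W u)\<^sup>2, E u / (W u)\<^sup>2]] :: real^2^2"
  have "E u * G u - M u * M u = (W u)\<^sup>2" using W_sq by (simp add: power2_eq_square)
  then have "fff X u ** ?B = mat 1" "?B ** fff X u = mat 1"
    using W_pos[of u]
    by (simp_all add: vec_eq_iff forall_2 matrix_matrix_mult_def UNIV_2 fff_X mat_def field_simps)
  then have "ginv X u = ?B"
    unfolding ginv_def by (simp add: matrix_inv_eqI)
  then show "ginv X u $ 1 $ 1 = G u / (W u)\<^sup>2" "ginv X u $ 1 $ 2 = - M u / (W u)\<^sup>2"
    "ginv X u $ 2 $ 1 = - M u / (W u)\<^sup>2" "ginv X u $ 2 $ 2 = E u / (W u)\<^sup>2" by simp_all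
qed

end

section \<open>Minimal surface equation and constancy of the conformal class\<close>

locale stationary_graph = spacelike_graph +
  assumes stationary: "stationary (graph_param F)"
begin

text \<open>The mean curvature is half the normal part of the metric trace \<open>t\<close> of the
  second derivatives. These have no component in the parameter plane, whereas the tangent vectors
  project there to the standard basis. So the tangential coefficients \<open>\<tau>1\<close> and
  \<open>\<tau>2\<close> vanish as well, and the full trace is zero.\<close>

lemma minimal_surface_eq: "G u *\<^sub>R F11 u - (2 * M u) *\<^sub>R F12 u + E u *\<^sub>R F22 u = 0"
proof -
  define a b d where "a = ginv X u $ 1 $ 1" and "b = ginv X u $ 1 $ 2" and "d = ginv X u $ 2 $ 2"
  have b': "ginv X u $ 2 $ 1 = b" by (simp add: b_def ginv_X)
  define t where "t = a *\<^sub>R F11 u + (2 * b) *\<^sub>R F12 u + d *\<^sub>R F22 u"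
  define \<tau>1 \<tau>2 where "\<tau>1 = a * (t \<bullet> F1 u) + b * (t \<bullet> F2 u)" and "\<tau>2 = b * (t \<bullet> F1 u) + d * (t \<bullet> F2 u)"
  have "2 *\<^sub>R mean_curvature X u = emb t 0 - \<tau>1 *\<^sub>R pd 1 X u - \<tau>2 *\<^sub>R pd 2 X u"
    unfolding mean_curvature_def second_ff_def normal_part_def pd_pd_X F21 sum_2 b'
      a_def[symmetric] b_def[symmetric] d_def[symmetric]
    unfolding pd_X mink_emb \<tau>1_def \<tau>2_def t_def
    by (simp add: vec_eq_iff forall_4 emb_nth inner_add_left algebra_simps)
  then have eq: "emb t 0 - \<tau>1 *\<^sub>R pd 1 X u - \<tau>2 *\<^sub>R pd 2 X u = 0"
    using stationary by (simp add: stationary_def)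
  have "\<tau>1 = 0" "\<tau>2 = 0"
    using arg_cong[OF eq, of "\<lambda>x. x $ 3"] arg_cong[OF eq, of "\<lambda>x. x $ 4"]
    by (simp_all add: pd_X emb_nth axis_def)
  with eq have "emb t 0 = 0" by simp
  then have "t $ 1 = 0" "t $ 2 = 0"
    using emb_nth(1,2)[of t 0] by simp_all
  then have "t = 0" by (simp add: vec_eq_iff forall_2)
  then have "(W u)\<^sup>2 *\<^sub>R t = 0" by simp
  then show ?thesis
    using W_pos[of u] by (simp add: t_def a_def b_def d_def ginv_X scaleR_add_right scaleR_diff_right)
qed

end

text \<open>Closedness of the rows \<open>(r, s)\<close> and \<open>(s, t)\<close> is encoded by
  sharing: \<open>k\<close> is at once the second derivative direction of \<open>r\<close> and the
  first of \<open>s\<close>, and \<open>l\<close> plays the same part for \<open>s\<close> and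
  \<open>t\<close>. The potentials \<open>P\<close> and \<open>Q\<close> of the rows are the
  components of the gradient of \<open>u\<close>, which is the form in which \<open>jorgens\<close>
  takes its data.\<close>

lemma jorgens_closed_fields:
  fixes r s t :: "real^2 \<Rightarrow> real"
  assumes r: "\<And>u. (r has_derivative (\<lambda>h. h$1 * r1 u + h$2 * k u)) (at u)"
    and s: "\<And>u. (s has_derivative (\<lambda>h. h$1 * k u + h$2 * l u)) (at u)"
    and t: "\<And>u. (t has_derivative (\<lambda>h. h$1 * l u + h$2 * t2 u)) (at u)"
    and cont: "continuous_on UNIV r1" "continuous_on UNIV k" "continuous_on UNIV l" "continuous_on UNIV t2"
    and pos: "\<And>u. r u > 0" and det: "\<And>u. r u * t u - (s u)\<^sup>2 = 1"
  shows "r u = r v" "s u = s v" "t u = t v"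
proof -
  have inner: "(x :: real^2) \<bullet> y = x$1 * y$1 + x$2 * y$2" for x y
    by (simp add: inner_vec_def UNIV_2)
  obtain P where P: "\<And>u. (P has_derivative (\<lambda>h. (vector [r u, s u] :: real^2) \<bullet> h)) (at u)"
    by (rule closed_field_has_potential[OF vector_2_has_derivative[OF r s]])
      (auto intro!: continuous_on_vector_2 continuous_intros cont simp: inner algebra_simps)
  obtain Q where Q: "\<And>u. (Q has_derivative (\<lambda>h. (vector [s u, t u] :: real^2) \<bullet> h)) (at u)"
    by (rule closed_field_has_potential[OF vector_2_has_derivative[OF s t]])
      (auto intro!: continuous_on_vector_2 continuous_intros cont simp: inner algebra_simps)
  define e where "e z = (vector [Re z, Im z] :: real^2)" for z
  have e: "(e has_derivative e) (at z)" for z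
    unfolding e_def by (intro vector_2_has_derivative bounded_linear.has_derivative[OF bounded_linear_Re]
      bounded_linear.has_derivative[OF bounded_linear_Im] has_derivative_ident)
  have e_nth: "e z $ 1 = Re z" "e z $ 2 = Im z" for z by (simp_all add: e_def)
  have P': "((\<lambda>z. P (e z)) has_derivative (\<lambda>h. r (e z) * Re h + s (e z) * Im h)) (at z)" for z
    using has_derivative_compose[OF e P] by (simp add: inner e_nth)
  have Q': "((\<lambda>z. Q (e z)) has_derivative (\<lambda>h. s (e z) * Re h + t (e z) * Im h)) (at z)" for z
    using has_derivative_compose[OF e Q] by (simp add: inner e_nth)
  have e_Complex: "e (Complex (u$1) (u$2)) = u" for u
    by (simp add: e_def vec_eq_iff forall_2)
  note const = jorgens[OF P' Q' pos det, of "Complex (u$1) (u$2)" "Complex (v$1) (v$2)"]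
  show "r u = r v" "s u = s v" "t u = t v" using const unfolding e_Complex .
qed

context stationary_graph
begin

text \<open>\<open>D1\<close> and \<open>D2\<close> are the partial derivatives of
  \<open>W^2 = E G - M^2\<close>.\<close>

definition D1 :: "real^2 \<Rightarrow> real" where
  "D1 u = 2 * (F1 u \<bullet> F11 u) * G u + E u * (2 * (F2 u \<bullet> F12 u)) - 2 * M u * (F2 u \<bullet> F11 u + F1 u \<bullet> F12 u)"
definition D2 :: "real^2 \<Rightarrow> real" where
  "D2 u = 2 * (F1 u \<bullet> F12 u) * G u + E u * (2 * (F2 u \<bullet> F22 u)) - 2 * M u * (F2 u \<bullet> F12 u + F1 u \<bullet> F22 u)"

lemma E_der: "(E has_derivative (\<lambda>h. h$1 * (2 * (F1 u \<bullet> F11 u)) + h$2 * (2 * (F1 u \<bullet> F12 u)))) (at u)"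
  unfolding E_def[abs_def]
  by (rule has_derivative_eq_rhs[OF has_derivative_add[OF has_derivative_const has_derivative_inner[OF F1_der F1_der]]])
    (simp add: fun_eq_iff inner_add_left inner_add_right inner_commute algebra_simps)

lemma M_der: "(M has_derivative (\<lambda>h. h$1 * (F2 u \<bullet> F11 u + F1 u \<bullet> F12 u) + h$2 * (F2 u \<bullet> F12 u + F1 u \<bullet> F22 u))) (at u)"
  unfolding M_def[abs_def]
  by (rule has_derivative_eq_rhs[OF has_derivative_inner[OF F1_der F2_der]])
    (simp add: fun_eq_iff inner_add_left inner_add_right inner_commute algebra_simps)

lemma G_der: "(G has_derivative (\<lambda>h. h$1 * (2 * (F2 u \<bullet> F12 u)) + h$2 * (2 * (F2 u \<bullet> F22 u)))) (at u)"
  unfolding G_def[abs_def]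
  by (rule has_derivative_eq_rhs[OF has_derivative_diff[OF has_derivative_inner[OF F2_der F2_der] has_derivative_const]])
    (simp add: fun_eq_iff inner_add_left inner_add_right inner_commute algebra_simps)

lemma W_der: "(W has_derivative (\<lambda>h. h$1 * (D1 u / (2 * W u)) + h$2 * (D2 u / (2 * W u)))) (at u)"
proof -
  have "((\<lambda>u. E u * G u - M u * M u) has_derivative (\<lambda>h. h$1 * D1 u + h$2 * D2 u)) (at u)"
    by (rule has_derivative_eq_rhs[OF has_derivative_diff[OF has_derivative_mult[OF E_der G_der] has_derivative_mult[OF M_der M_der]]])
      (simp add: fun_eq_iff D1_def D2_def algebra_simps)
  from has_derivative_real_sqrt[OF _ this] pos(2)[of u]
  have "((\<lambda>u. sqrt (E u * G u - M u * M u)) has_derivative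
      (\<lambda>h. (h$1 * D1 u + h$2 * D2 u) * (inverse (sqrt (E u * G u - M u * M u)) / 2))) (at u)"
    by (simp add: power2_eq_square)
  then show ?thesis
    unfolding W_def[abs_def] power2_eq_square
    by (rule has_derivative_eq_rhs) (simp add: fun_eq_iff field_simps add_divide_distrib)
qed

lemma quot_der:
  assumes "(Y has_derivative (\<lambda>h. h$1 * y1 + h$2 * y2)) (at u)"
  shows "((\<lambda>u. Y u / W u) has_derivative
    (\<lambda>h. h$1 * ((2 * (W u)\<^sup>2 * y1 - Y u * D1 u) / (2 * (W u)^3)) + h$2 * ((2 * (W u)\<^sup>2 * y2 - Y u * D2 u) / (2 * (W u)^3)))) (at u)"
proof (rule has_derivative_eq_rhs[OF has_derivative_divide'[OF assms W_der]])
  show "W u \<noteq> 0" using W_pos[of u] by simp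
  then show "(\<lambda>h. ((h$1 * y1 + h$2 * y2) * W u - Y u * (h$1 * (D1 u / (2 * W u)) + h$2 * (D2 u / (2 * W u)))) / (W u * W u))
    = (\<lambda>h. h$1 * ((2 * (W u)\<^sup>2 * y1 - Y u * D1 u) / (2 * (W u)^3)) + h$2 * ((2 * (W u)\<^sup>2 * y2 - Y u * D2 u) / (2 * (W u)^3)))"
    by (intro ext) (simp add: field_simps power2_eq_square power3_eq_cube)
qed

lemma minimal_inner:
  "G u * (v \<bullet> F11 u) - 2 * M u * (v \<bullet> F12 u) + E u * (v \<bullet> F22 u) = 0"
  using arg_cong[OF minimal_surface_eq[of u], of "\<lambda>x. v \<bullet> x"] by (simp add: inner_add_right inner_diff_right)

text \<open>With the common denominator \<open>2 W^3\<close> cleared, these read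
  \<open>(E/W)_2 = (M/W)_1\<close> and \<open>(M/W)_2 = (G/W)_1\<close>. Both follow from the
  minimal surface equation paired with \<open>F1\<close> and \<open>F2\<close>.\<close>

lemma closed:
  "2 * (W u)\<^sup>2 * (2 * (F1 u \<bullet> F12 u)) - E u * D2 u = 2 * (W u)\<^sup>2 * (F2 u \<bullet> F11 u + F1 u \<bullet> F12 u) - M u * D1 u"
  "2 * (W u)\<^sup>2 * (F2 u \<bullet> F12 u + F1 u \<bullet> F22 u) - M u * D2 u = 2 * (W u)\<^sup>2 * (2 * (F2 u \<bullet> F12 u)) - G u * D1 u"
  using minimal_inner[of u "F1 u"] minimal_inner[of u "F2 u"] unfolding W_sq D1_def D2_def by algebra+

lemma conformal_constants:
  obtains r s t where "r > 0" "r * t - s\<^sup>2 = 1" "\<And>u. E u = r * W u" "\<And>u. M u = s * W u" "\<And>u. G u = t * W u"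
    "\<And>u. t *\<^sub>R F11 u - (2 * s) *\<^sub>R F12 u + r *\<^sub>R F22 u = 0"
proof -
  have W0: "W u \<noteq> 0" for u using W_pos[of u] by simp
  have cE: "continuous_on UNIV E" "continuous_on UNIV M" "continuous_on UNIV G" "continuous_on UNIV W"
    using E_der M_der G_der W_der by (auto intro!: continuous_at_imp_continuous_on has_derivative_continuous)
  have c: "continuous_on UNIV D1" "continuous_on UNIV D2"
    unfolding D1_def[abs_def] D2_def[abs_def] by (intro continuous_intros cE F_cont)+
  note ci = continuous_intros cE c F_cont
  have pos': "E u / W u > 0" for u using pos(1) W_pos by simp
  have det: "E u / W u * (G u / W u) - (M u / W u)\<^sup>2 = 1" for u
  proof -
    have "E u / W u * (G u / W u) - (M u / W u)\<^sup>2 = (E u * G u - (M u)\<^sup>2) / (W u)\<^sup>2"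
      by (simp add: power2_eq_square diff_divide_distrib)
    then show ?thesis using W0[of u] by (simp add: W_sq[symmetric])
  qed
  \<comment> \<open>Rewriting by \<open>closed\<close> makes the mixed derivative terms
    syntactically equal, as the shared \<open>k\<close> and \<open>l\<close> of
    \<open>jorgens_closed_fields\<close> demand.\<close>
  note qE = quot_der[OF E_der, unfolded closed(1)] and qM = quot_der[OF M_der, unfolded closed(2)] and qG = quot_der[OF G_der]
  note const = jorgens_closed_fields[OF qE qM qG _ _ _ _ pos' det]
  define r s t where "r = E 0 / W 0" and "s = M 0 / W 0" and "t = G 0 / W 0"
  have "E u / W u = r" "M u / W u = s" "G u / W u = t" for u
    unfolding r_def s_def t_def by (rule const; (intro ci)?; simp add: W0)+
  then have eqs: "E u = r * W u" "M u = s * W u" "G u = t * W u" for u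
    using W0[of u] by (metis nonzero_divide_eq_eq)+
  have "t *\<^sub>R F11 u - (2 * s) *\<^sub>R F12 u + r *\<^sub>R F22 u = 0" for u
  proof -
    have "W u *\<^sub>R (t *\<^sub>R F11 u - (2 * s) *\<^sub>R F12 u + r *\<^sub>R F22 u) = 0"
      using minimal_surface_eq[of u] unfolding eqs
      by (simp add: scaleR_add_right scaleR_diff_right mult.commute mult.left_commute)
    then show ?thesis using W0[of u] by simp
  qed
  moreover have "r > 0" "r * t - s\<^sup>2 = 1" using pos' det by (simp_all add: r_def s_def t_def)
  ultimately show ?thesis using that[OF _ _ eqs] by blast
qed

end

section \<open>Gauss curvature of a conformally flat metric\<close>

text \<open>For a constant metric \<open>(r, s; s, t)\<close> of determinant 1 and its Laplacian
  \<open>Lap \<rho> = t \<rho>11 - 2 s \<rho>12 + r \<rho>22\<close>, this is the classical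
  \<open>K = - exp (- 2 \<rho>) Lap \<rho>\<close>.\<close>

lemma gauss_curvature_conformal:
  fixes X :: "real^2 \<Rightarrow> real^4" and \<rho> :: "real^2 \<Rightarrow> real"
  assumes g: "\<And>u. fff X u $ 1 $ 1 = exp (2 * \<rho> u) * r" "\<And>u. fff X u $ 1 $ 2 = exp (2 * \<rho> u) * s"
      "\<And>u. fff X u $ 2 $ 1 = exp (2 * \<rho> u) * s" "\<And>u. fff X u $ 2 $ 2 = exp (2 * \<rho> u) * t"
    and det: "r * t - s\<^sup>2 = 1"
    and \<rho>: "\<And>u. (\<rho> has_derivative (\<lambda>h. h$1 * \<rho>1 u + h$2 * \<rho>2 u)) (at u)"
    and \<rho>1: "\<And>u. (\<rho>1 has_derivative (\<lambda>h. h$1 * \<rho>11 u + h$2 * \<rho>12 u)) (at u)"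
    and \<rho>2: "\<And>u. (\<rho>2 has_derivative (\<lambda>h. h$1 * \<rho>12 u + h$2 * \<rho>22 u)) (at u)"
  shows "gauss_curvature X u * exp (2 * \<rho> u) = - (t * \<rho>11 u - 2 * s * \<rho>12 u + r * \<rho>22 u)"
proof -
  define W where "W u = exp (2 * \<rho> u)" for u
  have W0: "W u > 0" for u by (simp add: W_def)
  have det': "r * t = 1 + s * s" using det by (simp add: power2_eq_square)
  have Wd: "(W has_derivative (\<lambda>h. h$1 * (2 * W u * \<rho>1 u) + h$2 * (2 * W u * \<rho>2 u))) (at u)" for u
    unfolding W_def[abs_def]
    by (rule has_derivative_eq_rhs[OF has_derivative_exp[OF has_derivative_mult_right[OF \<rho>]]]) (simp add: fun_eq_iff algebra_simps)
  have pdW: "pd 1 (\<lambda>u. W u * c) u = 2 * W u * \<rho>1 u * c" "pd 2 (\<lambda>u. W u * c) u = 2 * W u * \<rho>2 u * c" for u c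
    using pd_eq[OF has_derivative_mult_left[OF Wd]] by (simp_all add: axis_def)
  note gW = g[folded W_def]
  define w where "w u = inverse (W u)" for u
  have w: "w u * W u = 1" for u using W0[of u] by (simp add: w_def)
  have ginv: "ginv X u = vector [vector [t * w u, - s * w u], vector [- s * w u, r * w u]]" for u
    unfolding ginv_def
  proof (rule matrix_inv_eqI)
    let ?B = "vector [vector [t * w u, - s * w u], vector [- s * w u, r * w u]] :: real^2^2"
    have "W u * r * (t * w u) + W u * s * (- s * w u) = 1" "W u * r * (- s * w u) + W u * s * (r * w u) = 0"
      "W u * s * (t * w u) + W u * t * (- s * w u) = 0" "W u * s * (- s * w u) + W u * t * (r * w u) = 1"
      "t * w u * (W u * r) + - s * w u * (W u * s) = 1" "t * w u * (W u * s) + - s * w u * (W u * t) = 0"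
      "- s * w u * (W u * r) + r * w u * (W u * s) = 0" "- s * w u * (W u * s) + r * w u * (W u * t) = 1"
      using w[of u] det' by algebra+
    then show "fff X u ** ?B = mat 1" "?B ** fff X u = mat 1"
      by (simp_all add: vec_eq_iff forall_2 matrix_matrix_mult_def sum_2 gW mat_def)
  qed
  have chr: "christoffel X k i j u = 1/2 * (ginv X u $ k $ 1 * (pd i (\<lambda>w. fff X w $ j $ 1) u + pd j (\<lambda>w. fff X w $ i $ 1) u - pd 1 (\<lambda>w. fff X w $ i $ j) u)
      + ginv X u $ k $ 2 * (pd i (\<lambda>w. fff X w $ j $ 2) u + pd j (\<lambda>w. fff X w $ i $ 2) u - pd 2 (\<lambda>w. fff X w $ i $ j) u))" for k i j u
    by (simp add: christoffel_def sum_2)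
  have ginv_nth: "ginv X u $ 1 $ 1 = t * w u" "ginv X u $ 1 $ 2 = - s * w u" "ginv X u $ 2 $ 1 = - s * w u" "ginv X u $ 2 $ 2 = r * w u" for u
    by (simp_all add: ginv)
  \<comment> \<open>The conformal formula: \<open>christoffel k i j\<close> is the sum of \<rho>_j
    if \<open>k = i\<close> and \<rho>_i if \<open>k = j\<close>, minus \<open>g_ij\<close> times
    the \<open>k\<close>-th component of the gradient of \<rho>. All coefficients are constant, so
    the derivatives needed for the curvature reduce to \<open>lin\<close>.\<close>
  have "christoffel X 1 1 1 u = (2 - r * t) * \<rho>1 u + r * s * \<rho>2 u"
    "christoffel X 1 1 2 u = - s * t * \<rho>1 u + (1 + s * s) * \<rho>2 u"
    "christoffel X 1 2 1 u = - s * t * \<rho>1 u + (1 + s * s) * \<rho>2 u"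
    "christoffel X 1 2 2 u = - t * t * \<rho>1 u + s * t * \<rho>2 u"
    "christoffel X 2 1 1 u = r * s * \<rho>1 u + - r * r * \<rho>2 u"
    "christoffel X 2 1 2 u = (1 + s * s) * \<rho>1 u + - r * s * \<rho>2 u"
    "christoffel X 2 2 1 u = (1 + s * s) * \<rho>1 u + - r * s * \<rho>2 u"
    "christoffel X 2 2 2 u = s * t * \<rho>1 u + (2 - r * t) * \<rho>2 u" for u
    using w[of u] det' unfolding chr gW pdW ginv_nth by algebra+
  note chr_eq = this
  have lin: "pd 1 (\<lambda>u. \<alpha> * \<rho>1 u + \<beta> * \<rho>2 u) u = \<alpha> * \<rho>11 u + \<beta> * \<rho>12 u"
    "pd 2 (\<lambda>u. \<alpha> * \<rho>1 u + \<beta> * \<rho>2 u) u = \<alpha> * \<rho>12 u + \<beta> * \<rho>22 u" for \<alpha> \<beta> u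
    using pd_eq[OF has_derivative_add[OF has_derivative_mult_right[OF \<rho>1] has_derivative_mult_right[OF \<rho>2]]]
    by (simp_all add: axis_def)
  have "det (fff X u) = W u * W u"
    using det' unfolding det_2 gW by algebra
  then have "gauss_curvature X u * W u = (riemann X 1 1 2 2 u * (W u * r) + riemann X 2 1 2 2 u * (W u * s)) * W u / (W u * W u)"
    by (simp add: gauss_curvature_def sum_2 gW)
  also have "\<dots> = r * riemann X 1 1 2 2 u + s * riemann X 2 1 2 2 u"
    using W0[of u] by (simp add: field_simps)
  also have "\<dots> = - (t * \<rho>11 u - 2 * s * \<rho>12 u + r * \<rho>22 u)"
    using det' unfolding riemann_def sum_2 chr_eq chr_eq[abs_def] lin by algebra
  finally show ?thesis by (simp add: W_def)
qed

section \<open>The Gauss map\<close>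

lemma Ck_on_affine:
  assumes "bounded_linear B"
  shows "Ck_on k UNIV (\<lambda>x. B x + c)"
  using assms
proof (induction k arbitrary: B c)
  case 0
  then show ?case by (simp add: continuous_on_add linear_continuous_on)
next
  case (Suc k)
  have der: "((\<lambda>x. B x + c) has_derivative B) (at x)" for x
    using has_derivative_add[OF bounded_linear_imp_has_derivative[OF Suc.prems] has_derivative_const] by simp
  have "Ck_on k UNIV (\<lambda>x. frechet_derivative (\<lambda>x. B x + c) (at x) b)" for b
    using Suc.IH[OF bounded_linear_zero, of "B b"] by (simp add: frechet_derivative_at[OF der, symmetric])
  then show ?case using der by (auto simp: differentiable_def)
qed

text \<open>The affine summand makes the class stable under differentiation: the derivative in
  direction \<open>b\<close> has the same shape, with \<open>f\<close> replaced by its derivative,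
  \<open>B\<close> by zero and \<open>c\<close> by \<open>B b\<close>.\<close>

lemma Ck_on_bounded_linear_add_affine:
  assumes "Ck_on k UNIV f" "bounded_linear A" "bounded_linear B"
  shows "Ck_on k UNIV (\<lambda>x. A (f x) + B x + c)"
  using assms
proof (induction k arbitrary: f B c)
  case 0
  then show ?case
    by (simp add: continuous_on_add linear_continuous_on bounded_linear.continuous_on)
next
  case (Suc k)
  have f: "(f has_derivative frechet_derivative f (at x)) (at x)" for x
    using Suc.prems(1) frechet_derivative_works by auto
  have der: "((\<lambda>x. A (f x) + B x + c) has_derivative (\<lambda>h. A (frechet_derivative f (at x) h) + B h)) (at x)" for x
    using has_derivative_add[OF has_derivative_add[OF bounded_linear.has_derivative[OF assms(2) f]
        bounded_linear_imp_has_derivative[OF Suc.prems(3)]] has_derivative_const] by simp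
  have "Ck_on k UNIV (\<lambda>x. frechet_derivative (\<lambda>x. A (f x) + B x + c) (at x) b)" if "b \<in> Basis" for b
  proof -
    have "Ck_on k UNIV (\<lambda>x. frechet_derivative f (at x) b)" using Suc.prems(1) that by simp
    from Suc.IH[OF this assms(2) bounded_linear_zero, of "B b"]
    show ?thesis by (simp add: frechet_derivative_at[OF der, symmetric])
  qed
  then show ?case using der by (auto simp: differentiable_def)
qed

lemma smooth_graph_param:
  assumes "smooth_on UNIV F"
  shows "smooth_on UNIV (graph_param F)"
  unfolding smooth_on_def
proof
  fix k
  have "linear (\<lambda>v. emb v 0)" "linear (\<lambda>h. emb 0 h)"
    by (auto intro!: linearI simp: vec_eq_iff forall_4 emb_nth)
  then have "Ck_on k UNIV (\<lambda>u. emb (F u) 0 + emb 0 u + 0)"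
    using assms by (intro Ck_on_bounded_linear_add_affine) (auto simp: smooth_on_def linear_conv_bounded_linear)
  moreover have "(\<lambda>u. emb (F u) 0 + emb 0 u + 0) = graph_param F"
    by (rule ext) (simp add: graph_param_emb vec_eq_iff forall_4 emb_nth)
  ultimately show "Ck_on k UNIV (graph_param F)" by simp
qed

section \<open>Homogeneous coordinates and the inverse of \<open>Psi_inv\<close>\<close>

lemma proj_scale: "c \<noteq> 0 \<Longrightarrow> proj (c *s z) = proj z"
proof -
  assume c: "c \<noteq> 0"
  have "\<exists>d'. d *s z = d' *s (c *s z) \<and> d' \<noteq> 0" if "d \<noteq> 0" for d
    using c that by (intro exI[of _ "d / c"]) (simp add: vec_eq_iff)
  moreover have "\<exists>d'. d *s (c *s z) = d' *s z \<and> d' \<noteq> 0" if "d \<noteq> 0" for d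
    using c that by (intro exI[of _ "d * c"]) (simp add: vec_eq_iff)
  ultimately show ?thesis unfolding proj_def by blast
qed

lemma proj_eqD:
  assumes "proj z = proj z'"
  obtains c where "c \<noteq> 0" "z = c *s z'"
proof -
  have "z = 1 *s z" by (simp add: vec_eq_iff)
  then have "z \<in> proj z" unfolding proj_def using one_neq_zero by blast
  then show ?thesis using assms that unfolding proj_def by blast
qed

text \<open>The sum of the third and fourth coordinates separates the cases: it is 2 in the chosen
  representatives of finite points and 0 in those of points with an infinite component. For two
  finite points it also forces the scaling factor to be 1.\<close>

lemma Psi_Psi_inv: "Psi (Psi_inv (Some w1, Some w2)) = (Some w1, Some w2)"
  unfolding Psi_def the_inv_into_def
proof (rule the_equality)
  fix y assume y: "y \<in> UNIV \<and> Psi_inv y = Psi_inv (Some w1, Some w2)"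
  have aux: "\<exists>c. c \<noteq> 0 \<and> w1 + w2 = c * A \<and> - \<i> * (w1 - w2) = c * B \<and> 1 - w1 * w2 = c * C \<and> 1 + w1 * w2 = c * D"
    if pr: "proj (vector [w1 + w2, - \<i> * (w1 - w2), 1 - w1 * w2, 1 + w1 * w2]) = proj (vector [A, B, C, D] :: complex^4)" for A B C D
  proof -
    obtain c where c: "c \<noteq> 0" "(vector [w1 + w2, - \<i> * (w1 - w2), 1 - w1 * w2, 1 + w1 * w2] :: complex^4) = c *s vector [A, B, C, D]"
      by (rule proj_eqD[OF pr])
    then show ?thesis by (intro exI[of _ c]) (simp add: vec_eq_iff forall_4 vector_4 del: vector_def)
  qed
  have no: False if pr: "proj (vector [A, B, - w, w]) = proj (vector [w1 + w2, - \<i> * (w1 - w2), 1 - w1 * w2, 1 + w1 * w2])" for A B w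
  proof -
    obtain c where "1 - w1 * w2 = c * - w" "1 + w1 * w2 = c * w" using aux[OF pr[symmetric]] by blast
    then have "(1 - w1 * w2) + (1 + w1 * w2) = 0" by simp
    then show False by simp
  qed
  obtain y1 y2 where y12: "y = (y1, y2)" by (cases y)
  note yP = y[THEN conjunct2, unfolded y12]
  show "y = (Some w1, Some w2)"
  proof (cases y1)
    case None
    show ?thesis
    proof (cases y2)
      case n: None
      show ?thesis by (rule FalseE, rule no, rule yP[unfolded None n Psi_inv.simps])
    next
      case (Some v2)
      show ?thesis by (rule FalseE, rule no, rule yP[unfolded None Some Psi_inv.simps])
    qed
  next
    case v1: (Some v1)
    show ?thesis
    proof (cases y2)
      case None
      show ?thesis by (rule FalseE, rule no, rule yP[unfolded None v1 Psi_inv.simps])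
    next
      case (Some v2)
      obtain c where c: "w1 + w2 = c * (v1 + v2)" "- \<i> * (w1 - w2) = c * (- \<i> * (v1 - v2))"
          "1 - w1 * w2 = c * (1 - v1 * v2)" "1 + w1 * w2 = c * (1 + v1 * v2)"
        using aux[OF yP[unfolded v1 Some Psi_inv.simps, symmetric]] by blast
      have "(1 - w1 * w2) + (1 + w1 * w2) = c * 2" unfolding c(3,4) by (simp add: algebra_simps)
      then have "c = 1" by simp
      with c(1,2) have "w1 + w2 = v1 + v2" "w1 - w2 = v1 - v2" by auto
      then have "(w1 + w2) + (w1 - w2) = (v1 + v2) + (v1 - v2)" "(w1 + w2) - (w1 - w2) = (v1 + v2) - (v1 - v2)" by simp_all
      then show ?thesis using y12 Some v1 by simp
    qed
  qed
qed simp

section \<open>The global isothermal coordinate and the Gauss map\<close>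

locale conformal_graph = stationary_graph +
  fixes r s t \<sigma> :: real
  assumes r: "r > 0" and det: "r * t - s\<^sup>2 = 1"
    and E: "\<And>u. E u = r * W u" and M: "\<And>u. M u = s * W u" and G: "\<And>u. G u = t * W u"
    and harmonic: "\<And>u. t *\<^sub>R F11 u - (2 * s) *\<^sub>R F12 u + r *\<^sub>R F22 u = 0"
    and \<sigma>: "\<sigma> = 1 \<or> \<sigma> = - 1"
begin

text \<open>\<open>L\<close> is chosen so that \<open>L L\<^sup>T\<close> is the inverse of \<open>(r, s; s, t)\<close> and \<open>det L = \<sigma>\<close>; its inverse is \<open>\<zeta>\<close>.\<close>

definition a :: complex where "a = Complex (- s / sqrt r) (\<sigma> / sqrt r)"
definition b :: complex where "b = of_real (sqrt r)"
definition L :: "complex \<Rightarrow> real^2" where "L z = vector [Re (a * z), Re (b * z)]"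
definition m1 :: complex where "m1 = Complex 0 (- \<sigma> * sqrt r)"
definition m2 :: complex where "m2 = Complex (1 / sqrt r) (- \<sigma> * s / sqrt r)"
definition \<zeta> :: "real^2 \<Rightarrow> complex" where "\<zeta> u = of_real (u $ 1) * m1 + of_real (u $ 2) * m2"

lemma \<sigma>_sq: "\<sigma> * \<sigma> = 1" using \<sigma> by auto

lemma t: "t > 0"
  using det r by (smt (verit) zero_le_power2 zero_less_mult_pos)

lemma rt: "r * t = 1 + s * s" using det by (simp add: power2_eq_square)

lemma sqrt_r: "sqrt r > 0" "sqrt r * sqrt r = r" using r by auto

lemma L_\<zeta>: "L (\<zeta> u) = u"
  using sqrt_r \<sigma>_sq by (auto simp: L_def \<zeta>_def a_def b_def m1_def m2_def vec_eq_iff forall_2 field_simps)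

lemma \<zeta>_L: "\<zeta> (L z) = z"
  using sqrt_r \<sigma>_sq by (auto simp: L_def \<zeta>_def a_def b_def m1_def m2_def complex_eq_iff field_simps)

lemma norms: "a * cnj a = of_real t" "b * cnj b = of_real r" "a * cnj b + cnj a * b = of_real (- 2 * s)"
  "(cmod a)\<^sup>2 = t" "(cmod b)\<^sup>2 = r"
proof -
  have "t = (s * s + 1) / r" using rt r by (simp add: field_simps)
  then have "Re a * Re a + Im a * Im a = t"
    using sqrt_r \<sigma>_sq r by (simp add: a_def field_simps)
  then show "a * cnj a = of_real t" "(cmod a)\<^sup>2 = t"
    unfolding complex_mult_cnj cmod_power2 by (simp_all only: power2_eq_square)
  show "b * cnj b = of_real r" "(cmod b)\<^sup>2 = r" using sqrt_r r by (simp_all add: b_def complex_eq_iff)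
  show "a * cnj b + cnj a * b = of_real (- 2 * s)" using sqrt_r by (simp add: a_def b_def complex_eq_iff)
qed

text \<open>The direction \<open>(a, b)\<close> is isotropic for \<open>(r, s; s, t)\<close>:
  \<open>a / b = (- s + \<i> \<sigma>) / r\<close> is a root of \<open>r x^2 + 2 s x + t\<close>,
  and \<sigma> selects which of the two conjugate roots.\<close>

lemma null: "of_real r * a\<^sup>2 + of_real (2 * s) * a * b + of_real t * b\<^sup>2 = 0"
proof -
  have "of_real (sqrt r) * a = Complex (- s) \<sigma>" using sqrt_r by (simp add: a_def complex_eq_iff)
  then have "of_real r * a = of_real (sqrt r) * Complex (- s) \<sigma>"
    using sqrt_r(2) by (metis mult.assoc of_real_mult)
  moreover have "of_real (sqrt r) * of_real (sqrt r) = (of_real r :: complex)" using sqrt_r(2) by (metis of_real_mult)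
  moreover have "Complex (- s) \<sigma> * Complex (- s) \<sigma> + 2 * of_real s * Complex (- s) \<sigma> + of_real (r * t) = 0"
    using \<sigma>_sq unfolding rt by (simp add: complex_eq_iff algebra_simps)
  moreover have "of_real (sqrt r) * a = Complex (- s) \<sigma>" by fact
  ultimately show ?thesis unfolding b_def of_real_mult of_real_numeral power2_eq_square by algebra
qed

text \<open>This number is the determinant of \<open>L\<close>, so it records the
  orientation.\<close>

lemma Im_ab: "Im (cnj b * a) = \<sigma>"
  using sqrt_r by (simp add: a_def b_def)

lemma ab_nz: "a + b \<noteq> 0" "b \<noteq> 0"
proof -
  show "b \<noteq> 0" using sqrt_r by (simp add: b_def)
  have "Im (a + b) \<noteq> 0" using sqrt_r \<sigma> by (auto simp: a_def b_def)
  then show "a + b \<noteq> 0" by (metis zero_complex.sel(2))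
qed

lemma L_linear: "bounded_linear L"
  unfolding linear_conv_bounded_linear[symmetric]
  by (rule linearI) (simp_all add: L_def vec_eq_iff forall_2 algebra_simps)

lemma L_der: "(L has_derivative L) (at z)"
  by (rule bounded_linear_imp_has_derivative[OF L_linear])

text \<open>By the chain rule this is twice the Wirtinger derivative of the \<open>k\<close>-th
  component of \<open>F \<circ> L\<close>, because
  \<open>L z = (Re (a z), Re (b z))\<close>.\<close>

definition hol :: "2 \<Rightarrow> complex \<Rightarrow> complex" where
  "hol k z = a * of_real (F1 (L z) $ k) + b * of_real (F2 (L z) $ k)"

text \<open>In the real derivative the coefficient of \<open>cnj v\<close> is half of
  \<open>|a|^2 F11 + 2 Re (a cnj b) F12 + |b|^2 F22\<close>. By \<open>norms\<close> this is the
  Laplacian in \<open>harmonic\<close>, so only the complex-linear part remains.\<close>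

lemma hol_der: "(hol k has_field_derivative
  (a\<^sup>2 * of_real (F11 (L z) $ k) + 2 * a * b * of_real (F12 (L z) $ k) + b\<^sup>2 * of_real (F22 (L z) $ k)) / 2) (at z)"
proof -
  note nth = bounded_linear.has_derivative[OF bounded_linear_vec_nth[of k]]
  have der: "(hol k has_derivative (\<lambda>v. a * of_real (((L v $ 1) *\<^sub>R F11 (L z) + (L v $ 2) *\<^sub>R F12 (L z)) $ k)
       + b * of_real (((L v $ 1) *\<^sub>R F12 (L z) + (L v $ 2) *\<^sub>R F22 (L z)) $ k))) (at z)"
    unfolding hol_def[abs_def]
    by (intro has_derivative_add has_derivative_mult_right has_derivative_of_real
        nth has_derivative_compose[OF L_der F1_der] has_derivative_compose[OF L_der F2_der])
  have eq: "a * of_real (((L v $ 1) *\<^sub>R F11 (L z) + (L v $ 2) *\<^sub>R F12 (L z)) $ k)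
       + b * of_real (((L v $ 1) *\<^sub>R F12 (L z) + (L v $ 2) *\<^sub>R F22 (L z)) $ k)
     = (a\<^sup>2 * of_real (F11 (L z) $ k) + 2 * a * b * of_real (F12 (L z) $ k) + b\<^sup>2 * of_real (F22 (L z) $ k)) / 2 * v" for v
  proof -
    have re: "of_real (Re w) = (w + cnj w) / 2" for w by (simp add: complex_eq_iff)
    have L1: "2 * of_real (L v $ 1) = a * v + cnj a * cnj v" "2 * of_real (L v $ 2) = b * v + cnj b * cnj v"
      by (simp_all add: L_def re del: times_complex.simps)
    have "t * F11 (L z) $ k - 2 * s * F12 (L z) $ k + r * F22 (L z) $ k = 0"
      using arg_cong[OF harmonic[of "L z"], of "\<lambda>x. x $ k"] by simp
    then have "complex_of_real (t * F11 (L z) $ k - 2 * s * F12 (L z) $ k + r * F22 (L z) $ k) = 0" by simp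
    then have "a * cnj a * of_real (F11 (L z) $ k) + (a * cnj b + cnj a * b) * of_real (F12 (L z) $ k) + b * cnj b * of_real (F22 (L z) $ k) = 0"
      unfolding norms by simp
    with L1 have "2 * (a * (of_real (L v $ 1) * of_real (F11 (L z) $ k) + of_real (L v $ 2) * of_real (F12 (L z) $ k))
       + b * (of_real (L v $ 1) * of_real (F12 (L z) $ k) + of_real (L v $ 2) * of_real (F22 (L z) $ k)))
     = (a\<^sup>2 * of_real (F11 (L z) $ k) + 2 * a * b * of_real (F12 (L z) $ k) + b\<^sup>2 * of_real (F22 (L z) $ k)) * v"
      by algebra
    moreover have "A = B / 2 * v" if "2 * A = B * v" for A B :: complex
      using that by (simp add: field_simps)
    ultimately show ?thesis
      unfolding vector_add_component vector_scaleR_component real_scaleR_def of_real_add of_real_mult by blast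
  qed
  show ?thesis
    unfolding has_field_derivative_def by (rule has_derivative_eq_rhs[OF der], rule ext, rule eq)
qed

lemma inner_F: "v \<bullet> w = v $ 1 * w $ 1 + v $ 2 * w $ 2" for v w :: "real^2"
  by (simp add: inner_vec_def sum_2)

text \<open>Expanding by the first fundamental form, the terms with \<open>W\<close> are a multiple
  of \<open>null\<close> and drop out; what is left comes from the parameter plane. This is isotropy
  of the Wirtinger derivative.\<close>

lemma hol_null: "(hol 1 z)\<^sup>2 + (hol 2 z)\<^sup>2 = b\<^sup>2 - a\<^sup>2"
proof -
  have e0: "F1 (L z) $ 1 * F1 (L z) $ 1 + F1 (L z) $ 2 * F1 (L z) $ 2 = r * W (L z) - 1"
    "F1 (L z) $ 1 * F2 (L z) $ 1 + F1 (L z) $ 2 * F2 (L z) $ 2 = s * W (L z)"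
    "F2 (L z) $ 1 * F2 (L z) $ 1 + F2 (L z) $ 2 * F2 (L z) $ 2 = t * W (L z) + 1"
    using E[of "L z"] M[of "L z"] G[of "L z"] unfolding E_def M_def G_def inner_F by linarith+
  have e: "complex_of_real (F1 (L z) $ 1) * of_real (F1 (L z) $ 1) + of_real (F1 (L z) $ 2) * of_real (F1 (L z) $ 2) = of_real (r * W (L z) - 1 :: real) "
     "complex_of_real (F1 (L z) $ 1) * of_real (F2 (L z) $ 1) + of_real (F1 (L z) $ 2) * of_real (F2 (L z) $ 2) = of_real (s * W (L z) :: real)"
     "of_real (F2 (L z) $ 1) * of_real (F2 (L z) $ 1) + of_real (F2 (L z) $ 2) * of_real (F2 (L z) $ 2) = complex_of_real (t * W (L z) + 1)"
    by (simp_all only: e0 flip: of_real_mult of_real_add)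
  show ?thesis using null e unfolding hol_def of_real_mult of_real_add of_real_diff of_real_1 of_real_numeral
    by algebra
qed

text \<open>The Hermitian counterpart of \<open>hol_null\<close>: here the coefficient of
  \<open>W\<close> is \<open>2 (r t - s^2) = 2\<close>.\<close>

lemma hol_norms: "(cmod (hol 1 z))\<^sup>2 + (cmod (hol 2 z))\<^sup>2 = 2 * W (L z) + r - t"
proof -
  let ?A = "F1 (L z)" and ?B = "F2 (L z)"
  have sq: "(cmod (a * of_real x + b * of_real y))\<^sup>2 = t * x * x - 2 * s * x * y + r * y * y" for x y
  proof -
    have "complex_of_real ((cmod (a * of_real x + b * of_real y))\<^sup>2) = (a * of_real x + b * of_real y) * cnj (a * of_real x + b * of_real y)"
      by (rule complex_norm_square)
    also have "\<dots> = (a * cnj a) * of_real x * of_real x + (a * cnj b + cnj a * b) * of_real x * of_real y + (b * cnj b) * of_real y * of_real y"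
      by (simp add: algebra_simps)
    also have "\<dots> = complex_of_real (t * x * x - 2 * s * x * y + r * y * y)" unfolding norms by simp
    finally show ?thesis by (simp only: of_real_eq_iff)
  qed
  have e: "1 + (?A $ 1 * ?A $ 1 + ?A $ 2 * ?A $ 2) = r * W (L z)" "?A $ 1 * ?B $ 1 + ?A $ 2 * ?B $ 2 = s * W (L z)"
    "?B $ 1 * ?B $ 1 + ?B $ 2 * ?B $ 2 - 1 = t * W (L z)"
    using E[of "L z"] M[of "L z"] G[of "L z"] unfolding E_def M_def G_def inner_F .
  show ?thesis unfolding hol_def sq using e rt by algebra
qed

text \<open>The complex-linear extension of \<open>X' u\<close>, applied to the complex vector
  \<open>(c1, c2)\<close>.\<close>

definition tangent :: "real^2 \<Rightarrow> complex \<Rightarrow> complex \<Rightarrow> complex^4" where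
  "tangent u c1 c2 = vector [c1 * of_real (F1 u $ 1) + c2 * of_real (F2 u $ 1), c1 * of_real (F1 u $ 2) + c2 * of_real (F2 u $ 2), c1, c2]"

lemma tangent_nth: "tangent u c1 c2 $ 1 = c1 * of_real (F1 u $ 1) + c2 * of_real (F2 u $ 1)"
  "tangent u c1 c2 $ 2 = c1 * of_real (F1 u $ 2) + c2 * of_real (F2 u $ 2)" "tangent u c1 c2 $ 3 = c1" "tangent u c1 c2 $ 4 = c2"
  by (simp_all add: tangent_def vector_4)

lemma pd_chart:
  assumes "\<phi> differentiable (at z)"
  shows "pdu (X \<circ> \<phi>) z = X' (\<phi> z) (pdu \<phi> z)" "pdv (X \<circ> \<phi>) z = X' (\<phi> z) (pdv \<phi> z)"
proof -
  have "(\<phi> has_derivative frechet_derivative \<phi> (at z)) (at z)" using assms frechet_derivative_works by blast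
  from frechet_derivative_at[OF diff_chain_at[OF this X_der]]
  show "pdu (X \<circ> \<phi>) z = X' (\<phi> z) (pdu \<phi> z)" "pdv (X \<circ> \<phi>) z = X' (\<phi> z) (pdv \<phi> z)"
    unfolding pdu_def pdv_def by (simp_all add: fun_eq_iff)
qed

lemma wirtinger_chart:
  assumes "\<phi> differentiable (at z)"
  shows "wirtinger (X \<circ> \<phi>) z = (1/2) *s tangent (\<phi> z) (Complex (pdu \<phi> z $ 1) (- pdv \<phi> z $ 1)) (Complex (pdu \<phi> z $ 2) (- pdv \<phi> z $ 2))"
  by (simp add: vec_eq_iff forall_4 wirtinger_def pd_chart[OF assms] X'_def emb_nth tangent_nth complex_eq_iff)

lemma mink_X'_polar: "mink (X' u h) (X' u k) = W u * (r * h$1 * k$1 + s * (h$1 * k$2 + h$2 * k$1) + t * h$2 * k$2)"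
  unfolding X'_def mink_emb using E[of u] M[of u] G[of u]
  unfolding E_def M_def G_def
  by (simp add: inner_add_left inner_add_right inner_commute algebra_simps) algebra

text \<open>In an isothermal chart \<open>(c1, c2)\<close>, twice the Wirtinger derivative of the
  chart, is isotropic for \<open>(r, s; s, t)\<close>. There are two isotropic lines, conjugate to
  each other, and the orientation \<sigma> selects the one spanned by \<open>(a, b)\<close>.\<close>

lemma chart_unique:
  assumes chart: "isothermal_chart \<sigma> X D \<phi>" and z: "z \<in> D"
  shows "proj (wirtinger (X \<circ> \<phi>) z) = proj (tangent (\<phi> z) a b)"
proof -
  have "Ck_on (Suc 0) D \<phi>" using chart unfolding isothermal_chart_def smooth_on_def by blast
  then have diff: "\<phi> differentiable (at z)" using z by simp
  define c1 c2 where "c1 = Complex (pdu \<phi> z $ 1) (- pdv \<phi> z $ 1)" and "c2 = Complex (pdu \<phi> z $ 2) (- pdv \<phi> z $ 2)"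
  let ?p = "pdu \<phi> z" and ?q = "pdv \<phi> z"
  have or: "\<sigma> * (?p $ 1 * ?q $ 2 - ?p $ 2 * ?q $ 1) > 0"
    and "mink (pdu (X \<circ> \<phi>) z) (pdu (X \<circ> \<phi>) z) = mink (pdv (X \<circ> \<phi>) z) (pdv (X \<circ> \<phi>) z)"
    and "mink (pdu (X \<circ> \<phi>) z) (pdv (X \<circ> \<phi>) z) = 0"
    using chart z unfolding isothermal_chart_def by auto
  then have iso: "r * ?p$1 * ?p$1 + s * (?p$1 * ?p$2 + ?p$2 * ?p$1) + t * ?p$2 * ?p$2 = r * ?q$1 * ?q$1 + s * (?q$1 * ?q$2 + ?q$2 * ?q$1) + t * ?q$2 * ?q$2"
    "r * ?p$1 * ?q$1 + s * (?p$1 * ?q$2 + ?p$2 * ?q$1) + t * ?p$2 * ?q$2 = 0"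
    using W_pos[of "\<phi> z"] unfolding pd_chart[OF diff] mink_X'_polar by auto
  have "of_real r * c1 * c1 + 2 * of_real s * c1 * c2 + of_real t * c2 * c2 = 0"
    using iso by (simp add: c1_def c2_def complex_eq_iff algebra_simps)
  moreover have rt': "of_real r * of_real t = (1 + of_real s * of_real s :: complex)"
    using rt by (metis of_real_1 of_real_add of_real_mult)
  \<comment> \<open>The isotropy equation times \<open>r\<close> is
    \<open>(r c1 + s c2)^2 + c2^2 = 0\<close>, by \<open>r t = 1 + s^2\<close>.\<close>
  ultimately have "(of_real r * c1 + of_real s * c2 - \<i> * of_real \<sigma> * c2) * (of_real r * c1 + of_real s * c2 + \<i> * of_real \<sigma> * c2) = 0"
  proof -
    have "(of_real \<sigma> :: complex) * of_real \<sigma> = 1" using \<sigma>_sq by (metis of_real_1 of_real_mult)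
    moreover have "\<i> * \<i> = - 1" by simp
    ultimately show ?thesis
      using \<open>of_real r * c1 * c1 + 2 * of_real s * c1 * c2 + of_real t * c2 * c2 = 0\<close> rt' by algebra
  qed
  \<comment> \<open>If the other factor vanished, \<sigma> times the Jacobian would be nonpositive,
    against the orientation of the chart.\<close>
  moreover have "of_real r * c1 + of_real s * c2 + \<i> * of_real \<sigma> * c2 \<noteq> 0"
  proof
    assume 0: "of_real r * c1 + of_real s * c2 + \<i> * of_real \<sigma> * c2 = 0"
    have "r * ?p $ 1 = - s * ?p $ 2 - \<sigma> * ?q $ 2" "r * ?q $ 1 = - s * ?q $ 2 + \<sigma> * ?p $ 2"
      using arg_cong[OF 0, of Re] arg_cong[OF 0, of Im] by (simp_all add: c1_def c2_def)
    then have "r * (\<sigma> * (?p $ 1 * ?q $ 2 - ?p $ 2 * ?q $ 1)) = - (?p $ 2 * ?p $ 2 + ?q $ 2 * ?q $ 2)"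
      using \<sigma>_sq by algebra
    also have "\<dots> \<le> 0" by simp
    finally show False using mult_pos_pos[OF r or] by simp
  qed
  ultimately have "of_real r * c1 + of_real s * c2 - \<i> * of_real \<sigma> * c2 = 0"
    by (simp only: mult_eq_0_iff simp_thms)
  then have rc: "of_real r * c1 = (- of_real s + \<i> * of_real \<sigma>) * c2" by (simp add: algebra_simps)
  have "c2 \<noteq> 0"
  proof
    assume "c2 = 0"
    then show False using or by (simp add: c2_def complex_eq_iff)
  qed
  have ab: "of_real r * a = (- of_real s + \<i> * of_real \<sigma>) * b"
    using sqrt_r by (simp add: a_def b_def complex_eq_iff field_simps)
  have "of_real r * (c2 / b * a) = c2 / b * (of_real r * a)" by simp
  also have "\<dots> = of_real r * c1"
    unfolding rc ab using ab_nz(2) by simp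
  finally have "of_real r * (c2 / b * a) = of_real r * c1" .
  moreover have "complex_of_real r \<noteq> 0" using r by simp
  ultimately have c1: "c1 = c2 / b * a" by (metis mult_left_cancel)
  have c2: "c2 = c2 / b * b" using ab_nz(2) by simp
  have "wirtinger (X \<circ> \<phi>) z = (1/2) *s tangent (\<phi> z) c1 c2"
    unfolding wirtinger_chart[OF diff] c1_def c2_def ..
  also have "\<dots> = (c2 / (2 * b)) *s tangent (\<phi> z) a b"
    using ab_nz(2) by (simp add: vec_eq_iff forall_4 tangent_nth c1 field_simps)
  finally show ?thesis using proj_scale[of "c2 / (2 * b)"] \<open>c2 \<noteq> 0\<close> ab_nz(2) by simp
qed

lemma chart_L: "isothermal_chart \<sigma> X UNIV L"
proof -
  have sm: "smooth_on UNIV L"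
    unfolding smooth_on_def using Ck_on_affine[OF L_linear, of _ 0] by simp
  have inj: "inj L" using \<zeta>_L by (rule inj_on_inverseI)
  have diff: "L differentiable (at z)" for z using L_der differentiable_def by blast
  have pd: "pdu L z = vector [- s / sqrt r, sqrt r]" "pdv L z = vector [- \<sigma> / sqrt r, 0]" for z
    unfolding pdu_def pdv_def frechet_derivative_at[OF L_der, symmetric]
    by (simp_all add: L_def a_def b_def vec_eq_iff forall_2)
  have "r * (- s / sqrt r) * (- s / sqrt r) + s * ((- s / sqrt r) * sqrt r + sqrt r * (- s / sqrt r)) + t * sqrt r * sqrt r
     = r * (- \<sigma> / sqrt r) * (- \<sigma> / sqrt r)"
    using sqrt_r \<sigma>_sq rt r by (simp add: field_simps)
  then show ?thesis
    unfolding isothermal_chart_def pd_chart[OF diff] mink_X'_polar pd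
    using sm inj sqrt_r \<sigma>_sq by (auto simp: field_simps)
qed

text \<open>The definite description is justified by \<open>L\<close> as a chart through every point
  and by \<open>chart_unique\<close> for all other charts.\<close>

lemma gauss_map_eq: "gauss_map \<sigma> X p = proj (tangent p a b)"
  unfolding gauss_map_def
proof (rule the_equality)
  show "\<exists>D \<phi>. \<exists>z\<in>D. isothermal_chart \<sigma> X D \<phi> \<and> \<phi> z = p \<and> proj (tangent p a b) = proj (wirtinger (X \<circ> \<phi>) z)"
    using chart_L chart_unique[OF chart_L, of "\<zeta> p"] L_\<zeta>
    by (intro exI[of _ UNIV] exI[of _ L] bexI[of _ "\<zeta> p"]) auto
  show "l = proj (tangent p a b)" if "\<exists>D \<phi>. \<exists>z\<in>D. isothermal_chart \<sigma> X D \<phi> \<and> \<phi> z = p \<and> l = proj (wirtinger (X \<circ> \<phi>) z)" for l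
    using that chart_unique by blast
qed

definition w1 :: "complex \<Rightarrow> complex" where "w1 z = (hol 1 z + \<i> * hol 2 z) / (a + b)"
definition w2 :: "complex \<Rightarrow> complex" where "w2 z = (hol 1 z - \<i> * hol 2 z) / (a + b)"

lemma w_prod: "(a + b) * (w1 z * w2 z) = b - a"
proof -
  have "(a + b) * ((a + b) * (w1 z * w2 z)) = (hol 1 z + \<i> * hol 2 z) * (hol 1 z - \<i> * hol 2 z)"
    using ab_nz by (simp add: w1_def w2_def)
  also have "\<dots> = (hol 1 z)\<^sup>2 + (hol 2 z)\<^sup>2" by (simp add: algebra_simps power2_eq_square)
  also have "\<dots> = (a + b) * (b - a)" unfolding hol_null by (simp add: algebra_simps power2_eq_square)
  finally show ?thesis using ab_nz by simp
qed

text \<open>On a null vector \<open>z\<close> with \<open>z_3 + z_4 \<noteq> 0\<close>, \<Psi> is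
  given by \<open>(z_1 \<plusminus> \<i> z_2) / (z_3 + z_4)\<close>. Here the denominator is the
  constant \<open>a + b \<noteq> 0\<close>, so no value is infinite.\<close>

lemma Psi_gauss_map: "Psi (gauss_map \<sigma> X p) = (Some (w1 (\<zeta> p)), Some (w2 (\<zeta> p)))"
proof -
  let ?w1 = "w1 (\<zeta> p)" and ?w2 = "w2 (\<zeta> p)" and ?v = "\<lambda>w1 w2. vector [w1 + w2, - \<i> * (w1 - w2), 1 - w1 * w2, 1 + w1 * w2] :: complex^4"
  have "(a + b) * ?w1 = hol 1 (\<zeta> p) + \<i> * hol 2 (\<zeta> p)" "(a + b) * ?w2 = hol 1 (\<zeta> p) - \<i> * hol 2 (\<zeta> p)"
    using ab_nz by (simp_all add: w1_def w2_def)
  moreover have "\<i> * \<i> = - 1" by simp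
  ultimately have "(a + b) * (?w1 + ?w2) = 2 * hol 1 (\<zeta> p)" "(a + b) * (- \<i> * (?w1 - ?w2)) = 2 * hol 2 (\<zeta> p)"
    by algebra+
  moreover have "(a + b) * (1 - ?w1 * ?w2) = 2 * a" "(a + b) * (1 + ?w1 * ?w2) = 2 * b"
    using w_prod[of "\<zeta> p"] by (simp_all add: algebra_simps)
  ultimately have "tangent p a b = ((a + b) / 2) *s ?v ?w1 ?w2"
    by (simp add: vec_eq_iff forall_4 tangent_nth vector_4 hol_def L_\<zeta>)
  then have "gauss_map \<sigma> X p = Psi_inv (Some ?w1, Some ?w2)"
    using ab_nz by (simp add: gauss_map_eq proj_scale)
  then show ?thesis by (simp only: Psi_Psi_inv)
qed

lemma elliptic: "degenerate_stationary_elliptic \<sigma> X"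
proof -
  define A :: "complex^4" where "A = vector [0, 0, b, a]"
  have "gauss_map \<sigma> X p \<in> hyperplane_section A" for p
  proof -
    have "mink (tangent p a b) (tangent p a b) = 0"
    proof -
      have "mink (tangent p a b) (tangent p a b) = (hol 1 (\<zeta> p))\<^sup>2 + (hol 2 (\<zeta> p))\<^sup>2 + a\<^sup>2 - b\<^sup>2"
        by (simp add: mink_def tangent_nth hol_def L_\<zeta> power2_eq_square)
      then show ?thesis unfolding hol_null by simp
    qed
    moreover have "tangent p a b \<noteq> 0"
      using tangent_nth(4)[of p a b] ab_nz by auto
    ultimately have "gauss_map \<sigma> X p \<in> Q11" unfolding Q11_def gauss_map_eq by blast
    moreover have "mink A (c *s tangent p a b) = 0" for c
      by (simp add: mink_def A_def vector_4 tangent_nth)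
    ultimately show ?thesis unfolding hyperplane_section_def gauss_map_eq proj_def by auto
  qed
  moreover define x y where "x = (\<chi> k. Re (A $ k))" and "y = (\<chi> k. Im (A $ k))"
  have x: "x $ 1 = 0" "x $ 2 = 0" "x $ 3 = sqrt r" "x $ 4 = - s / sqrt r"
    and y: "y $ 1 = 0" "y $ 2 = 0" "y $ 3 = 0" "y $ 4 = \<sigma> / sqrt r"
    by (simp_all add: x_def y_def A_def vector_4 a_def b_def)
  have ne: "x \<noteq> y" using x(3) y(3) sqrt_r by auto
  have ind: "independent {x, y}"
  proof -
    have "x \<notin> span {y}" using x(3) y(3) sqrt_r by (auto simp: span_singleton)
    moreover have "y \<noteq> 0" using y(4) sqrt_r \<sigma> by auto
    ultimately show ?thesis by (simp add: independent_insert)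
  qed
  have "lorentzian_plane (span {x, y})"
    unfolding lorentzian_plane_def
  proof (intro conjI)
    show "dim (span {x, y}) = 2" using ne by (simp add: dim_span dim_eq_card_independent[OF ind])
    have "y \<in> span {x, y}" "x \<in> span {x, y}" by (simp_all add: span_base)
    \<comment> \<open>The multiple of \<open>y\<close> cancels the fourth coordinate of
      \<open>x\<close>; the outcome is \<open>sqrt r\<close> times the third basis vector,
      orthogonal to \<open>y\<close>.\<close>
    moreover from this have "x + (s * \<sigma>) *\<^sub>R y \<in> span {x, y}" by (intro span_add span_scale)
    moreover have "mink (x + (s * \<sigma>) *\<^sub>R y) (x + (s * \<sigma>) *\<^sub>R y) > 0" "mink y y < 0" "mink (x + (s * \<sigma>) *\<^sub>R y) y = 0"
    proof -
      have "s * \<sigma> * (\<sigma> / sqrt r) = s / sqrt r" using \<sigma>_sq by (simp add: mult.assoc)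
      then have e: "(x + (s * \<sigma>) *\<^sub>R y) $ 1 = 0" "(x + (s * \<sigma>) *\<^sub>R y) $ 2 = 0"
        "(x + (s * \<sigma>) *\<^sub>R y) $ 3 = sqrt r" "(x + (s * \<sigma>) *\<^sub>R y) $ 4 = 0" by (simp_all add: x y)
      show "mink (x + (s * \<sigma>) *\<^sub>R y) (x + (s * \<sigma>) *\<^sub>R y) > 0" "mink (x + (s * \<sigma>) *\<^sub>R y) y = 0"
        unfolding mink_def e y using sqrt_r by simp_all
      show "mink y y < 0" unfolding mink_def y using sqrt_r \<sigma> by auto
    qed
    ultimately show "\<exists>v\<in>span {x, y}. \<exists>w\<in>span {x, y}. mink v v > 0 \<and> mink w w < 0 \<and> mink v w = 0" by blast
  qed (rule subspace_span)
  ultimately show ?thesis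
    unfolding degenerate_stationary_elliptic_def Let_def
    using smooth_graph_param[OF smooth] spacelike stationary ne ind
    unfolding x_def y_def by blast
qed

end

section \<open>Completeness and exceptional values from the constant product of the Gauss map
  components\<close>

context conformal_graph
begin

lemma w_holomorphic: "w1 holomorphic_on UNIV" "w2 holomorphic_on UNIV"
proof -
  have "hol k holomorphic_on UNIV" for k
    using hol_der by (auto simp: holomorphic_on_open)
  then show "w1 holomorphic_on UNIV" "w2 holomorphic_on UNIV"
    unfolding w1_def[abs_def] w2_def[abs_def] using ab_nz by (auto intro!: holomorphic_intros)
qed

definition m :: complex where "m = (b - a) / (a + b)"

lemma w_mult: "w1 z * w2 z = m"
  using w_prod[of z] ab_nz by (simp add: m_def field_simps)

text \<open>This is \<open>|a + b|^2\<close> times the imaginary part of \<open>m\<close>; it equals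
  \<open>- 2 \<sigma>\<close>.\<close>

lemma Im_gap: "Im ((b - a) * cnj (a + b)) \<noteq> 0"
proof -
  have "Im ((b - a) * cnj (a + b)) = - 2 * Im (cnj b * a)" by (simp add: algebra_simps)
  then show ?thesis using Im_ab \<sigma> by auto
qed

lemma m_nz: "m \<noteq> 0"
  using Im_gap ab_nz by (auto simp: m_def)

lemma w_nz: "w1 z \<noteq> 0" "w2 z \<noteq> 0"
  using w_mult[of z] m_nz by auto

text \<open>Equal to the modulus of \<open>(b - a) * cnj (a + b)\<close>, a non-real number with
  real part \<open>r - t\<close>; hence the strict inequality in \<open>N_gt\<close>.\<close>

definition N :: real where "N = (cmod (a + b))\<^sup>2 * cmod m"

lemma N_gt: "r - t < N"
proof -
  have "Re ((b - a) * cnj (a + b)) = (cmod b)\<^sup>2 - (cmod a)\<^sup>2"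
    unfolding cmod_power2 by (simp add: power2_eq_square algebra_simps)
  also have "\<dots> = r - t" by (simp add: norms)
  finally have "r - t = Re ((b - a) * cnj (a + b))" ..
  also have "\<dots> < cmod ((b - a) * cnj (a + b))"
  proof -
    let ?z = "(b - a) * cnj (a + b)"
    have "(Re ?z)\<^sup>2 < (cmod ?z)\<^sup>2" unfolding cmod_power2[of ?z] using Im_gap by simp
    then show ?thesis by (rule power2_less_imp_less) simp
  qed
  also have "\<dots> = N"
    unfolding N_def m_def norm_mult norm_divide complex_mod_cnj power2_eq_square using ab_nz by simp
  finally show ?thesis .
qed

lemma N_pos: "N > 0" using ab_nz m_nz by (simp add: N_def)

text \<open>The parallelogram law applied to \<open>hol 1 z\<close> and
  \<open>\<i> * hol 2 z\<close>, combined with \<open>hol_norms\<close>.\<close>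

lemma W_eq: "2 * W (L z) = (cmod (a + b))\<^sup>2 * ((cmod (w1 z))\<^sup>2 + (cmod (w2 z))\<^sup>2) / 2 + t - r"
proof -
  have par: "(cmod (x + \<i> * y))\<^sup>2 + (cmod (x - \<i> * y))\<^sup>2 = 2 * ((cmod x)\<^sup>2 + (cmod y)\<^sup>2)" for x y
    unfolding cmod_power2 by (simp add: power2_eq_square algebra_simps)
  have "(cmod (a + b))\<^sup>2 * ((cmod (w1 z))\<^sup>2 + (cmod (w2 z))\<^sup>2) = (cmod ((a + b) * w1 z))\<^sup>2 + (cmod ((a + b) * w2 z))\<^sup>2"
    by (simp add: norm_mult power_mult_distrib distrib_left)
  also have "\<dots> = (cmod (hol 1 z + \<i> * hol 2 z))\<^sup>2 + (cmod (hol 1 z - \<i> * hol 2 z))\<^sup>2"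
    using ab_nz by (simp add: w1_def w2_def)
  also have "\<dots> = 2 * (2 * W (L z) + r - t)" unfolding par hol_norms ..
  finally have eq: "(cmod (a + b))\<^sup>2 * ((cmod (w1 z))\<^sup>2 + (cmod (w2 z))\<^sup>2) = 2 * (2 * W (L z) + r - t)" .
  show ?thesis unfolding eq by (simp add: field_simps)
qed

text \<open>Arithmetic-geometric mean inequality for the squared moduli of \<open>w1\<close> and
  \<open>w2\<close>, whose product is fixed.\<close>

lemma W_lower: "N + t - r \<le> 2 * W u"
proof -
  have "0 \<le> (cmod (w1 (\<zeta> u)) - cmod (w2 (\<zeta> u)))\<^sup>2" by simp
  then have "2 * cmod m \<le> (cmod (w1 (\<zeta> u)))\<^sup>2 + (cmod (w2 (\<zeta> u)))\<^sup>2"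
    unfolding w_mult[of "\<zeta> u", symmetric] norm_mult power2_diff by simp
  then have "(cmod (a + b))\<^sup>2 * (2 * cmod m) \<le> (cmod (a + b))\<^sup>2 * ((cmod (w1 (\<zeta> u)))\<^sup>2 + (cmod (w2 (\<zeta> u)))\<^sup>2)"
    by (rule mult_left_mono) simp
  then show ?thesis using W_eq[of "\<zeta> u"] by (simp add: L_\<zeta> N_def)
qed

lemma complete: "complete_surface X"
proof -
  define \<delta> where "\<delta> = (N + t - r) / 2"
  \<comment> \<open>The eigenvalues of \<open>(r, s; s, t)\<close> are positive with product 1 and
    sum \<open>r + t\<close>, so each of them exceeds \<open>1 / (r + t)\<close>.\<close>
  define l where "l = 1 / (r + t)"
  have \<delta>: "\<delta> > 0" using N_gt by (simp add: \<delta>_def)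
  have l: "l > 0" "l * (r + t) = 1" using r t by (simp_all add: l_def)
  have rl: "r > l"
  proof -
    have "r * (r + t) = r * r + 1 + s * s" using rt by (simp add: algebra_simps)
    also have "\<dots> > l * (r + t)" using l(2) r by (smt (verit) mult_pos_pos zero_le_square)
    finally show ?thesis using r t by simp
  qed
  have quad: "l * (x\<^sup>2 + y\<^sup>2) \<le> r * x\<^sup>2 + 2 * s * x * y + t * y\<^sup>2" for x y
  proof -
    \<comment> \<open>Completing the square for the matrix minus \<open>l\<close> times the
      identity: its determinant is \<open>1 - l (r + t) + l^2 = l^2\<close>.\<close>
    have "(r - l) * (r * x\<^sup>2 + 2 * s * x * y + t * y\<^sup>2 - l * (x\<^sup>2 + y\<^sup>2)) = ((r - l) * x + s * y)\<^sup>2 + (l * y)\<^sup>2"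
      using rt l(2) by algebra
    then have "0 \<le> (r - l) * (r * x\<^sup>2 + 2 * s * x * y + t * y\<^sup>2 - l * (x\<^sup>2 + y\<^sup>2))" by simp
    then show ?thesis using rl by (simp add: zero_le_mult_iff)
  qed
  interpret uniform_surface X X' "sqrt (\<delta> * l)"
  proof
    show "(X has_derivative X' u) (at u)" for u by (rule X_der)
    show "continuous_on UNIV (\<lambda>u. X' u v)" for v
    proof -
      \<comment> \<open>For fixed \<open>v\<close> the map \<open>emb\<close> is only affine in its
        first argument; its constant part is subtracted here and restored below.\<close>
      have "linear (\<lambda>p. emb p v - emb 0 v)"
        by (auto intro!: linearI simp: vec_eq_iff forall_4 emb_nth)
      then have "continuous_on UNIV (\<lambda>u. emb ((v$1) *\<^sub>R F1 u + (v$2) *\<^sub>R F2 u) v - emb 0 v)"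
        by (intro bounded_linear.continuous_on[where f = "\<lambda>p. emb p v - emb 0 v"] continuous_intros F_cont)
          (simp add: linear_conv_bounded_linear)
      then have "continuous_on UNIV (\<lambda>u. (emb ((v$1) *\<^sub>R F1 u + (v$2) *\<^sub>R F2 u) v - emb 0 v) + emb 0 v)"
        by (intro continuous_on_add continuous_on_const)
      then show ?thesis by (simp add: X'_def)
    qed
    show "sqrt (\<delta> * l) > 0" using \<delta> l by simp
    show "(sqrt (\<delta> * l))\<^sup>2 * (norm v)\<^sup>2 \<le> mink (X' u v) (X' u v)" for u v
    proof -
      have nv: "(norm v)\<^sup>2 = (v$1)\<^sup>2 + (v$2)\<^sup>2"
        unfolding power2_norm_eq_inner inner_F by (simp add: power2_eq_square)
      have "(sqrt (\<delta> * l))\<^sup>2 * (norm v)\<^sup>2 = \<delta> * (l * ((v$1)\<^sup>2 + (v$2)\<^sup>2))"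
        using \<delta> l by (simp add: nv)
      also have "\<dots> \<le> W u * (r * (v$1)\<^sup>2 + 2 * s * (v$1) * (v$2) + t * (v$2)\<^sup>2)"
        using W_lower[of u] W_pos[of u] l by (intro mult_mono quad) (auto simp: \<delta>_def)
      also have "\<dots> = mink (X' u v) (X' u v)"
        unfolding mink_X' E M G by (simp add: algebra_simps)
      finally show ?thesis .
    qed
  qed
  show ?thesis by (rule complete)
qed

lemma psi_eq: "psi1 \<sigma> X p = Some (w1 (\<zeta> p))" "psi2 \<sigma> X p = Some (w2 (\<zeta> p))"
  by (simp_all add: psi1_def psi2_def Psi_gauss_map)

text \<open>Infinity is omitted because \<open>w\<close> is entire, and \<open>0\<close> because
  \<open>w\<close> is zero-free; those two fibres are empty, while all others are infinite.\<close>

lemma exceptional_values: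
  assumes hol: "w holomorphic_on UNIV" and nz: "\<And>z. w z \<noteq> 0" and nc: "\<not> w constant_on UNIV"
    and f: "\<And>p. f p = Some (w (\<zeta> p))"
  shows "card {c. \<not> infinite {p. f p = c}} = 2"
proof -
  have "finite {p. f p = c} \<longleftrightarrow> c \<in> {None, Some 0}" for c
  proof (cases c)
    case None
    then show ?thesis by (simp add: f)
  next
    case (Some v)
    show ?thesis
    proof (cases "v = 0")
      case True
      then show ?thesis using Some nz by (simp add: f)
    next
      case False
      have "{z. w z = v} \<subseteq> \<zeta> ` {p. f p = c}"
      proof
        fix z assume "z \<in> {z. w z = v}"
        then have "L z \<in> {p. f p = c}" using Some by (simp add: f \<zeta>_L)
        then have "\<zeta> (L z) \<in> \<zeta> ` {p. f p = c}" by (rule imageI)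
        then show "z \<in> \<zeta> ` {p. f p = c}" by (simp only: \<zeta>_L)
      qed
      then have "infinite {p. f p = c}"
        using zero_free_entire_infinite_fibres[OF hol nz nc False] finite_subset by blast
      then show ?thesis using False Some by simp
    qed
  qed
  then have "{c. \<not> infinite {p. f p = c}} = {None, Some 0}" by blast
  then show ?thesis by simp
qed

section \<open>The Gauss curvature and its integral\<close>

lemma fff_conformal: "fff X u $ 1 $ 1 = W u * r" "fff X u $ 1 $ 2 = W u * s" "fff X u $ 2 $ 1 = W u * s" "fff X u $ 2 $ 2 = W u * t"
  by (simp_all add: fff_X E M G)

text \<open>If \<open>w1\<close> is constant then so are \<open>w2 = m / w1\<close> and, by
  \<open>W_eq\<close>, the conformal factor. The contrapositive supplies a nonconstant
  \<open>w1\<close> for a nonflat surface.\<close>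

lemma flat:
  assumes "w1 constant_on UNIV"
  shows "gauss_curvature X u = 0"
proof -
  obtain d where d: "\<And>z. w1 z = d" using assms by (auto simp: constant_on_def)
  then have "w2 z = m / d" for z using w_mult[of z] w_nz(1)[of z] by (auto simp: field_simps)
  then have "W (L z) = W (L 0)" for z using W_eq[of z] W_eq[of 0] by (simp add: d)
  then have Wc: "W u = W (L 0)" for u using L_\<zeta>[of u] by metis
  define \<rho> where "\<rho> = ln (W (L 0)) / 2"
  have e: "exp (2 * \<rho>) = W u" for u using W_pos[of "L 0"] Wc[of u] by (simp add: \<rho>_def)
  have "gauss_curvature X u * exp (2 * \<rho>) = - (t * 0 - 2 * s * 0 + r * 0)"
    by (rule gauss_curvature_conformal[where \<rho> = "\<lambda>_. \<rho>" and ?\<rho>1.0 = "\<lambda>_. 0" and ?\<rho>2.0 = "\<lambda>_. 0"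
      and ?\<rho>11.0 = "\<lambda>_. 0" and ?\<rho>12.0 = "\<lambda>_. 0" and ?\<rho>22.0 = "\<lambda>_. 0", OF _ _ _ _ det])
      (auto simp: e[symmetric] fff_conformal)
  then show ?thesis by simp
qed

text \<open>These say that \<zeta> is conformal for the constant metric. The first makes every
  holomorphic function of \<zeta> harmonic; the second says that the real and imaginary parts of
  \<zeta> have squared gradients adding up to 2.\<close>

lemma m_quadratic:
  "of_real t * m1 * m1 - 2 * of_real s * m1 * m2 + of_real r * m2 * m2 = 0"
  "t * (cmod m1)\<^sup>2 - 2 * s * Re (m1 * cnj m2) + r * (cmod m2)\<^sup>2 = 2"
proof -
  define q where "q = 1 / sqrt r"
  have q: "q * sqrt r = 1" using sqrt_r by (simp add: q_def)
  have m1: "Re m1 = 0" "Im m1 = - \<sigma> * sqrt r" and m2: "Re m2 = q" "Im m2 = - \<sigma> * s * q"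
    by (simp_all add: m1_def m2_def q_def)
  show "of_real t * m1 * m1 - 2 * of_real s * m1 * m2 + of_real r * m2 * m2 = 0"
  proof (rule complex_eqI)
    have "- t * (\<sigma> * sqrt r) * (\<sigma> * sqrt r) + 2 * s * (\<sigma> * sqrt r) * (\<sigma> * s * q) + r * (q * q - (\<sigma> * s * q) * (\<sigma> * s * q)) = 0"
      using q sqrt_r(2) \<sigma>_sq rt by algebra
    then show "Re (of_real t * m1 * m1 - 2 * of_real s * m1 * m2 + of_real r * m2 * m2) = Re 0"
      by (simp add: m1 m2 algebra_simps)
    have "2 * s * (\<sigma> * sqrt r) * q - 2 * r * q * (\<sigma> * s * q) = 0"
      using q sqrt_r(2) by algebra
    then show "Im (of_real t * m1 * m1 - 2 * of_real s * m1 * m2 + of_real r * m2 * m2) = Im 0"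
      by (simp add: m1 m2 algebra_simps)
  qed
  have "t * ((\<sigma> * sqrt r) * (\<sigma> * sqrt r)) - 2 * s * ((\<sigma> * sqrt r) * (\<sigma> * s * q)) + r * (q * q + (\<sigma> * s * q) * (\<sigma> * s * q)) = 2"
    using q sqrt_r(2) \<sigma>_sq rt by algebra
  then show "t * (cmod m1)\<^sup>2 - 2 * s * Re (m1 * cnj m2) + r * (cmod m2)\<^sup>2 = 2"
    unfolding cmod_power2 by (simp add: m1 m2 power2_eq_square)
qed

lemma Im_m: "Im (cnj m1 * m2) \<noteq> 0"
  using sqrt_r \<sigma> by (auto simp: m1_def m2_def)

lemma \<zeta>_der: "(\<zeta> has_derivative \<zeta>) (at u)"
proof -
  have "(\<zeta> has_derivative (\<lambda>h. of_real (h$1) * m1 + of_real (h$2) * m2)) (at u)"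
    unfolding \<zeta>_def[abs_def]
    by (intro has_derivative_add has_derivative_mult_left has_derivative_of_real
        bounded_linear_imp_has_derivative[OF bounded_linear_vec_nth])
  then show ?thesis by (simp add: \<zeta>_def[abs_def])
qed

lemma curvature_not_integrable:
  assumes nc: "\<not> w1 constant_on UNIV"
  shows "\<not> integrable (area_measure X) (gauss_curvature X)"
proof
  assume int: "integrable (area_measure X) (gauss_curvature X)"
  obtain g where holg: "g holomorphic_on UNIV" and g: "\<And>z. exp (g z) = w1 z"
    using holomorphic_logarithm_exists[of UNIV w1 0] w_holomorphic(1) w_nz(1) by auto
  \<comment> \<open>The shift by half a logarithm of \<open>m\<close> balances the two components:
    \<open>|w1|^2\<close> and \<open>|w2|^2\<close> become
    \<open>|m| exp (\<plusminus> 2 Re B)\<close>, so \<open>W\<close> turns into an even function of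
    \<open>Re B\<close>.\<close>
  define B where "B z = g z - Ln m / 2" for z
  have holB: "B holomorphic_on UNIV" unfolding B_def[abs_def] by (intro holomorphic_intros holg)
  have w1B: "w1 z = exp (B z) * exp (Ln m / 2)" for z
    unfolding B_def exp_diff g by simp
  have ncB: "\<not> B constant_on UNIV"
  proof
    assume "B constant_on UNIV"
    then obtain d where "\<And>z. B z = d" by (auto simp: constant_on_def)
    then show False using nc by (auto simp: constant_on_def w1B)
  qed
  have mm: "(cmod (exp (Ln m / 2)))\<^sup>2 = cmod m"
  proof -
    have "exp (Ln m / 2) * exp (Ln m / 2) = m" using m_nz by (simp flip: exp_add)
    then show ?thesis by (metis norm_mult power2_eq_square)
  qed
  define Y where "Y u = 2 * Re (B (\<zeta> u))" for u
  have n1: "(cmod (w1 (\<zeta> u)))\<^sup>2 = cmod m * exp (Y u)" for u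
  proof -
    have "(cmod (w1 (\<zeta> u)))\<^sup>2 = (exp (Re (B (\<zeta> u))))\<^sup>2 * cmod m"
      unfolding w1B norm_mult power_mult_distrib mm by simp
    then show ?thesis by (simp add: Y_def exp_double)
  qed
  have n2: "(cmod (w2 (\<zeta> u)))\<^sup>2 = cmod m * exp (- Y u)" for u
  proof -
    have "(cmod (w1 (\<zeta> u)))\<^sup>2 * (cmod (w2 (\<zeta> u)))\<^sup>2 = (cmod m)\<^sup>2"
      unfolding w_mult[of "\<zeta> u", symmetric] norm_mult power_mult_distrib ..
    moreover have "cmod m * exp (Y u) * (cmod m * exp (- Y u)) = (cmod m)\<^sup>2"
      by (simp add: power2_eq_square exp_minus)
    ultimately have "cmod m * exp (Y u) * (cmod (w2 (\<zeta> u)))\<^sup>2 = cmod m * exp (Y u) * (cmod m * exp (- Y u))"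
      unfolding n1 by (rule trans[OF _ sym])
    moreover have "cmod m * exp (Y u) \<noteq> 0" using m_nz by simp
    ultimately show ?thesis using mult_left_cancel[THEN iffD1] by blast
  qed
  define c where "c = (r - t) / N"
  have c: "c < 1" using N_gt N_pos by (simp add: c_def)
  have WY: "W u = N / 2 * (cosh (Y u) - c)" for u
  proof -
    have "2 * W u = N * (exp (Y u) + exp (- Y u)) / 2 + t - r"
      using W_eq[of "\<zeta> u"] unfolding L_\<zeta> n1 n2 N_def by (simp add: algebra_simps)
    moreover have "N * c = r - t" using N_pos by (simp add: c_def)
    moreover have "N / 2 * (cosh (Y u) - c) = (N * (exp (Y u) + exp (- Y u)) / 2 - N * c) / 2"
      unfolding cosh_field_def by (simp add: field_simps)
    ultimately show ?thesis by simp
  qed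
  have pos: "cosh y - c > 0" for y :: real using cosh_real_ge_1[of y] c by linarith
  \<comment> \<open>The derivative of \<open>y \<mapsto> ln (cosh y - c) / 2\<close>, so that the
    differential of the conformal exponent \<rho> below is \<open>\<phi> (Y)\<close> times that of
    \<open>Y\<close>.\<close>
  define \<phi> where "\<phi> y = sinh y / (2 * (cosh y - c))" for y :: real
  define \<phi>' where "\<phi>' y = (1 - c * cosh y) / (2 * (cosh y - c)\<^sup>2)" for y :: real
  have d\<phi>: "(\<phi> has_real_derivative \<phi>' y) (at y)" for y
  proof -
    have "(\<phi> has_real_derivative (cosh y * (2 * (cosh y - c)) - sinh y * (2 * sinh y)) / (2 * (cosh y - c) * (2 * (cosh y - c)))) (at y)"
      unfolding \<phi>_def[abs_def] using pos[of y] by (auto intro!: derivative_eq_intros)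
    moreover have "(cosh y * (2 * (cosh y - c)) - sinh y * (2 * sinh y)) / (2 * (cosh y - c) * (2 * (cosh y - c))) = \<phi>' y"
    proof -
      have "(cosh y)\<^sup>2 - (sinh y)\<^sup>2 = 1" by (rule hyperbolic_pythagoras)
      then have eq: "cosh y * (2 * (cosh y - c)) - sinh y * (2 * sinh y) = 2 * (1 - c * cosh y)" by algebra
      have "2 * x / (2 * d * (2 * d)) = x / (2 * d\<^sup>2)" for x d :: real by (simp add: power2_eq_square)
      then show ?thesis unfolding eq \<phi>'_def .
    qed
    ultimately show ?thesis by simp
  qed
  define \<rho> where "\<rho> u = ln (N / 2 * (cosh (Y u) - c)) / 2" for u
  have e\<rho>: "exp (2 * \<rho> u) = W u" for u
    using W_pos[of u] unfolding \<rho>_def WY[symmetric] by simp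
  define B1 where "B1 = deriv B"
  define B2 where "B2 = deriv B1"
  have holB1: "B1 holomorphic_on UNIV" unfolding B1_def using holB by (intro holomorphic_deriv) auto
  have dB: "(B has_derivative (\<lambda>h. B1 z * h)) (at z)" "(B1 has_derivative (\<lambda>h. B2 z * h)) (at z)" for z
    using holomorphic_derivI[OF holB, of z] holomorphic_derivI[OF holB1, of z]
    by (simp_all add: B1_def B2_def has_field_derivative_def)
  define Y1 where "Y1 n u = 2 * Re (B1 (\<zeta> u) * n)" for n u
  define Y2 where "Y2 n k u = 2 * Re (B2 (\<zeta> u) * n * k)" for n k u
  have dY: "(Y has_derivative (\<lambda>h. h$1 * Y1 m1 u + h$2 * Y1 m2 u)) (at u)" for u
    unfolding Y_def[abs_def]
    by (rule has_derivative_eq_rhs[OF has_derivative_mult_right[OF bounded_linear.has_derivative[OF bounded_linear_Re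
      has_derivative_compose[OF \<zeta>_der dB(1)]]]])
      (simp add: fun_eq_iff Y1_def \<zeta>_def algebra_simps)
  have dY1: "(Y1 n has_derivative (\<lambda>h. h$1 * Y2 n m1 u + h$2 * Y2 n m2 u)) (at u)" for n u
    unfolding Y1_def[abs_def]
    by (rule has_derivative_eq_rhs[OF has_derivative_mult_right[OF bounded_linear.has_derivative[OF bounded_linear_Re
      has_derivative_mult_left[OF has_derivative_compose[OF \<zeta>_der dB(2)]]]]])
      (simp add: fun_eq_iff Y2_def \<zeta>_def algebra_simps)
  have d\<rho>: "(\<rho> has_derivative (\<lambda>h. h$1 * (\<phi> (Y u) * Y1 m1 u) + h$2 * (\<phi> (Y u) * Y1 m2 u))) (at u)" for u
  proof -
    have "((\<lambda>y. ln (N / 2 * (cosh y - c)) / 2) has_real_derivative \<phi> y) (at y)" for y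
      unfolding \<phi>_def using pos[of y] N_pos by (auto intro!: derivative_eq_intros simp: field_simps)
    from has_derivative_compose[OF dY this[unfolded has_field_derivative_def]]
    show ?thesis unfolding \<rho>_def[abs_def] by (rule has_derivative_eq_rhs) (simp add: fun_eq_iff algebra_simps)
  qed
  have d\<rho>1: "((\<lambda>u. \<phi> (Y u) * Y1 n u) has_derivative (\<lambda>h. h$1 * (\<phi>' (Y u) * Y1 m1 u * Y1 n u + \<phi> (Y u) * Y2 n m1 u)
      + h$2 * (\<phi>' (Y u) * Y1 m2 u * Y1 n u + \<phi> (Y u) * Y2 n m2 u))) (at u)" for n u
    by (rule has_derivative_eq_rhs[OF has_derivative_mult[OF has_derivative_compose[OF dY d\<phi>[unfolded has_field_derivative_def]] dY1]])
      (simp add: fun_eq_iff algebra_simps)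
  \<comment> \<open>The curvature lemma expects one common function for both mixed derivatives; this
    identifies the two expressions.\<close>
  have sym: "\<phi>' (Y u) * Y1 m1 u * Y1 m2 u + \<phi> (Y u) * Y2 m2 m1 u = \<phi>' (Y u) * Y1 m2 u * Y1 m1 u + \<phi> (Y u) * Y2 m1 m2 u" for u
    by (simp add: Y2_def algebra_simps)
  have K: "gauss_curvature X u * exp (2 * \<rho> u) = - (t * (\<phi>' (Y u) * Y1 m1 u * Y1 m1 u + \<phi> (Y u) * Y2 m1 m1 u)
      - 2 * s * (\<phi>' (Y u) * Y1 m2 u * Y1 m1 u + \<phi> (Y u) * Y2 m1 m2 u)
      + r * (\<phi>' (Y u) * Y1 m2 u * Y1 m2 u + \<phi> (Y u) * Y2 m2 m2 u))" for u
    by (rule gauss_curvature_conformal[OF _ _ _ _ det d\<rho> d\<rho>1 d\<rho>1[where n = m2, unfolded sym]]) (simp_all add: e\<rho> fff_conformal)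
  have harm: "t * Y2 m1 m1 u - 2 * s * Y2 m1 m2 u + r * Y2 m2 m2 u = 0" for u
  proof -
    have "t * Y2 m1 m1 u - 2 * s * Y2 m1 m2 u + r * Y2 m2 m2 u
      = 2 * Re (B2 (\<zeta> u) * (of_real t * m1 * m1 - 2 * of_real s * m1 * m2 + of_real r * m2 * m2))"
      unfolding Y2_def by (simp add: algebra_simps)
    then show ?thesis unfolding m_quadratic by simp
  qed
  \<comment> \<open>The squared gradient of \<open>Y = 2 Re (B \<circ> \<zeta>)\<close> in the
    constant metric. In the polarized product the holomorphic part is killed by the first half of
    \<open>m_quadratic\<close>, and the Hermitian part is evaluated by the second.\<close>
  have grad: "t * Y1 m1 u * Y1 m1 u - 2 * s * Y1 m2 u * Y1 m1 u + r * Y1 m2 u * Y1 m2 u = 4 * (cmod (B1 (\<zeta> u)))\<^sup>2" for u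
  proof -
    let ?q = "B1 (\<zeta> u)"
    have polar: "(2 * Re (?q * x)) * (2 * Re (?q * y)) = 2 * Re (?q\<^sup>2 * (x * y)) + 2 * (cmod ?q)\<^sup>2 * Re (x * cnj y)" for x y
      unfolding cmod_power2 by (simp add: power2_eq_square algebra_simps)
    have "t * Y1 m1 u * Y1 m1 u - 2 * s * Y1 m2 u * Y1 m1 u + r * Y1 m2 u * Y1 m2 u
       = t * (Y1 m1 u * Y1 m1 u) - 2 * s * (Y1 m1 u * Y1 m2 u) + r * (Y1 m2 u * Y1 m2 u)" by simp
    also have "\<dots> = 2 * Re (?q\<^sup>2 * (of_real t * m1 * m1 - 2 * of_real s * m1 * m2 + of_real r * m2 * m2))
       + 2 * (cmod ?q)\<^sup>2 * (t * (cmod m1)\<^sup>2 - 2 * s * Re (m1 * cnj m2) + r * (cmod m2)\<^sup>2)"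
      unfolding Y1_def polar cmod_power2[of m1] cmod_power2[of m2] by (simp add: power2_eq_square algebra_simps)
    finally show ?thesis unfolding m_quadratic by simp
  qed
  \<comment> \<open>\<open>k x = 2 \<phi>' (2 x)\<close>, adapted to \<open>Y = 2 Re B\<close>; at
    the origin it equals \<open>1 / (1 - c)\<close>.\<close>
  define k where "k x = (1 - c * cosh (2 * x)) / (cosh (2 * x) - c)\<^sup>2" for x :: real
  have KW: "gauss_curvature X u * W u = - 2 * ((cmod (deriv B (\<zeta> u)))\<^sup>2 * k (Re (B (\<zeta> u))))" for u
  proof -
    have "gauss_curvature X u * W u = - (\<phi>' (Y u) * (t * Y1 m1 u * Y1 m1 u - 2 * s * Y1 m2 u * Y1 m1 u + r * Y1 m2 u * Y1 m2 u)
        + \<phi> (Y u) * (t * Y2 m1 m1 u - 2 * s * Y2 m1 m2 u + r * Y2 m2 m2 u))"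
      using K[of u] unfolding e\<rho> by (simp add: algebra_simps)
    also have "\<dots> = - (4 * (cmod (B1 (\<zeta> u)))\<^sup>2 * \<phi>' (Y u))" unfolding grad harm by simp
    also have "\<dots> = - 2 * ((cmod (deriv B (\<zeta> u)))\<^sup>2 * k (Re (B (\<zeta> u))))"
      by (simp add: \<phi>'_def k_def Y_def B1_def)
    finally show ?thesis .
  qed
  have "isCont k 0"
    unfolding k_def[abs_def] using c by (auto intro!: continuous_intros)
  moreover have "k 0 \<noteq> 0" using c by (simp add: k_def)
  moreover have "(\<lambda>u. (cmod (deriv B (\<zeta> u)))\<^sup>2 * k (Re (B (\<zeta> u)))) absolutely_integrable_on UNIV"
  proof -
    have sd: "sqrt (det (fff X u)) = W u" for u using W_pos[of u] by (simp add: det_fff)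
    have "continuous_on UNIV W" using W_der by (auto intro!: continuous_at_imp_continuous_on has_derivative_continuous)
    then have Wm: "W \<in> borel_measurable lborel" using borel_measurable_continuous_onI by simp
    \<comment> \<open>Measurability of the curvature is taken from the assumed integrability, since
      a density leaves the measurable sets unchanged.\<close>
    have Km: "gauss_curvature X \<in> borel_measurable lborel"
      using borel_measurable_integrable[OF int] by (simp add: area_measure_def)
    have "integrable lborel (\<lambda>u. W u *\<^sub>R gauss_curvature X u)"
      using int unfolding area_measure_def sd
      by (subst (asm) integrable_density) (use Km Wm W_pos in \<open>auto intro: less_imp_le\<close>)
    then have "integrable lborel (\<lambda>u. (- 1/2) * (W u *\<^sub>R gauss_curvature X u))" by (rule integrable_mult_right)
    moreover have eq: "(- 1/2) * (W u *\<^sub>R gauss_curvature X u) = (cmod (deriv B (\<zeta> u)))\<^sup>2 * k (Re (B (\<zeta> u)))" for u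
      using KW[of u] by (simp add: mult.commute)
    ultimately have "integrable lborel (\<lambda>u. (cmod (deriv B (\<zeta> u)))\<^sup>2 * k (Re (B (\<zeta> u))))"
      by (simp only: eq)
    then show ?thesis
      unfolding set_integrable_def by (simp add: integrable_completion)
  qed
  ultimately show False
    using entire_pullback_not_integrable[OF holB ncB Im_m] unfolding \<zeta>_def[abs_def] by blast
qed

end

theorem theorem4p9:
  fixes F :: "real^2 \<Rightarrow> real^2" and \<sigma> :: real
  assumes "smooth_on UNIV F"
    and "spacelike (graph_param F)"
    and "stationary (graph_param F)"
    and "\<sigma> = 1 \<or> \<sigma> = -1"
  shows "complete_surface (graph_param F) \<and>
    degenerate_stationary_elliptic \<sigma> (graph_param F) \<and>
    (nonflat (graph_param F) \<longrightarrow>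
      card {c. \<not> infinite {p. psi1 \<sigma> (graph_param F) p = c}} = 2 \<and>
      card {c. \<not> infinite {p. psi2 \<sigma> (graph_param F) p = c}} = 2 \<and>
      \<not> integrable (area_measure (graph_param F)) (gauss_curvature (graph_param F)))"
proof -
  interpret stationary_graph F
    by unfold_locales (fact assms)+
  obtain r s t where rst: "r > 0" "r * t - s\<^sup>2 = 1" "\<And>u. E u = r * W u" "\<And>u. M u = s * W u" "\<And>u. G u = t * W u"
    "\<And>u. t *\<^sub>R F11 u - (2 * s) *\<^sub>R F12 u + r *\<^sub>R F22 u = 0"
    by (rule conformal_constants) blast
  interpret conformal_graph F r s t \<sigma>
    by unfold_locales (fact rst assms)+
  have "card {c. \<not> infinite {p. psi1 \<sigma> X p = c}} = 2 \<and> card {c. \<not> infinite {p. psi2 \<sigma> X p = c}} = 2 \<and>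
      \<not> integrable (area_measure X) (gauss_curvature X)" if "nonflat X"
  proof (intro conjI)
    have nc: "\<not> w1 constant_on UNIV" using that flat by (auto simp: nonflat_def)
    have nc2: "\<not> w2 constant_on UNIV"
    proof
      assume "w2 constant_on UNIV"
      then obtain d where "\<And>z. w2 z = d" by (auto simp: constant_on_def)
      then have "w1 z = m / d" for z using w_mult[of z] w_nz(2)[of z] by (auto simp: field_simps)
      then show False using nc by (auto simp: constant_on_def)
    qed
    show "card {c. \<not> infinite {p. psi1 \<sigma> X p = c}} = 2"
      by (rule exceptional_values[OF w_holomorphic(1) w_nz(1) nc psi_eq(1)])
    show "card {c. \<not> infinite {p. psi2 \<sigma> X p = c}} = 2"
      by (rule exceptional_values[OF w_holomorphic(2) w_nz(2) nc2 psi_eq(2)])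
    show "\<not> integrable (area_measure X) (gauss_curvature X)"
      by (rule curvature_not_integrable[OF nc])
  qed
  then show ?thesis using complete elliptic by blast
qed

end
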